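(* Let $T>0$. Suppose that $b(t,\cdot):\mathcal H\to\mathcal H$ is globally Lipschitz uniformly in $t\in[0,T]$, that $\beta\in C([0,T])$ with $0<\beta_-\le\beta(t)\le\beta_+$, and that $\sigma(x)=D(x)^{1/2}Q^{1/2}$ is Lipschitz as a map from $\mathcal H$ into the Hilbert–Schmidt operators $\mathcal L_2(\mathcal H)$. Then for each $X_0\in L^2(\Omega;\mathcal H)$ there is a unique strong solution $X\in L^2(\Omega;C([0,T];\mathcal H))$ of the stochastic differential equation $$dX_t=b(t,X_t)\,dt+\sqrt{\beta(t)}\,D(X_t)^{1/2}Q^{1/2}\,dW_t$$ with initial value $X_0$. Moreover, with a finite constant $C_T^{\mathrm{fwd}}$, $$\mathbb E\sup_{t\le T}\|X_t\|^2\le C_T^{\mathrm{fwd}}\,(1+\mathbb E\|X_0\|^2).$$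
   Context: $\mathcal H$ is a separable real Hilbert space. $Q$ is the trace-class covariance operator of the Gaussian measure $\mu_0=\mathcal N(0,Q)$, with $Qe_k=q_ke_k$ for an orthonormal basis $(e_k)$, $q_k>0$, $\sum_kq_k<\infty$. For each $x\in\mathcal H$ the operator $D(x)$ is self-adjoint, positive and bounded, with $d_-I\le D(x)\le d_+I$ for constants $0<d_-\le d_+<\infty$, and $x\mapsto D(x)^{1/2}$ is globally Lipschitz in the operator norm. $W$ is a cylindrical Wiener process in $\mathcal H$ on the underlying probability space $\Omega$.
   Formalization: The formal statement also assumes that t ↦ b(t,x) is Lebesgue integrable on [0,T] for each x (without this, b(t,x)=v/t admits no solution), and takes X_0 to be measurable at time 0 for a fixed complete filtration to which W is adapted. *)

theory Defs
  imports "HOL-Probability.Probability"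
begin

section \<open>Operators on a separable real Hilbert space\<close>

text \<open>The Hilbert space is a type \<open>'h\<close> of sort
  \<open>{real_inner, banach, second_countable_topology}\<close>. Orthonormal bases are indexed by a set
  \<open>I\<close> of natural numbers, so that finite-dimensional spaces are not excluded.\<close>

definition orthonormal_basis :: "nat set \<Rightarrow> (nat \<Rightarrow> 'h::real_inner) \<Rightarrow> bool" where
  "orthonormal_basis I e \<longleftrightarrow>
     (\<forall>j\<in>I. \<forall>k\<in>I. e j \<bullet> e k = (if j = k then 1 else 0)) \<and> closure (span (e ` I)) = UNIV"

definition selfadjoint_op :: "('h::real_inner \<Rightarrow>\<^sub>L 'h) \<Rightarrow> bool" where
  "selfadjoint_op A \<longleftrightarrow> (\<forall>x y. A x \<bullet> y = x \<bullet> A y)"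

definition positive_op :: "('h::real_inner \<Rightarrow>\<^sub>L 'h) \<Rightarrow> bool" where
  "positive_op A \<longleftrightarrow> selfadjoint_op A \<and> (\<forall>x. 0 \<le> A x \<bullet> x)"

text \<open>On a Hilbert space a positive operator has exactly one positive square root, so the
  description is proper whenever \<open>A\<close> is positive.\<close>

definition sqrt_op :: "('h::real_inner \<Rightarrow>\<^sub>L 'h) \<Rightarrow> ('h \<Rightarrow>\<^sub>L 'h)" where
  "sqrt_op A = (THE B. positive_op B \<and> B o\<^sub>L B = A)"

text \<open>The Hilbert--Schmidt class and norm, computed in an orthonormal basis; neither depends on
  the basis.\<close>

definition hilbert_schmidt :: "nat set \<Rightarrow> (nat \<Rightarrow> 'h::real_inner) \<Rightarrow> ('h \<Rightarrow>\<^sub>L 'h) \<Rightarrow> bool" where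
  "hilbert_schmidt I e A \<longleftrightarrow> (\<lambda>k. (norm (A (e k)))\<^sup>2) summable_on I"

definition hs_norm :: "nat set \<Rightarrow> (nat \<Rightarrow> 'h::real_inner) \<Rightarrow> ('h \<Rightarrow>\<^sub>L 'h) \<Rightarrow> real" where
  "hs_norm I e A = sqrt (\<Sum>\<^sub>\<infinity>k\<in>I. (norm (A (e k)))\<^sup>2)"

definition lipschitz_into_HS ::
    "nat set \<Rightarrow> (nat \<Rightarrow> 'h::real_inner) \<Rightarrow> ('h \<Rightarrow> ('h \<Rightarrow>\<^sub>L 'h)) \<Rightarrow> bool" where
  "lipschitz_into_HS I e \<sigma> \<longleftrightarrow>
     (\<forall>x. hilbert_schmidt I e (\<sigma> x)) \<and>
     (\<exists>L. \<forall>x y. hs_norm I e (\<sigma> x - \<sigma> y) \<le> L * dist x y)"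

section \<open>Filtrations and cylindrical Wiener processes\<close>

text \<open>Only the times in \<open>{0..T}\<close> matter; a filtration on \<open>{0..T}\<close> is extended constantly to the
  other reals. Right-continuity is not required, so that the completed filtration generated by
  \<open>X\<^sub>0\<close> and \<open>W\<close> is an instance.\<close>

definition complete_filtration :: "'w measure \<Rightarrow> (real \<Rightarrow> 'w measure) \<Rightarrow> bool" where
  "complete_filtration M F \<longleftrightarrow>
     filtration (space M) F \<and> (\<forall>t. sets (F t) \<subseteq> sets M) \<and>
     (\<forall>N\<in>null_sets M. \<forall>A\<subseteq>N. \<forall>t\<ge>0. A \<in> sets (F t))"

text \<open>\<open>W t h\<close> is the value at time \<open>t\<close> of the cylindrical process tested against \<open>h\<close>, that is
  \<open>\<langle>W\<^sub>t, h\<rangle>\<close>: for each \<open>h\<close> a Brownian motion relative to \<open>F\<close> of variance \<open>t * (norm h)\<^sup>2\<close>,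
  almost surely linear in \<open>h\<close>.\<close>

definition cylindrical_wiener ::
    "'w measure \<Rightarrow> (real \<Rightarrow> 'w measure) \<Rightarrow> real \<Rightarrow> (real \<Rightarrow> 'h::real_inner \<Rightarrow> 'w \<Rightarrow> real) \<Rightarrow> bool" where
  "cylindrical_wiener M F T W \<longleftrightarrow>
     (\<forall>t\<in>{0..T}. \<forall>h. W t h \<in> borel_measurable (F t)) \<and>
     (\<forall>h. AE \<omega> in M. W 0 h \<omega> = 0) \<and>
     (\<forall>h. AE \<omega> in M. continuous_on {0..T} (\<lambda>t. W t h \<omega>)) \<and>
     (\<forall>t\<in>{0..T}. \<forall>a b g h. AE \<omega> in M. W t (a *\<^sub>R g + b *\<^sub>R h) \<omega> = a * W t g \<omega> + b * W t h \<omega>) \<and>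
     (\<forall>s t h. 0 \<le> s \<and> s < t \<and> t \<le> T \<longrightarrow>
        prob_space.indep_set M (sets (F s))
          (sets (vimage_algebra (space M) (\<lambda>\<omega>. W t h \<omega> - W s h \<omega>) borel)) \<and>
        (h \<noteq> 0 \<longrightarrow> distributed M lborel (\<lambda>\<omega>. W t h \<omega> - W s h \<omega>)
                       (normal_density 0 (sqrt (t - s) * norm h))))"

section \<open>The stochastic integral\<close>

text \<open>An elementary process is a finite sum of terms \<open>1\<^bsub>(s,u]\<^esub>(t) \<langle>h, \<cdot>\<rangle> \<xi>(\<omega>)\<close>, each encoded as
  \<open>(s, u, h, \<xi>)\<close>, with \<open>\<xi>\<close> bounded, \<open>'h\<close>-valued and measurable at time \<open>s\<close>; its integral up to
  time \<open>t\<close> is the sum of the terms \<open>\<langle>W\<^bsub>u\<and>t\<^esub> - W\<^bsub>s\<and>t\<^esub>, h\<rangle> \<xi>\<close>.\<close>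

type_synonym ('w, 'h) elementary = "(real \<times> real \<times> 'h \<times> ('w \<Rightarrow> 'h)) list"

definition elementary_process ::
    "'w measure \<Rightarrow> (real \<Rightarrow> 'w measure) \<Rightarrow> real \<Rightarrow>
     ('w, 'h::{real_normed_vector, second_countable_topology}) elementary \<Rightarrow> bool" where
  "elementary_process M F T Z \<longleftrightarrow>
     (\<forall>(s, u, h, \<xi>)\<in>set Z. 0 \<le> s \<and> s \<le> u \<and> u \<le> T \<and>
        \<xi> \<in> borel_measurable (F s) \<and> (\<exists>B. \<forall>\<omega>\<in>space M. norm (\<xi> \<omega>) \<le> B))"

definition elementary_value ::
    "('w, 'h::real_inner) elementary \<Rightarrow> real \<Rightarrow> 'w \<Rightarrow> ('h \<Rightarrow>\<^sub>L 'h)" where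
  "elementary_value Z t \<omega> =
     (\<Sum>(s, u, h, \<xi>)\<leftarrow>Z. indicat_real {s<..u} t *\<^sub>R (blinfun_scaleR_left (\<xi> \<omega>) o\<^sub>L blinfun_inner_right h))"

definition elementary_integral ::
    "(real \<Rightarrow> 'h \<Rightarrow> 'w \<Rightarrow> real) \<Rightarrow> ('w, 'h::real_inner) elementary \<Rightarrow> real \<Rightarrow> 'w \<Rightarrow> 'h" where
  "elementary_integral W Z t \<omega> =
     (\<Sum>(s, u, h, \<xi>)\<leftarrow>Z. (W (min u t) h \<omega> - W (min s t) h \<omega>) *\<^sub>R \<xi> \<omega>)"

text \<open>The elements of \<open>L\<^sup>2(\<Omega>; C([0,T]; H))\<close> that are adapted to \<open>F\<close>, as processes.\<close>

definition continuous_adapted ::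
    "'w measure \<Rightarrow> (real \<Rightarrow> 'w measure) \<Rightarrow> real \<Rightarrow> (real \<Rightarrow> 'w \<Rightarrow> 'h::real_normed_vector) \<Rightarrow> bool" where
  "continuous_adapted M F T X \<longleftrightarrow>
     (\<forall>t\<in>{0..T}. X t \<in> borel_measurable (F t)) \<and>
     (\<forall>\<omega>\<in>space M. continuous_on {0..T} (\<lambda>t. X t \<omega>))"

definition sup_sq_moment ::
    "'w measure \<Rightarrow> real \<Rightarrow> (real \<Rightarrow> 'w \<Rightarrow> 'h::real_normed_vector) \<Rightarrow> ennreal" where
  "sup_sq_moment M T X = (\<integral>\<^sup>+\<omega>. (SUP t\<in>{0..T}. ennreal ((norm (X t \<omega>))\<^sup>2)) \<partial>M)"

definition L2_continuous_adapted ::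
    "'w measure \<Rightarrow> (real \<Rightarrow> 'w measure) \<Rightarrow> real \<Rightarrow> (real \<Rightarrow> 'w \<Rightarrow> 'h::real_normed_vector) \<Rightarrow> bool" where
  "L2_continuous_adapted M F T X \<longleftrightarrow> continuous_adapted M F T X \<and> sup_sq_moment M T X < \<infinity>"

definition hs_sq_moment ::
    "nat set \<Rightarrow> (nat \<Rightarrow> 'h::real_inner) \<Rightarrow> 'w measure \<Rightarrow> real \<Rightarrow> (real \<Rightarrow> 'w \<Rightarrow> ('h \<Rightarrow>\<^sub>L 'h)) \<Rightarrow> ennreal" where
  "hs_sq_moment I e M T \<Phi> =
     (\<integral>\<^sup>+\<omega>. (\<integral>\<^sup>+t\<in>{0..T}. ennreal ((hs_norm I e (\<Phi> t \<omega>))\<^sup>2) \<partial>lborel) \<partial>M)"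

text \<open>Measurability of operator-valued processes is strong measurability, i.e. measurability of
  \<open>\<Phi> h\<close> for each vector \<open>h\<close>.\<close>

definition L2_integrand ::
    "nat set \<Rightarrow> (nat \<Rightarrow> 'h::real_inner) \<Rightarrow> 'w measure \<Rightarrow> (real \<Rightarrow> 'w measure) \<Rightarrow> real \<Rightarrow>
     (real \<Rightarrow> 'w \<Rightarrow> ('h \<Rightarrow>\<^sub>L 'h)) \<Rightarrow> bool" where
  "L2_integrand I e M F T \<Phi> \<longleftrightarrow>
     (\<forall>h. (\<lambda>(t, \<omega>). \<Phi> t \<omega> h) \<in> borel_measurable (restrict_space lborel {0..T} \<Otimes>\<^sub>M M)) \<and>
     (\<forall>t\<in>{0..T}. \<forall>h. (\<lambda>\<omega>. \<Phi> t \<omega> h) \<in> borel_measurable (F t)) \<and>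
     (\<forall>t\<in>{0..T}. \<forall>\<omega>\<in>space M. hilbert_schmidt I e (\<Phi> t \<omega>)) \<and>
     hs_sq_moment I e M T \<Phi> < \<infinity>"

text \<open>The process \<open>J\<close> is the Ito integral \<open>t \<mapsto> \<integral>\<^sub>0\<^sup>t \<Phi>\<^sub>s dW\<^sub>s\<close>: the limit in
  \<open>L\<^sup>2(\<Omega>; C([0,T]; H))\<close> of the integrals of elementary processes that approximate \<open>\<Phi>\<close> in
  \<open>L\<^sup>2(\<Omega> \<times> [0,T]; L\<^sub>2(H))\<close>. By the Ito isometry \<open>J\<close> is determined up to
  indistinguishability.\<close>

definition has_stochastic_integral ::
    "nat set \<Rightarrow> (nat \<Rightarrow> 'h) \<Rightarrow> 'w measure \<Rightarrow> (real \<Rightarrow> 'w measure) \<Rightarrow> real \<Rightarrow>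
     (real \<Rightarrow> 'h \<Rightarrow> 'w \<Rightarrow> real) \<Rightarrow> (real \<Rightarrow> 'w \<Rightarrow> ('h \<Rightarrow>\<^sub>L 'h)) \<Rightarrow>
     (real \<Rightarrow> 'w \<Rightarrow> 'h::{real_inner, second_countable_topology}) \<Rightarrow> bool" where
  "has_stochastic_integral I e M F T W \<Phi> J \<longleftrightarrow>
     L2_integrand I e M F T \<Phi> \<and> L2_continuous_adapted M F T J \<and>
     (\<exists>Z :: nat \<Rightarrow> ('w, 'h) elementary.
        (\<forall>n. elementary_process M F T (Z n)) \<and>
        (\<lambda>n. hs_sq_moment I e M T (\<lambda>t \<omega>. \<Phi> t \<omega> - elementary_value (Z n) t \<omega>)) \<longlonglongrightarrow> 0 \<and>
        (\<lambda>n. sup_sq_moment M T (\<lambda>t \<omega>. J t \<omega> - elementary_integral W (Z n) t \<omega>)) \<longlonglongrightarrow> 0)"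

section \<open>Strong solutions\<close>

text \<open>Strong solutions of \<open>dX = b(t,X) dt + \<Sigma>(t,X) dW\<close>, \<open>X(0) = X\<^sub>0\<close>, on \<open>[0,T]\<close> that lie in
  \<open>L\<^sup>2(\<Omega>; C([0,T]; H))\<close>. Since \<open>LINT\<close> is 0 for non-integrable integrands, integrability of
  the drift is required explicitly.\<close>

definition strong_solution ::
    "nat set \<Rightarrow> (nat \<Rightarrow> 'h) \<Rightarrow> 'w measure \<Rightarrow> (real \<Rightarrow> 'w measure) \<Rightarrow> real \<Rightarrow>
     (real \<Rightarrow> 'h \<Rightarrow> 'w \<Rightarrow> real) \<Rightarrow> (real \<Rightarrow> 'h \<Rightarrow> 'h) \<Rightarrow> (real \<Rightarrow> 'h \<Rightarrow> ('h \<Rightarrow>\<^sub>L 'h)) \<Rightarrow>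
     ('w \<Rightarrow> 'h) \<Rightarrow> (real \<Rightarrow> 'w \<Rightarrow> 'h::{real_inner, banach, second_countable_topology}) \<Rightarrow> bool" where
  "strong_solution I e M F T W b \<Sigma> X0 X \<longleftrightarrow>
     L2_continuous_adapted M F T X \<and>
     (\<exists>J. has_stochastic_integral I e M F T W (\<lambda>t \<omega>. \<Sigma> t (X t \<omega>)) J \<and>
        (AE \<omega> in M. set_integrable lborel {0..T} (\<lambda>s. b s (X s \<omega>)) \<and>
           (\<forall>t\<in>{0..T}. X t \<omega> = X0 \<omega> + (LINT s:{0..t}|lborel. b s (X s \<omega>)) + J t \<omega>)))"

end

theory Submission
  imports Defs
begin

text \<open>The solution is the limit of the Picard iterates
  \<open>X\<^sup>n\<^sup>+\<^sup>1 = X\<^sub>0 + \<integral>b(s, X\<^sup>n) ds + \<integral>\<surd>\<beta> \<sigma>(X\<^sup>n) dW\<close>. By Doob's maximal inequality and the Ito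
  isometry, one iteration satisfies
  \<open>E sup\<^bsub>s\<le>t\<^esub> \<parallel>X' - Y'\<parallel>\<^sup>2 \<le> C \<integral>\<^sub>0\<^sup>t E sup\<^bsub>r\<le>s\<^esub> \<parallel>X - Y\<parallel>\<^sup>2 ds\<close>; measuring with the weight
  \<open>exp (16 C t)\<close> turns this into a contraction by the factor \<open>1/16\<close>. Uniqueness and the moment
  bound are the same estimate applied to two solutions, respectively to the solution and to one
  iterate of the zero process, followed by Gronwall's argument. Doob's inequality is obtained by
  integrating a pathwise inequality for running maxima, and the integrands, whose paths are
  continuous in the Hilbert--Schmidt norm, are approximated by freezing them on uniform time
  grids.\<close>

section \<open>Hilbert--Schmidt operators\<close>

text \<open>All moments and distances live in \<open>ennreal\<close>: squared suprema,
  Hilbert--Schmidt sums and their integrals then exist without side conditions, at the price of a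
  factor 2 in each triangle inequality for squares. \<open>hsq\<close> is the squared
  Hilbert--Schmidt norm in this form. Three obstacles shape the rest. The integral is a relation
  that fixes a process only up to indistinguishability, so an iteration step is a relation too,
  iterates come from dependent choice, and the limit is a fixed point only almost surely. Wiener
  paths are continuous only almost surely, while solutions must have all paths continuous, so
  processes are redefined on null sets; adaptedness survives because \<open>F t\<close> contains the
  null sets for \<open>0 \<le> t\<close>. Finally, small moments of increments must yield a limit
  with continuous paths: the rate \<open>(1/16)^n\<close> of squared distances leaves room to
  multiply by \<open>4^n\<close> and still sum, whence almost surely increments of order
  \<open>(1/2)^n\<close> uniformly in time. The same rate is imposed on the subsequence that defines
  the integral.\<close>

definition hsq :: "nat set \<Rightarrow> (nat \<Rightarrow> 'h::real_inner) \<Rightarrow> ('h \<Rightarrow>\<^sub>L 'h) \<Rightarrow> ennreal" where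
  "hsq I e A = (\<Sum>k. ennreal (if k \<in> I then (norm (A (e k)))\<^sup>2 else 0))"

text \<open>Bridge from \<open>infsum\<close> over \<open>I\<close>, the language of
  \<open>hs_norm\<close>, to series over all naturals padded by 0, where sums and measurability are
  unconditional. The padding treats finite and infinite \<open>I\<close> alike.\<close>

lemma summable_on_iff_ennreal_suminf:
  fixes f :: "nat \<Rightarrow> real"
  assumes "\<And>k. k \<in> I \<Longrightarrow> 0 \<le> f k"
  shows "f summable_on I \<longleftrightarrow> (\<Sum>k. ennreal (if k \<in> I then f k else 0)) < \<infinity>"
    and "f summable_on I \<Longrightarrow> ennreal (infsum f I) = (\<Sum>k. ennreal (if k \<in> I then f k else 0))"
proof -
  let ?g = "\<lambda>k. if k \<in> I then f k else 0"
  have g0: "\<And>k. 0 \<le> ?g k" using assms by auto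
  have "f summable_on I \<longleftrightarrow> ?g summable_on UNIV"
    by (rule summable_on_cong_neutral) auto
  also have "\<dots> \<longleftrightarrow> summable ?g"
    by (rule summable_on_UNIV_nonneg_real_iff) (use g0 in auto)
  finally have iff: "f summable_on I \<longleftrightarrow> summable ?g" .
  show "f summable_on I \<longleftrightarrow> (\<Sum>k. ennreal (?g k)) < \<infinity>"
  proof
    assume "f summable_on I"
    then have "suminf (\<lambda>k. ennreal (?g k)) = ennreal (suminf ?g)"
      using iff g0 by (intro suminf_ennreal2) auto
    then show "(\<Sum>k. ennreal (?g k)) < \<infinity>" by simp
  next
    assume "(\<Sum>k. ennreal (?g k)) < \<infinity>"
    then have "(\<Sum>k. ennreal (?g k)) \<noteq> top" by auto
    from summable_suminf_not_top[OF g0 this] show "f summable_on I" using iff by simp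
  qed
  assume "f summable_on I"
  then have s: "summable ?g" using iff by simp
  have "infsum f I = infsum ?g UNIV"
    by (rule infsum_cong_neutral) auto
  also have "\<dots> = suminf ?g"
    using norm_summable_imp_has_sum[of ?g "suminf ?g"] s g0
    by (simp add: infsumI summable_sums)
  finally show "ennreal (infsum f I) = (\<Sum>k. ennreal (?g k))"
    using suminf_ennreal2[OF g0 s] by simp
qed

lemma hilbert_schmidt_iff_hsq: "hilbert_schmidt I e A \<longleftrightarrow> hsq I e A < \<infinity>"
  unfolding hilbert_schmidt_def hsq_def by (rule summable_on_iff_ennreal_suminf) simp

text \<open>The hypothesis matters: outside the Hilbert--Schmidt class \<open>infsum\<close>
  defaults to 0, so \<open>hs_norm\<close> is 0 there while \<open>hsq\<close> is infinite.\<close>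

lemma hs_norm_sq_eq_hsq:
  "hilbert_schmidt I e A \<Longrightarrow> ennreal ((hs_norm I e A)\<^sup>2) = hsq I e A"
  unfolding hilbert_schmidt_def hsq_def hs_norm_def
  by (subst real_sqrt_pow2) (auto intro!: summable_on_iff_ennreal_suminf infsum_nonneg)

section \<open>Triangle inequalities for squared norms, with a factor 2\<close>

lemma sq_norm_add_le: "(norm (x + y))\<^sup>2 \<le> 2 * (norm x)\<^sup>2 + 2 * (norm (y::'a::real_normed_vector))\<^sup>2"
proof -
  have "(norm (x + y))\<^sup>2 \<le> (norm x + norm y)\<^sup>2"
    by (intro power_mono norm_triangle_ineq) simp
  also have "\<dots> \<le> 2 * (norm x)\<^sup>2 + 2 * (norm y)\<^sup>2"
    using sum_squares_bound[of "norm x" "norm y"] by (simp add: power2_sum)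
  finally show ?thesis .
qed

lemma ennreal_sq_norm_add_le:
  "ennreal ((norm (x + y))\<^sup>2) \<le> 2 * ennreal ((norm x)\<^sup>2) + 2 * ennreal ((norm (y::'a::real_normed_vector))\<^sup>2)"
proof -
  have "ennreal ((norm (x + y))\<^sup>2) \<le> ennreal (2 * (norm x)\<^sup>2 + 2 * (norm y)\<^sup>2)"
    by (intro ennreal_leI sq_norm_add_le)
  then show ?thesis by (simp add: ennreal_mult)
qed

lemma hsq_add: "hsq I e (A + B) \<le> 2 * hsq I e A + 2 * hsq I e B"
proof -
  have "hsq I e (A + B) \<le> (\<Sum>k. 2 * ennreal (if k \<in> I then (norm (A (e k)))\<^sup>2 else 0) +
      2 * ennreal (if k \<in> I then (norm (B (e k)))\<^sup>2 else 0))"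
    unfolding hsq_def
    using ennreal_sq_norm_add_le by (intro suminf_le) (auto simp: blinfun.add_left)
  also have "\<dots> = 2 * hsq I e A + 2 * hsq I e B"
    unfolding hsq_def by (simp add: suminf_add[symmetric] ennreal_suminf_cmult)
  finally show ?thesis .
qed

lemma hsq_uminus: "hsq I e (- A) = hsq I e A"
  unfolding hsq_def by (simp add: blinfun.minus_left cong: if_cong)

lemma hsq_diff: "hsq I e (A - B) \<le> 2 * hsq I e A + 2 * hsq I e B"
  using hsq_add[of I e A "- B"] by (simp add: hsq_uminus)

lemma hilbert_schmidt_diff:
  "hilbert_schmidt I e A \<Longrightarrow> hilbert_schmidt I e B \<Longrightarrow> hilbert_schmidt I e (A - B)"
  unfolding hilbert_schmidt_iff_hsq
  using hsq_diff[of I e A B] by (auto simp: ennreal_mult_less_top intro: le_less_trans)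

lemma hsq_scaleR: "hsq I e (c *\<^sub>R A) = ennreal (c\<^sup>2) * hsq I e A"
  unfolding hsq_def ennreal_suminf_cmult[symmetric]
  by (intro suminf_cong) (auto simp: blinfun.scaleR_left power_mult_distrib ennreal_mult[symmetric])

section \<open>Expansions in an orthonormal basis\<close>

lemma orthonormal_basis_norm_sum:
  assumes "orthonormal_basis I e" "finite K" "K \<subseteq> I"
  shows "(norm (\<Sum>k\<in>K. c k *\<^sub>R e k))\<^sup>2 = (\<Sum>k\<in>K. (c k)\<^sup>2)"
proof -
  have "(norm (\<Sum>k\<in>K. c k *\<^sub>R e k))\<^sup>2 = (\<Sum>j\<in>K. \<Sum>k\<in>K. c j * (c k * (e j \<bullet> e k)))"
    by (simp add: power2_norm_eq_inner inner_sum_left inner_sum_right sum_distrib_left)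
       (subst sum.swap, simp add: inner_commute mult.left_commute)
  also have "\<dots> = (\<Sum>j\<in>K. \<Sum>k\<in>K. if j = k then (c j)\<^sup>2 else 0)"
    using assms unfolding orthonormal_basis_def
    by (intro sum.cong) (auto simp: power2_eq_square subset_iff)
  finally show ?thesis using assms(2) by simp
qed

lemma orthonormal_basis_inj_on: "orthonormal_basis I e \<Longrightarrow> inj_on e I"
  unfolding orthonormal_basis_def by (intro inj_onI) (metis one_neq_zero)

lemma span_orthonormal_basisE:
  assumes "orthonormal_basis I e" "y \<in> span (e ` I)"
  obtains K c where "finite K" "K \<subseteq> I" "y = (\<Sum>k\<in>K. c k *\<^sub>R e k)"
proof -
  obtain t r where tr: "finite t" "t \<subseteq> e ` I" "y = (\<Sum>a\<in>t. r a *\<^sub>R a)"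
    using assms(2) unfolding span_explicit by auto
  obtain K where K: "K \<subseteq> I" "t = e ` K" "finite K"
    using finite_subset_image[OF tr(1,2)] by auto
  have "inj_on e K" using orthonormal_basis_inj_on[OF assms(1)] K(1) inj_on_subset by blast
  then have "y = (\<Sum>k\<in>K. r (e k) *\<^sub>R e k)"
    using tr(3) K by (simp add: sum.reindex)
  then show thesis using that[of K "\<lambda>k. r (e k)"] K by blast
qed

lemma orthonormal_basis_approx:
  assumes "orthonormal_basis I e" "0 < d"
  obtains K c where "finite K" "K \<subseteq> I" "norm (x - (\<Sum>k\<in>K. c k *\<^sub>R e k)) < d"
proof -
  have "x \<in> closure (span (e ` I))" using assms(1) by (simp add: orthonormal_basis_def)
  then obtain y where y: "y \<in> span (e ` I)" "dist y x < d"
    using assms(2) by (auto simp: closure_approachable)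
  from span_orthonormal_basisE[OF assms(1) y(1)] that y(2)
  show thesis by (metis dist_commute dist_norm)
qed

text \<open>The Hilbert--Schmidt norm dominates the operator norm: Cauchy--Schwarz on finite
  combinations of basis vectors, extended to the closure of their span because both sides are
  continuous in the vector.\<close>

lemma norm_blinfun_le_hsq:
  assumes "orthonormal_basis I e"
  shows "ennreal ((norm (blinfun_apply A x))\<^sup>2) \<le> hsq I e A * ennreal ((norm x)\<^sup>2)"
\<comment> \<open>If \<open>hsq\<close> is infinite the bound is trivial except at
  \<open>x = 0\<close>, where top times 0 is 0 and the left side has to vanish as well.\<close>
proof (cases "hsq I e A < \<infinity>")
  case False
  then have "hsq I e A = \<infinity>" by (simp add: less_top[symmetric])
  then show ?thesis by (cases "x = 0") (auto simp: blinfun.zero_right ennreal_top_mult)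
next
  case True
  then obtain H where H: "hsq I e A = ennreal H" "0 \<le> H" by (auto simp: less_top_ennreal)
  have fin: "(norm (blinfun_apply A y))\<^sup>2 \<le> H * (norm y)\<^sup>2" if "y \<in> span (e ` I)" for y
  proof -
    obtain K c where K: "finite K" "K \<subseteq> I" "y = (\<Sum>k\<in>K. c k *\<^sub>R e k)"
      using span_orthonormal_basisE[OF assms \<open>y \<in> _\<close>] .
    have "ennreal (\<Sum>k\<in>K. (norm (A (e k)))\<^sup>2) = (\<Sum>k\<in>K. ennreal (if k \<in> I then (norm (A (e k)))\<^sup>2 else 0))"
      using K by (subst sum_ennreal) (auto intro!: sum.cong arg_cong[where f=ennreal])
    also have "\<dots> \<le> hsq I e A"
      unfolding hsq_def using K(1) by (intro sum_le_suminf) auto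
    finally have le: "(\<Sum>k\<in>K. (norm (A (e k)))\<^sup>2) \<le> H" using H by (simp add: ennreal_le_iff)
    have "norm (A y) \<le> (\<Sum>k\<in>K. \<bar>c k\<bar> * \<bar>norm (A (e k))\<bar>)"
      unfolding K(3) blinfun.sum_right blinfun.scaleR_right
      by (rule order_trans[OF norm_sum]) simp
    also have "\<dots> \<le> L2_set c K * L2_set (\<lambda>k. norm (A (e k))) K"
      by (rule L2_set_mult_ineq)
    finally have "(norm (A y))\<^sup>2 \<le> (L2_set c K * L2_set (\<lambda>k. norm (A (e k))) K)\<^sup>2"
      by (intro power_mono norm_ge_zero)
    also have "\<dots> = (\<Sum>k\<in>K. (c k)\<^sup>2) * (\<Sum>k\<in>K. (norm (A (e k)))\<^sup>2)"
      by (simp add: L2_set_def power_mult_distrib sum_nonneg)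
    also have "\<dots> \<le> (\<Sum>k\<in>K. (c k)\<^sup>2) * H"
      using le by (intro mult_left_mono sum_nonneg) auto
    also have "\<dots> = H * (norm y)\<^sup>2"
      using orthonormal_basis_norm_sum[OF assms K(1,2), of c] K(3) by simp
    finally show ?thesis .
  qed
  have "closed {y. (norm (A y))\<^sup>2 \<le> H * (norm y)\<^sup>2}"
    by (intro closed_Collect_le continuous_intros)
  then have "closure (span (e ` I)) \<subseteq> {y. (norm (A y))\<^sup>2 \<le> H * (norm y)\<^sup>2}"
    using fin by (intro closure_minimal) auto
  then have "(norm (A x))\<^sup>2 \<le> H * (norm x)\<^sup>2"
    using assms by (auto simp: orthonormal_basis_def)
  then show ?thesis
    unfolding H(1) by (subst ennreal_mult[symmetric]) (use H(2) in auto)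
qed

text \<open>No projection is constructed. \<open>pyth\<close> with the Fourier coefficients gives
  Bessel's inequality; with the coefficients of a close approximant from the dense span it shows
  that the finite sums come within any epsilon of the squared norm.\<close>

lemma parseval_sq:
  assumes "orthonormal_basis I e"
  shows "((\<lambda>k. (x \<bullet> e k)\<^sup>2) has_sum (norm x)\<^sup>2) I"
proof -
  have pyth: "(norm (x - (\<Sum>k\<in>K. c k *\<^sub>R e k)))\<^sup>2
      = (norm x)\<^sup>2 - (\<Sum>k\<in>K. (x \<bullet> e k)\<^sup>2) + (\<Sum>k\<in>K. (c k - x \<bullet> e k)\<^sup>2)"
    if "finite K" "K \<subseteq> I" for K c
  proof -
    have "(norm (x - (\<Sum>k\<in>K. c k *\<^sub>R e k)))\<^sup>2
       = (norm x)\<^sup>2 - 2 * (\<Sum>k\<in>K. c k * (x \<bullet> e k)) + (norm (\<Sum>k\<in>K. c k *\<^sub>R e k))\<^sup>2"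
      by (simp add: power2_norm_eq_inner inner_diff inner_sum_right inner_sum_left algebra_simps
          inner_commute)
    then show ?thesis
      unfolding orthonormal_basis_norm_sum[OF assms that]
      by (simp add: power2_diff sum.distrib sum_subtractf sum_distrib_left algebra_simps)
  qed
  have le: "(\<Sum>k\<in>K. (x \<bullet> e k)\<^sup>2) \<le> (norm x)\<^sup>2" if "finite K" "K \<subseteq> I" for K
    using pyth[OF that, of "\<lambda>k. x \<bullet> e k"] zero_le_power2[of "norm (x - (\<Sum>k\<in>K. (x \<bullet> e k) *\<^sub>R e k))"]
    by simp
  show ?thesis
    unfolding has_sum_def tendsto_iff
  proof (intro allI impI)
    fix \<epsilon> :: real assume "0 < \<epsilon>"
    then obtain K c where K: "finite K" "K \<subseteq> I" "norm (x - (\<Sum>k\<in>K. c k *\<^sub>R e k)) < sqrt \<epsilon>"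
      using orthonormal_basis_approx[OF assms, of "sqrt \<epsilon>" x] by auto
    have "(norm (x - (\<Sum>k\<in>K. c k *\<^sub>R e k)))\<^sup>2 < (sqrt \<epsilon>)\<^sup>2"
      using K(3) by (intro power_strict_mono) auto
    then have "(norm x)\<^sup>2 - (\<Sum>k\<in>K. (x \<bullet> e k)\<^sup>2) < \<epsilon>"
      unfolding pyth[OF K(1,2)] using \<open>0 < \<epsilon>\<close>
      by (smt (verit, ccfv_SIG) real_sqrt_pow2 sum_nonneg zero_le_power2)
    moreover have "(\<Sum>k\<in>K. (x \<bullet> e k)\<^sup>2) \<le> (\<Sum>k\<in>K'. (x \<bullet> e k)\<^sup>2)" if "finite K'" "K \<subseteq> K'" for K'
      using that by (intro sum_mono2) auto
    ultimately have "dist (\<Sum>k\<in>K'. (x \<bullet> e k)\<^sup>2) ((norm x)\<^sup>2) < \<epsilon>" if "finite K'" "K \<subseteq> K'" "K' \<subseteq> I" for K'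
      using le[of K'] that by (smt (verit) dist_real_def)
    then show "\<forall>\<^sub>F K' in finite_subsets_at_top I. dist (\<Sum>k\<in>K'. (x \<bullet> e k)\<^sup>2) ((norm x)\<^sup>2) < \<epsilon>"
      unfolding eventually_finite_subsets_at_top using K by auto
  qed
qed

text \<open>Polarisation of \<open>parseval_sq\<close>.\<close>

lemma parseval:
  assumes "orthonormal_basis I e"
  shows "((\<lambda>k. (x \<bullet> e k) * (y \<bullet> e k)) has_sum (x \<bullet> y)) I"
proof -
  have "((\<lambda>k. ((x + y) \<bullet> e k)\<^sup>2 + - (x \<bullet> e k)\<^sup>2 + - (y \<bullet> e k)\<^sup>2) has_sum
      ((norm (x + y))\<^sup>2 + - (norm x)\<^sup>2 + - (norm y)\<^sup>2)) I"
    by (intro has_sum_add) (auto simp: has_sum_uminus parseval_sq assms)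
  then have "((\<lambda>k. ((x + y) \<bullet> e k)\<^sup>2 - (x \<bullet> e k)\<^sup>2 - (y \<bullet> e k)\<^sup>2) has_sum
      ((norm (x + y))\<^sup>2 - (norm x)\<^sup>2 - (norm y)\<^sup>2)) I"
    by simp
  then have "((\<lambda>k. (1/2) * (((x + y) \<bullet> e k)\<^sup>2 - (x \<bullet> e k)\<^sup>2 - (y \<bullet> e k)\<^sup>2)) has_sum
      (1/2) * ((norm (x + y))\<^sup>2 - (norm x)\<^sup>2 - (norm y)\<^sup>2)) I"
    by (rule has_sum_cmult_right)
  moreover have "(\<lambda>k. (1/2) * (((x + y) \<bullet> e k)\<^sup>2 - (x \<bullet> e k)\<^sup>2 - (y \<bullet> e k)\<^sup>2)) = (\<lambda>k. (x \<bullet> e k) * (y \<bullet> e k))"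
    by (auto simp: inner_add_left power2_sum)
  moreover have "(1/2) * ((norm (x + y))\<^sup>2 - (norm x)\<^sup>2 - (norm y)\<^sup>2) = x \<bullet> y"
    by (simp add: power2_norm_eq_inner inner_add inner_commute)
  ultimately show ?thesis by simp
qed

section \<open>Suprema of continuous processes\<close>

definition sup_sq :: "real \<Rightarrow> (real \<Rightarrow> 'w \<Rightarrow> 'h::real_normed_vector) \<Rightarrow> 'w \<Rightarrow> ennreal" where
  "sup_sq t X \<omega> = (SUP s\<in>{0..t}. ennreal ((norm (X s \<omega>))\<^sup>2))"

lemma sup_sq_moment_eq: "sup_sq_moment M t X = (\<integral>\<^sup>+\<omega>. sup_sq t X \<omega> \<partial>M)"
  unfolding sup_sq_moment_def sup_sq_def ..

lemma sup_sq_upper: "s \<in> {0..t} \<Longrightarrow> ennreal ((norm (X s \<omega>))\<^sup>2) \<le> sup_sq t X \<omega>"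
  unfolding sup_sq_def by (rule SUP_upper)

lemma sup_sq_least:
  "(\<And>s. s \<in> {0..t} \<Longrightarrow> ennreal ((norm (X s \<omega>))\<^sup>2) \<le> c) \<Longrightarrow> sup_sq t X \<omega> \<le> c"
  unfolding sup_sq_def by (rule SUP_least)

lemma sup_sq_mono_time: "s \<le> t \<Longrightarrow> sup_sq s X \<omega> \<le> sup_sq t X \<omega>"
  unfolding sup_sq_def by (rule SUP_subset_mono) auto

lemma sup_sq_cong:
  "(\<And>s. s \<in> {0..t} \<Longrightarrow> X s \<omega> = Y s \<omega>) \<Longrightarrow> sup_sq t X \<omega> = sup_sq t Y \<omega>"
  unfolding sup_sq_def by (rule SUP_cong) auto

lemma sup_sq_add:
  "sup_sq t (\<lambda>s \<omega>. X s \<omega> + Y s \<omega>) \<omega> \<le> 2 * sup_sq t X \<omega> + 2 * sup_sq t Y \<omega>"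
proof (rule sup_sq_least)
  fix s assume s: "s \<in> {0..t}"
  have "ennreal ((norm (X s \<omega> + Y s \<omega>))\<^sup>2) \<le> 2 * ennreal ((norm (X s \<omega>))\<^sup>2) + 2 * ennreal ((norm (Y s \<omega>))\<^sup>2)"
    by (rule ennreal_sq_norm_add_le)
  also have "\<dots> \<le> 2 * sup_sq t X \<omega> + 2 * sup_sq t Y \<omega>"
    by (intro add_mono mult_left_mono sup_sq_upper s) auto
  finally show "ennreal ((norm (X s \<omega> + Y s \<omega>))\<^sup>2) \<le> 2 * sup_sq t X \<omega> + 2 * sup_sq t Y \<omega>" .
qed

lemma sup_sq_uminus: "sup_sq t (\<lambda>s \<omega>. - X s \<omega>) \<omega> = sup_sq t X \<omega>"
  unfolding sup_sq_def by simp

lemma sup_sq_diff: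
  "sup_sq t (\<lambda>s \<omega>. X s \<omega> - Y s \<omega>) \<omega> \<le> 2 * sup_sq t X \<omega> + 2 * sup_sq t Y \<omega>"
  using sup_sq_add[of t X "\<lambda>s \<omega>. - Y s \<omega>" \<omega>] by (simp add: sup_sq_uminus)

lemma sup_sq_eq_0_iff:
  "sup_sq t X \<omega> = 0 \<longleftrightarrow> (\<forall>s\<in>{0..t}. X s \<omega> = 0)"
proof
  assume "sup_sq t X \<omega> = 0"
  then show "\<forall>s\<in>{0..t}. X s \<omega> = 0"
    using sup_sq_upper[of _ t X \<omega>] by (auto simp: ennreal_eq_0_iff)
next
  assume "\<forall>s\<in>{0..t}. X s \<omega> = 0"
  then have "sup_sq t X \<omega> \<le> 0" by (intro sup_sq_least) auto
  then show "sup_sq t X \<omega> = 0" by simp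
qed

section \<open>Uniform time grids\<close>

lemma grid_point_in:
  fixes t :: real
  assumes "0 \<le> t" "k \<le> Suc m"
  shows "t * real k / real (Suc m) \<in> {0..t}"
proof -
  have "t * (real k / real (Suc m)) \<le> t * 1" using assms by (intro mult_left_mono) auto
  then show ?thesis using assms(1) by auto
qed

text \<open>A maximum over finitely many times is measurable without any regularity of paths, unlike
  the supremum over an interval that it approximates. \<open>Suc m\<close> keeps the mesh well
  defined for every \<open>m\<close>.\<close>

definition grid_max :: "nat \<Rightarrow> real \<Rightarrow> (real \<Rightarrow> 'w \<Rightarrow> 'h::real_normed_vector) \<Rightarrow> 'w \<Rightarrow> ennreal" where
  "grid_max m t X \<omega> = (SUP k\<in>{..Suc m}. ennreal ((norm (X (t * real k / real (Suc m)) \<omega>))\<^sup>2))"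

text \<open>For \<open>s \<in> {0..t}\<close> this is the largest grid point not above
  \<open>s\<close>. For \<open>t = 0\<close> division by 0 yields 0, which is the right
  value.\<close>

definition round_down :: "nat \<Rightarrow> real \<Rightarrow> real \<Rightarrow> real" where
  "round_down m t s = t * real (nat \<lfloor>s * real (Suc m) / t\<rfloor>) / real (Suc m)"

lemma round_down_bounds:
  assumes "s \<in> {0..t}"
  shows "nat \<lfloor>s * real (Suc m) / t\<rfloor> \<le> Suc m" "round_down m t s \<le> s" "0 \<le> round_down m t s"
    and "s - round_down m t s \<le> t / real (Suc m)"
proof -
  define n where "n = real (Suc m)"
  have n: "0 < n" by (simp add: n_def)
  let ?k = "\<lfloor>s * n / t\<rfloor>"
  have "s * n / t \<le> n"
    using assms n by (cases "t = 0") (auto simp: divide_le_eq mult.commute)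
  then have "?k \<le> int (Suc m)" by (simp add: floor_le_iff n_def)
  then show "nat \<lfloor>s * real (Suc m) / t\<rfloor> \<le> Suc m" by (simp add: n_def nat_le_iff)
  have k0: "0 \<le> ?k" using assms n by simp
  show "0 \<le> round_down m t s"
    using assms unfolding round_down_def by (intro divide_nonneg_nonneg mult_nonneg_nonneg) auto
  have eq: "round_down m t s = t * real_of_int ?k / n"
    using k0 by (simp add: round_down_def n_def)
  show "round_down m t s \<le> s"
  proof (cases "t = 0")
    case False
    then have "0 < t" using assms by auto
    have "t * real_of_int ?k \<le> t * (s * n / t)"
      using \<open>0 < t\<close> by (intro mult_left_mono of_int_floor_le) auto
    then show ?thesis unfolding eq using n \<open>0 < t\<close> by (simp add: divide_le_eq)
  qed (use assms in \<open>auto simp: round_down_def\<close>)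
  show "s - round_down m t s \<le> t / real (Suc m)"
  proof (cases "t = 0")
    case False
    then have "0 < t" using assms by auto
    have "s * n / t \<le> real_of_int ?k + 1" by linarith
    then have "s * n \<le> t * real_of_int ?k + t"
      using \<open>0 < t\<close> by (simp add: divide_le_eq algebra_simps)
    then have "s \<le> (t * real_of_int ?k + t) / n" using n by (simp add: le_divide_eq)
    then show ?thesis unfolding eq n_def[symmetric] by (simp add: add_divide_distrib)
  qed (use assms in \<open>auto simp: round_down_def\<close>)
qed

lemma round_down_in: "s \<in> {0..t} \<Longrightarrow> round_down m t s \<in> {0..t}"
  using round_down_bounds[of s t m] by auto

lemma round_down_tendsto:
  assumes "s \<in> {0..t}"
  shows "(\<lambda>m. round_down m t s) \<longlonglongrightarrow> s"
proof (rule tendsto_sandwich)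
  show "(\<lambda>m. s - t / real (Suc m)) \<longlonglongrightarrow> s"
    using tendsto_diff[OF tendsto_const LIMSEQ_Suc[OF lim_const_over_n], of s t] by simp
  show "(\<lambda>m. s) \<longlonglongrightarrow> s" by simp
qed (use round_down_bounds[OF assms] in \<open>auto simp: algebra_simps\<close>)

text \<open>Grid points \<open>round_down m t s\<close> converge to \<open>s\<close>, so by
  continuity no value is lost. The grids are not nested, hence there is no monotone limit; a
  \<open>liminf\<close> still gives measurability and is the form in which Fatou's lemma takes the
  limit in Doob's inequality.\<close>

lemma sup_sq_eq_liminf:
  assumes "continuous_on {0..t} (\<lambda>s. X s \<omega>)" and t: "0 \<le> t"
  shows "sup_sq t X \<omega> = liminf (\<lambda>m. grid_max m t X \<omega>)"
proof (rule antisym)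
  have "grid_max m t X \<omega> \<le> sup_sq t X \<omega>" for m
    unfolding grid_max_def
    by (intro SUP_least sup_sq_upper grid_point_in t) auto
  then show "liminf (\<lambda>m. grid_max m t X \<omega>) \<le> sup_sq t X \<omega>"
    by (intro Liminf_le) auto
  show "sup_sq t X \<omega> \<le> liminf (\<lambda>m. grid_max m t X \<omega>)"
  proof (rule sup_sq_least)
    fix s assume s: "s \<in> {0..t}"
    have "(\<lambda>m. X (round_down m t s) \<omega>) \<longlonglongrightarrow> X s \<omega>"
      using assms s round_down_tendsto[OF s] round_down_in[OF s]
      unfolding continuous_on_sequentially by (auto simp: comp_def)
    then have "(\<lambda>m. ennreal ((norm (X (round_down m t s) \<omega>))\<^sup>2)) \<longlonglongrightarrow> ennreal ((norm (X s \<omega>))\<^sup>2)"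
      by (intro tendsto_ennrealI tendsto_intros)
    then have "ennreal ((norm (X s \<omega>))\<^sup>2) = liminf (\<lambda>m. ennreal ((norm (X (round_down m t s) \<omega>))\<^sup>2))"
      by (intro lim_imp_Liminf[symmetric]) auto
    also have "\<dots> \<le> liminf (\<lambda>m. grid_max m t X \<omega>)"
      unfolding grid_max_def round_down_def
      by (intro Liminf_mono always_eventually allI SUP_upper2[of "nat \<lfloor>s * real (Suc _) / t\<rfloor>"])
        (use round_down_bounds(1)[OF s] in auto)
    finally show "ennreal ((norm (X s \<omega>))\<^sup>2) \<le> liminf (\<lambda>m. grid_max m t X \<omega>)" .
  qed
qed

section \<open>Uniform limits, and modification on null sets\<close>

lemma geometric_uniform_limit:
  fixes x :: "nat \<Rightarrow> 'h::banach"
  assumes "\<And>n. norm (x (Suc n) - x n) \<le> c * (1/2)^n"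
  shows "convergent x" "norm (lim x - x n) \<le> 2 * c * (1/2)^n"
proof -
  define d where "d k = x (Suc k) - x k" for k
  \<comment> \<open>The shift by \<open>n\<close> is built in so that the same series also measures
    the tail after step \<open>n\<close>, with sum \<open>2 * c * (1/2)^n\<close>. In the
    application \<open>c\<close> depends on the path but not on time, which makes the error uniform
    over \<open>{0..T}\<close>.\<close>
  have geo: "summable (\<lambda>k. c * (1/2)^(k + n))" for n
    by (simp add: power_add summable_mult mult.assoc[symmetric] summable_mult2)
  have sd: "summable (\<lambda>k. norm (d (k + n)))" for n
    by (rule summable_comparison_test'[OF geo[of n], of 0]) (use assms in \<open>auto simp: d_def\<close>)
  have tele: "(\<Sum>k<m. d (k + n)) = x (m + n) - x n" for m n
    by (induction m) (auto simp: d_def)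
  have lim: "(\<lambda>m. x (m + n)) \<longlonglongrightarrow> x n + (\<Sum>k. d (k + n))" for n
  proof -
    have "(\<lambda>m. x n + (\<Sum>k<m. d (k + n))) \<longlonglongrightarrow> x n + (\<Sum>k. d (k + n))"
      by (intro tendsto_intros summable_LIMSEQ summable_norm_cancel[OF sd])
    then show ?thesis by (simp add: tele)
  qed
  from lim[of 0] show conv: "convergent x" by (auto simp: convergent_def)
  then have "(\<lambda>m. x (m + n)) \<longlonglongrightarrow> lim x"
    by (intro LIMSEQ_ignore_initial_segment) (simp add: convergent_LIMSEQ_iff)
  with lim[of n] have "lim x = x n + (\<Sum>k. d (k + n))" by (rule LIMSEQ_unique[symmetric])
  then have "norm (lim x - x n) = norm (\<Sum>k. d (k + n))" by simp
  also have "\<dots> \<le> (\<Sum>k. norm (d (k + n)))" by (rule summable_norm[OF sd])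
  also have "\<dots> \<le> (\<Sum>k. c * (1/2)^(k + n))"
    by (rule suminf_le[OF _ sd geo]) (use assms in \<open>auto simp: d_def\<close>)
  also have "\<dots> = (\<Sum>k. (c * (1/2)^n) * (1/2)^k)" by (simp add: power_add mult_ac)
  also have "\<dots> = 2 * c * (1/2)^n" by (subst suminf_mult) (auto simp: suminf_geometric)
  finally show "norm (lim x - x n) \<le> 2 * c * (1/2)^n" .
qed

text \<open>The preimages under \<open>X\<close> and \<open>Y\<close> differ only inside a null set,
  and \<open>N\<close> contains all subsets of null sets of \<open>M\<close>. As \<open>N\<close>
  may be smaller than \<open>M\<close>, this covers a single \<open>F t\<close>.\<close>

lemma measurable_AE_eq:
  assumes "space N = space M" "\<And>S A. S \<in> null_sets M \<Longrightarrow> A \<subseteq> S \<Longrightarrow> A \<in> sets N"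
    and X: "X \<in> measurable N K" and ae: "AE \<omega> in M. X \<omega> = Y \<omega>" and Y: "Y \<in> space M \<rightarrow> space K"
  shows "Y \<in> measurable N K"
proof (rule measurableI)
  show "Y \<omega> \<in> space K" if "\<omega> \<in> space N" for \<omega> using Y that assms(1) by auto
  fix A assume A: "A \<in> sets K"
  obtain S where S: "{\<omega> \<in> space M. X \<omega> \<noteq> Y \<omega>} \<subseteq> S" "S \<in> null_sets M"
    using ae by (auto elim!: AE_E intro: null_setsI)
  have "Y -` A \<inter> space N = (X -` A \<inter> space N - {\<omega> \<in> space M. X \<omega> \<noteq> Y \<omega>}) \<union> {\<omega> \<in> space M. X \<omega> \<noteq> Y \<omega> \<and> Y \<omega> \<in> A}"
    using assms(1) by auto
  moreover have "\<dots> \<in> sets N"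
  proof (intro sets.Un sets.Diff measurable_sets[OF X A])
    show "{\<omega> \<in> space M. X \<omega> \<noteq> Y \<omega>} \<in> sets N" by (rule assms(2)[OF S(2,1)])
    show "{\<omega> \<in> space M. X \<omega> \<noteq> Y \<omega> \<and> Y \<omega> \<in> A} \<in> sets N"
      by (rule assms(2)[OF S(2)]) (use S(1) in auto)
  qed
  ultimately show "Y -` A \<inter> space N \<in> sets N" by simp
qed

section \<open>Processes adapted to a complete filtration\<close>

locale filtered_prob_space = prob_space M for M :: "'w measure" +
  fixes F :: "real \<Rightarrow> 'w measure" and T :: real
  assumes filt: "complete_filtration M F" and T_pos: "0 < T"
begin

lemma space_F [simp]: "space (F t) = space M"
  using filt by (auto simp: complete_filtration_def filtration_def)

lemma sets_F_mono: "s \<le> t \<Longrightarrow> sets (F s) \<subseteq> sets (F t)"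
  using filt by (auto simp: complete_filtration_def filtration_def)

lemma sets_F_le: "sets (F t) \<subseteq> sets M"
  using filt by (auto simp: complete_filtration_def)

lemma measurable_F_mono: "X \<in> measurable (F s) K \<Longrightarrow> s \<le> t \<Longrightarrow> X \<in> measurable (F t) K"
  using sets_F_mono[of s t] unfolding measurable_def by auto

lemma measurable_F_M: "X \<in> measurable (F s) K \<Longrightarrow> X \<in> measurable M K"
  using sets_F_le[of s] unfolding measurable_def by auto

lemma null_subset_F: "S \<in> null_sets M \<Longrightarrow> A \<subseteq> S \<Longrightarrow> 0 \<le> t \<Longrightarrow> A \<in> sets (F t)"
  using filt by (auto simp: complete_filtration_def)

lemma null_subset_M: "S \<in> null_sets M \<Longrightarrow> A \<subseteq> S \<Longrightarrow> A \<in> sets M"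
  using null_subset_F[of S A 0] sets_F_le by auto

lemma measurable_F_AE_eq:
  assumes "X \<in> borel_measurable (F t)" "AE \<omega> in M. X \<omega> = Y \<omega>" "0 \<le> t"
  shows "Y \<in> borel_measurable (F t)"
proof (rule measurable_AE_eq[OF _ _ assms(1,2)])
  show "\<And>S A. S \<in> null_sets M \<Longrightarrow> A \<subseteq> S \<Longrightarrow> A \<in> sets (F t)"
    using null_subset_F assms(3) by blast
qed simp_all

lemma measurable_M_AE_eq:
  assumes "X \<in> borel_measurable M" "AE \<omega> in M. X \<omega> = Y \<omega>"
  shows "Y \<in> borel_measurable M"
proof (rule measurable_AE_eq[OF _ _ assms])
  show "\<And>S A. S \<in> null_sets M \<Longrightarrow> A \<subseteq> S \<Longrightarrow> A \<in> sets M"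
    using null_subset_M by blast
qed simp_all

text \<open>The weakening of \<open>continuous_adapted\<close> that elementary integrals satisfy:
  Wiener paths are continuous only almost surely. It still makes \<open>sup_sq\<close>
  measurable.\<close>

definition ae_continuous_adapted :: "(real \<Rightarrow> 'w \<Rightarrow> 'h::{real_normed_vector}) \<Rightarrow> bool" where
  "ae_continuous_adapted X \<longleftrightarrow> (\<forall>t\<in>{0..T}. X t \<in> borel_measurable (F t)) \<and>
     (AE \<omega> in M. continuous_on {0..T} (\<lambda>t. X t \<omega>))"

lemma continuous_adapted_ae:
  "continuous_adapted M F T X \<Longrightarrow> ae_continuous_adapted X"
  by (auto simp: continuous_adapted_def ae_continuous_adapted_def)

lemma L2_continuous_adapted_ae:
  "L2_continuous_adapted M F T X \<Longrightarrow> ae_continuous_adapted X"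
  by (auto simp: L2_continuous_adapted_def continuous_adapted_ae)

lemma ae_continuous_adapted_add:
  fixes X Y :: "real \<Rightarrow> 'w \<Rightarrow> 'h::{real_normed_vector, second_countable_topology}"
  assumes "ae_continuous_adapted X" "ae_continuous_adapted Y"
  shows "ae_continuous_adapted (\<lambda>t \<omega>. X t \<omega> + Y t \<omega>)"
  unfolding ae_continuous_adapted_def
proof
  show "\<forall>t\<in>{0..T}. (\<lambda>\<omega>. X t \<omega> + Y t \<omega>) \<in> borel_measurable (F t)"
    using assms unfolding ae_continuous_adapted_def by (auto intro!: borel_measurable_add)
  from assms have "AE \<omega> in M. continuous_on {0..T} (\<lambda>t. X t \<omega>)" "AE \<omega> in M. continuous_on {0..T} (\<lambda>t. Y t \<omega>)"
    unfolding ae_continuous_adapted_def by auto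
  then show "AE \<omega> in M. continuous_on {0..T} (\<lambda>t. X t \<omega> + Y t \<omega>)"
    by eventually_elim (rule continuous_on_add)
qed

lemma ae_continuous_adapted_diff:
  fixes X Y :: "real \<Rightarrow> 'w \<Rightarrow> 'h::{real_normed_vector, second_countable_topology}"
  assumes "ae_continuous_adapted X" "ae_continuous_adapted Y"
  shows "ae_continuous_adapted (\<lambda>t \<omega>. X t \<omega> - Y t \<omega>)"
  unfolding ae_continuous_adapted_def
proof
  show "\<forall>t\<in>{0..T}. (\<lambda>\<omega>. X t \<omega> - Y t \<omega>) \<in> borel_measurable (F t)"
    using assms unfolding ae_continuous_adapted_def by (auto intro!: borel_measurable_diff)
  from assms have "AE \<omega> in M. continuous_on {0..T} (\<lambda>t. X t \<omega>)" "AE \<omega> in M. continuous_on {0..T} (\<lambda>t. Y t \<omega>)"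
    unfolding ae_continuous_adapted_def by auto
  then show "AE \<omega> in M. continuous_on {0..T} (\<lambda>t. X t \<omega> - Y t \<omega>)"
    by eventually_elim (rule continuous_on_diff)
qed

text \<open>A supremum over uncountably many times, but almost surely equal to the
  \<open>liminf\<close> of the finite maxima; completeness transfers measurability.\<close>

lemma sup_sq_measurable:
  fixes X :: "real \<Rightarrow> 'w \<Rightarrow> 'h::real_normed_vector"
  assumes "ae_continuous_adapted X" "t \<in> {0..T}"
  shows "sup_sq t X \<in> borel_measurable M"
proof (rule measurable_M_AE_eq)
  have "X (t * real k / real (Suc m)) \<in> borel_measurable M" if "k \<le> Suc m" for k m
  proof -
    have "t * real k / real (Suc m) \<in> {0..T}" using grid_point_in[of t k m] that assms(2) by auto
    then show ?thesis
      using assms(1) measurable_F_M unfolding ae_continuous_adapted_def by blast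
  qed
  then show "(\<lambda>\<omega>. liminf (\<lambda>m. grid_max m t X \<omega>)) \<in> borel_measurable M"
    unfolding grid_max_def
    by (intro borel_measurable_liminf borel_measurable_SUP measurable_compose[OF _ measurable_ennreal]
        borel_measurable_power measurable_compose[OF _ borel_measurable_norm]) auto
  have "{0..t} \<subseteq> {0..T}" using assms(2) by auto
  then have "AE \<omega> in M. continuous_on {0..t} (\<lambda>t. X t \<omega>)"
    using assms(1) unfolding ae_continuous_adapted_def
    by (auto elim!: eventually_mono intro: continuous_on_subset)
  then show "AE \<omega> in M. liminf (\<lambda>m. grid_max m t X \<omega>) = sup_sq t X \<omega>"
    by eventually_elim (use assms(2) in \<open>auto intro!: sup_sq_eq_liminf[symmetric]\<close>)
qed

abbreviation sup_dist :: "real \<Rightarrow> (real \<Rightarrow> 'w \<Rightarrow> 'h::real_normed_vector) \<Rightarrow> (real \<Rightarrow> 'w \<Rightarrow> 'h) \<Rightarrow> ennreal" where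
  "sup_dist t X Y \<equiv> sup_sq_moment M t (\<lambda>s \<omega>. X s \<omega> - Y s \<omega>)"

abbreviation "path_process \<equiv> continuous_adapted M F T"

abbreviation "L2_process \<equiv> L2_continuous_adapted M F T"

lemma sup_sq_moment_add:
  assumes "ae_continuous_adapted X" "ae_continuous_adapted Y" "t \<in> {0..T}"
  shows "sup_sq_moment M t (\<lambda>s \<omega>. X s \<omega> + Y s \<omega>) \<le> 2 * sup_sq_moment M t X + 2 * sup_sq_moment M t Y"
proof -
  note [measurable] = sup_sq_measurable[OF assms(1,3)] sup_sq_measurable[OF assms(2,3)]
  have "sup_sq_moment M t (\<lambda>s \<omega>. X s \<omega> + Y s \<omega>) \<le> (\<integral>\<^sup>+\<omega>. 2 * sup_sq t X \<omega> + 2 * sup_sq t Y \<omega> \<partial>M)"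
    unfolding sup_sq_moment_eq by (intro nn_integral_mono sup_sq_add)
  then show ?thesis by (simp add: nn_integral_add nn_integral_cmult sup_sq_moment_eq)
qed

lemma sup_sq_moment_diff:
  assumes "ae_continuous_adapted X" "ae_continuous_adapted Y" "t \<in> {0..T}"
  shows "sup_dist t X Y \<le> 2 * sup_sq_moment M t X + 2 * sup_sq_moment M t Y"
proof -
  note [measurable] = sup_sq_measurable[OF assms(1,3)] sup_sq_measurable[OF assms(2,3)]
  have "sup_dist t X Y \<le> (\<integral>\<^sup>+\<omega>. 2 * sup_sq t X \<omega> + 2 * sup_sq t Y \<omega> \<partial>M)"
    unfolding sup_sq_moment_eq by (intro nn_integral_mono sup_sq_diff)
  then show ?thesis by (simp add: nn_integral_add nn_integral_cmult sup_sq_moment_eq)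
qed

lemma sup_sq_moment_mono_time:
  "s \<le> t \<Longrightarrow> sup_sq_moment M s X \<le> sup_sq_moment M t X"
  unfolding sup_sq_moment_eq by (intro nn_integral_mono sup_sq_mono_time)

lemma sup_sq_moment_cong_AE:
  assumes "AE \<omega> in M. \<forall>s\<in>{0..t}. X s \<omega> = Y s \<omega>"
  shows "sup_sq_moment M t X = sup_sq_moment M t Y"
  unfolding sup_sq_moment_eq using assms
  by (intro nn_integral_cong_AE) (auto elim!: eventually_mono intro!: sup_sq_cong)

text \<open>Completeness of the space of square-integrable continuous adapted processes, for
  sequences that are Cauchy at a geometric rate. It produces both the stochastic integral and the
  limit of the Picard iterates.\<close>

lemma L2_continuous_limit:
  fixes X :: "nat \<Rightarrow> real \<Rightarrow> 'w \<Rightarrow> 'h::{banach, second_countable_topology}"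
  assumes X: "\<And>n. ae_continuous_adapted (X n)" and fin: "\<And>n. sup_sq_moment M T (X n) < \<infinity>"
    and cauchy: "\<And>n. sup_dist T (X (Suc n)) (X n) \<le> ennreal (A * (1/16)^n)"
    and "0 \<le> A"
  obtains J where "L2_continuous_adapted M F T J"
    "(\<lambda>n. sup_dist T J (X n)) \<longlonglongrightarrow> 0"
proof -
  define D where "D n = sup_sq T (\<lambda>t \<omega>. X (Suc n) t \<omega> - X n t \<omega>)" for n
  have TT: "T \<in> {0..T}" using T_pos by auto
  have D_meas [measurable]: "D n \<in> borel_measurable M" for n
    unfolding D_def by (intro sup_sq_measurable ae_continuous_adapted_diff X TT)
  \<comment> \<open>The weight \<open>4^n\<close> is a compromise: the expectations, of order
    \<open>(1/16)^n\<close>, still sum after multiplication, and finiteness of \<open>B\<close>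
    bounds the \<open>n\<close>-th squared increment of a path by \<open>B (1/4)^n\<close>.\<close>
  define B where "B \<omega> = (\<Sum>n. 4^n * D n \<omega>)" for \<omega>
  have B_meas [measurable]: "B \<in> borel_measurable M" unfolding B_def by measurable
  have "(\<integral>\<^sup>+\<omega>. B \<omega> \<partial>M) = (\<Sum>n. 4^n * (\<integral>\<^sup>+\<omega>. D n \<omega> \<partial>M))"
    unfolding B_def by (simp add: nn_integral_suminf nn_integral_cmult)
  also have "\<dots> \<le> (\<Sum>n. ennreal (A * (1/4)^n))"
  proof (intro suminf_le)
    fix n
    have "4^n * (\<integral>\<^sup>+\<omega>. D n \<omega> \<partial>M) \<le> ennreal (4^n) * ennreal (A * (1/16)^n)"
      using cauchy[of n] unfolding sup_sq_moment_eq D_def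
      by (intro mult_mono) (auto simp: ennreal_power[symmetric])
    also have "\<dots> = ennreal (A * (4^n * (1/16)^n))"
      using \<open>0 \<le> A\<close> by (subst ennreal_mult[symmetric]) (auto simp: mult_ac)
    also have "(4::real)^n * (1/16)^n = (1/4)^n" by (simp add: power_mult_distrib[symmetric])
    finally show "4^n * (\<integral>\<^sup>+\<omega>. D n \<omega> \<partial>M) \<le> ennreal (A * (1/4)^n)" .
  qed auto
  also have "\<dots> < \<infinity>"
    using \<open>0 \<le> A\<close> by (subst suminf_ennreal2) (auto intro!: summable_mult)
  finally have B_fin: "(\<integral>\<^sup>+\<omega>. B \<omega> \<partial>M) < \<infinity>" .
  then have B_ae: "AE \<omega> in M. B \<omega> \<noteq> \<infinity>"
    by (intro nn_integral_PInf_AE) auto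
  define G where "G \<omega> \<longleftrightarrow> (\<forall>n. continuous_on {0..T} (\<lambda>t. X n t \<omega>)) \<and> B \<omega> \<noteq> \<infinity>" for \<omega>
  have "AE \<omega> in M. \<forall>n. continuous_on {0..T} (\<lambda>t. X n t \<omega>)"
    using X by (subst AE_all_countable) (auto simp: ae_continuous_adapted_def)
  with B_ae have G_ae: "AE \<omega> in M. G \<omega>" unfolding G_def by eventually_elim auto
  \<comment> \<open>The value 0 on bad paths makes every path continuous, as
    \<open>continuous_adapted\<close> demands.\<close>
  define J where "J t \<omega> = (if G \<omega> then lim (\<lambda>n. X n t \<omega>) else 0)" for t \<omega>
  define b where "b \<omega> = sqrt (enn2real (B \<omega>))" for \<omega>
  have inc: "norm (X (Suc n) t \<omega> - X n t \<omega>) \<le> b \<omega> * (1/2)^n" if "G \<omega>" "t \<in> {0..T}" for n t \<omega>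
  proof -
    have "4^n * ennreal ((norm (X (Suc n) t \<omega> - X n t \<omega>))\<^sup>2) \<le> 4^n * D n \<omega>"
      unfolding D_def using sup_sq_upper[OF that(2), of "\<lambda>t \<omega>. X (Suc n) t \<omega> - X n t \<omega>" \<omega>]
      by (intro mult_left_mono) auto
    also have "\<dots> \<le> B \<omega>"
      unfolding B_def using sum_le_suminf[of "\<lambda>n. 4^n * D n \<omega>" "{n}"] by simp
    also have "\<dots> = ennreal ((b \<omega>)\<^sup>2)"
      using that(1) by (simp add: b_def G_def less_top)
    also have "4^n * ennreal ((norm (X (Suc n) t \<omega> - X n t \<omega>))\<^sup>2) = ennreal ((2^n * norm (X (Suc n) t \<omega> - X n t \<omega>))\<^sup>2)"
    proof -
      have "(4::real)^n = (2^n)\<^sup>2" by (simp add: power2_eq_square power_mult_distrib[symmetric])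
      moreover have "ennreal (4^n) = ennreal 4 ^ n" by (rule ennreal_power[symmetric]) simp
      ultimately have "(4::ennreal)^n = ennreal ((2^n)\<^sup>2)" by simp
      then show ?thesis
        by (simp only: power_mult_distrib ennreal_mult zero_le_power2)
    qed
    finally have "(2^n * norm (X (Suc n) t \<omega> - X n t \<omega>))\<^sup>2 \<le> (b \<omega>)\<^sup>2"
      by (simp add: ennreal_le_iff)
    then have "2^n * norm (X (Suc n) t \<omega> - X n t \<omega>) \<le> b \<omega>"
      by (rule power2_le_imp_le) (simp add: b_def)
    then show ?thesis by (simp add: field_simps)
  qed
  have J_lim: "(\<lambda>n. X n t \<omega>) \<longlonglongrightarrow> J t \<omega>"
    and J_bound: "norm (J t \<omega> - X n t \<omega>) \<le> 2 * b \<omega> * (1/2)^n" if "G \<omega>" "t \<in> {0..T}" for n t \<omega>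
    using geometric_uniform_limit[of "\<lambda>n. X n t \<omega>" "b \<omega>"] inc[OF that] that(1)
    by (auto simp: J_def convergent_LIMSEQ_iff)
  have J_cont: "continuous_on {0..T} (\<lambda>t. J t \<omega>)" for \<omega>
  proof (cases "G \<omega>")
    case True
    show ?thesis
    proof (rule uniform_limit_theorem)
      show "\<forall>\<^sub>F n in sequentially. continuous_on {0..T} (\<lambda>t. X n t \<omega>)"
        using True by (simp add: G_def)
      show "uniform_limit {0..T} (\<lambda>n t. X n t \<omega>) (\<lambda>t. J t \<omega>) sequentially"
      proof (rule uniform_limitI)
        fix \<epsilon> :: real assume "0 < \<epsilon>"
        have "(\<lambda>n. 2 * b \<omega> * (1/2)^n) \<longlonglongrightarrow> 2 * b \<omega> * 0"
          by (intro tendsto_intros LIMSEQ_power_zero) auto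
        then have "\<forall>\<^sub>F n in sequentially. 2 * b \<omega> * (1/2)^n < \<epsilon>"
          using \<open>0 < \<epsilon>\<close> by (intro order_tendstoD(2)) auto
        then show "\<forall>\<^sub>F n in sequentially. \<forall>t\<in>{0..T}. dist (X n t \<omega>) (J t \<omega>) < \<epsilon>"
        proof eventually_elim
          case (elim n)
          show ?case
          proof (intro ballI)
            fix t assume "t \<in> {0..T}"
            from le_less_trans[OF J_bound[OF True this, of n] elim]
            show "dist (X n t \<omega>) (J t \<omega>) < \<epsilon>" by (simp add: dist_norm norm_minus_commute)
          qed
        qed
      qed
    qed auto
  qed (simp add: J_def)
  have J_meas: "J t \<in> borel_measurable (F t)" if t: "t \<in> {0..T}" for t
  proof -
    \<comment> \<open>\<open>G\<close> depends on the paths over all of \<open>{0..T}\<close>, so it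
      is not obviously known at time \<open>t\<close>. It has full measure, however, and
      \<open>F t\<close> contains the null sets, so cutting with it preserves adaptedness.\<close>
    have m: "(\<lambda>\<omega>. if G \<omega> then X n t \<omega> else 0) \<in> borel_measurable (F t)" for n
    proof (rule measurable_F_AE_eq[of "X n t"])
      show "X n t \<in> borel_measurable (F t)" using X[of n] t by (auto simp: ae_continuous_adapted_def)
      show "AE \<omega> in M. X n t \<omega> = (if G \<omega> then X n t \<omega> else 0)" using G_ae by eventually_elim simp
    qed (use t in auto)
    show ?thesis
    proof (rule borel_measurable_LIMSEQ_metric[OF m])
      fix \<omega>
      show "(\<lambda>n. if G \<omega> then X n t \<omega> else 0) \<longlonglongrightarrow> J t \<omega>"
        using J_lim[OF _ t, of \<omega>] by (cases "G \<omega>") (auto simp: J_def)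
    qed
  qed
  have J_ca: "continuous_adapted M F T J"
    using J_cont J_meas by (simp add: continuous_adapted_def)
  \<comment> \<open>The pathwise error \<open>2 b (1/2)^n\<close> squares to
    \<open>4 (1/4)^n B\<close>, and \<open>B\<close> is integrable.\<close>
  have bound: "sup_dist T J (X n) \<le> ennreal (4 * (1/4)^n) * (\<integral>\<^sup>+\<omega>. B \<omega> \<partial>M)" for n
  proof -
    have "sup_sq T (\<lambda>t \<omega>. J t \<omega> - X n t \<omega>) \<omega> \<le> ennreal (4 * (1/4)^n) * B \<omega>" if "G \<omega>" for \<omega>
    proof (rule sup_sq_least)
      fix t assume t: "t \<in> {0..T}"
      have "(norm (J t \<omega> - X n t \<omega>))\<^sup>2 \<le> (2 * b \<omega> * (1/2)^n)\<^sup>2"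
        by (intro power_mono J_bound that t norm_ge_zero)
      also have "\<dots> = 4 * (1/4)^n * (b \<omega>)\<^sup>2"
        by (simp add: power2_eq_square power_mult_distrib[symmetric])
      finally have "ennreal ((norm (J t \<omega> - X n t \<omega>))\<^sup>2) \<le> ennreal (4 * (1/4)^n * (b \<omega>)\<^sup>2)"
        by (rule ennreal_leI)
      also have "\<dots> = ennreal (4 * (1/4)^n) * B \<omega>"
        using that by (subst ennreal_mult) (auto simp: b_def G_def less_top)
      finally show "ennreal ((norm (J t \<omega> - X n t \<omega>))\<^sup>2) \<le> ennreal (4 * (1/4)^n) * B \<omega>" .
    qed
    then have "sup_dist T J (X n) \<le> (\<integral>\<^sup>+\<omega>. ennreal (4 * (1/4)^n) * B \<omega> \<partial>M)"
      unfolding sup_sq_moment_eq by (intro nn_integral_mono_AE) (use G_ae in \<open>auto elim!: AE_mp\<close>)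
    then show ?thesis by (simp add: nn_integral_cmult)
  qed
  obtain B0 where B0: "(\<integral>\<^sup>+\<omega>. B \<omega> \<partial>M) = ennreal B0" "0 \<le> B0"
    using B_fin by (auto simp: less_top_ennreal)
  have lim0: "(\<lambda>n. sup_dist T J (X n)) \<longlonglongrightarrow> 0"
  proof (rule tendsto_sandwich[OF _ _ tendsto_const])
    have "(\<lambda>n. ennreal (4 * (1/4)^n * B0)) \<longlonglongrightarrow> ennreal (4 * 0 * B0)"
      by (intro tendsto_ennrealI tendsto_intros LIMSEQ_power_zero) auto
    then show "(\<lambda>n. ennreal (4 * (1/4)^n) * ennreal B0) \<longlonglongrightarrow> 0"
      using B0(2) by (simp add: ennreal_mult[symmetric])
    show "\<forall>\<^sub>F n in sequentially. sup_dist T J (X n) \<le> ennreal (4 * (1/4)^n) * ennreal B0"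
      using bound B0(1) by simp
  qed auto
  have "sup_sq_moment M T J = sup_sq_moment M T (\<lambda>t \<omega>. (J t \<omega> - X 0 t \<omega>) + X 0 t \<omega>)" by simp
  also have "\<dots> \<le> 2 * sup_dist T J (X 0) + 2 * sup_sq_moment M T (X 0)"
    by (intro sup_sq_moment_add ae_continuous_adapted_diff X continuous_adapted_ae J_ca TT)
  also have "\<dots> < \<infinity>"
  proof -
    have "sup_dist T J (X 0) < \<infinity>"
      using bound[of 0] B0 by (intro le_less_trans[OF bound[of 0]]) (auto simp: ennreal_mult_less_top)
    then show ?thesis using fin[of 0] by (simp add: ennreal_mult_less_top)
  qed
  finally show thesis using that[of J] J_ca lim0 by (simp add: L2_continuous_adapted_def)
qed

end

section \<open>Doob's maximal inequality\<close>

primrec run_max :: "(nat \<Rightarrow> real) \<Rightarrow> nat \<Rightarrow> real" where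
  "run_max s 0 = s 0"
| "run_max s (Suc k) = max (run_max s k) (s (Suc k))"

lemma run_max_ge: "k \<le> n \<Longrightarrow> s k \<le> run_max s n"
  by (induction n) (auto simp: le_Suc_eq)

lemma run_max_sq_le_sum:
  assumes "\<And>k. 0 \<le> s k" shows "0 \<le> run_max s n" "(run_max s n)\<^sup>2 \<le> (\<Sum>k\<le>n. (s k)\<^sup>2)"
proof -
  show "0 \<le> run_max s n" by (rule order_trans[OF assms run_max_ge[of 0]]) simp
  \<comment> \<open>A crude bound that serves only to make the squared running maximum
    integrable.\<close>
  show "(run_max s n)\<^sup>2 \<le> (\<Sum>k\<le>n. (s k)\<^sup>2)"
  proof (induction n)
    case (Suc n)
    have "0 \<le> (\<Sum>k\<le>n. (s k)\<^sup>2)" by (intro sum_nonneg) auto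
    then show ?case
      using Suc zero_le_power2[of "s (Suc n)"] by (auto simp: max_def intro: order_trans)
  qed simp
qed

text \<open>Summation by parts: the running maximum only grows at times where it equals the sequence.\<close>

lemma run_max_sq_le:
  assumes "\<And>k. 0 \<le> s k"
  shows "(run_max s n)\<^sup>2 \<le> 4 * (s n)\<^sup>2 - 4 * (\<Sum>k<n. run_max s k * (s (Suc k) - s k))"
proof -
  have "(run_max s n)\<^sup>2 \<le> 2 * run_max s n * s n - 2 * (\<Sum>k<n. run_max s k * (s (Suc k) - s k))"
  proof (induction n)
    case 0
    show ?case using assms[of 0] by (simp add: power2_eq_square)
  next
    case (Suc n)
    show ?case
    proof (cases "s (Suc n) \<le> run_max s n")
      case True
      then show ?thesis using Suc by (simp add: max_def algebra_simps)
    next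
      case False
      \<comment> \<open>At a new record the gap between the two sides grows by exactly this square;
        otherwise both the maximum and the induction hypothesis carry over.\<close>
      have "0 \<le> (s (Suc n) - run_max s n)\<^sup>2" by simp
      then show ?thesis using False Suc by (simp add: max_def algebra_simps power2_eq_square)
    qed
  qed
  \<comment> \<open>With \<open>R\<close> the final maximum, twice the bound just proved contains
    \<open>4 R s\<close>, and \<open>4 R s \<le> R^2 + 4 s^2\<close> absorbs one copy of the left
    side. This is where Doob's constant 4 comes from.\<close>
  moreover have "0 \<le> (run_max s n - 2 * s n)\<^sup>2" by simp
  ultimately show ?thesis by (simp add: power2_eq_square algebra_simps)
qed

lemma integrable_inner_L2:
  fixes X Y :: "'w \<Rightarrow> 'h::{real_inner, second_countable_topology}"
  assumes [measurable]: "X \<in> borel_measurable M" "Y \<in> borel_measurable M"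
    and "integrable M (\<lambda>\<omega>. (norm (X \<omega>))\<^sup>2)" "integrable M (\<lambda>\<omega>. (norm (Y \<omega>))\<^sup>2)"
  shows "integrable M (\<lambda>\<omega>. X \<omega> \<bullet> Y \<omega>)"
proof (rule Bochner_Integration.integrable_bound)
  show "integrable M (\<lambda>\<omega>. (norm (X \<omega>))\<^sup>2 + (norm (Y \<omega>))\<^sup>2)"
    by (intro Bochner_Integration.integrable_add assms)
  have "\<bar>x \<bullet> y\<bar> \<le> (norm x)\<^sup>2 + (norm y)\<^sup>2" for x y :: 'h
    using Cauchy_Schwarz_ineq2[of x y] sum_squares_bound[of "norm x" "norm y"]
      mult_nonneg_nonneg[OF norm_ge_zero[of x] norm_ge_zero[of y]] by linarith
  then show "AE \<omega> in M. norm (X \<omega> \<bullet> Y \<omega>) \<le> norm ((norm (X \<omega>))\<^sup>2 + (norm (Y \<omega>))\<^sup>2)"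
    by (intro AE_I2) auto
qed measurable

lemma integrable_sq_norm_add:
  fixes X Y :: "'w \<Rightarrow> 'h::{real_inner, second_countable_topology}"
  assumes [measurable]: "X \<in> borel_measurable M" "Y \<in> borel_measurable M"
    and "integrable M (\<lambda>\<omega>. (norm (X \<omega>))\<^sup>2)" "integrable M (\<lambda>\<omega>. (norm (Y \<omega>))\<^sup>2)"
  shows "integrable M (\<lambda>\<omega>. (norm (X \<omega> + Y \<omega>))\<^sup>2)"
proof (rule Bochner_Integration.integrable_bound)
  show "integrable M (\<lambda>\<omega>. 2 * (norm (X \<omega>))\<^sup>2 + 2 * (norm (Y \<omega>))\<^sup>2)"
    by (intro Bochner_Integration.integrable_add integrable_mult_right assms)
  show "AE \<omega> in M. norm ((norm (X \<omega> + Y \<omega>))\<^sup>2) \<le> norm (2 * (norm (X \<omega>))\<^sup>2 + 2 * (norm (Y \<omega>))\<^sup>2)"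
    using sq_norm_add_le[of "X _" "Y _"] by (intro AE_I2) auto
qed measurable

context filtered_prob_space
begin

text \<open>Martingales are described by duality, which avoids conditional expectations in \<open>'h\<close>.\<close>

definition L2_martingale :: "(real \<Rightarrow> 'w \<Rightarrow> 'h::{real_inner, second_countable_topology}) \<Rightarrow> bool" where
  "L2_martingale N \<longleftrightarrow>
     (\<forall>t\<in>{0..T}. N t \<in> borel_measurable (F t) \<and> integrable M (\<lambda>\<omega>. (norm (N t \<omega>))\<^sup>2)) \<and>
     (\<forall>r t Y. 0 \<le> r \<and> r \<le> t \<and> t \<le> T \<and> Y \<in> borel_measurable (F r) \<and> integrable M (\<lambda>\<omega>. (norm (Y \<omega>))\<^sup>2) \<longrightarrow>
        (\<integral>\<omega>. Y \<omega> \<bullet> (N t \<omega> - N r \<omega>) \<partial>M) = 0)"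

lemma L2_martingale_zero: "L2_martingale (\<lambda>t \<omega>. 0)"
  by (simp add: L2_martingale_def)

lemma L2_martingale_add:
  assumes "L2_martingale N" "L2_martingale N'"
  shows "L2_martingale (\<lambda>t \<omega>. N t \<omega> + N' t \<omega>)"
  unfolding L2_martingale_def
proof (intro conjI ballI allI impI)
  fix t assume t: "t \<in> {0..T}"
  show "(\<lambda>\<omega>. N t \<omega> + N' t \<omega>) \<in> borel_measurable (F t)"
    using assms t by (auto simp: L2_martingale_def intro: borel_measurable_add)
  show "integrable M (\<lambda>\<omega>. (norm (N t \<omega> + N' t \<omega>))\<^sup>2)"
    using assms t by (intro integrable_sq_norm_add) (auto simp: L2_martingale_def intro: measurable_F_M)
next
  fix r t :: real and Y :: "'w \<Rightarrow> 'a"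
  assume *: "0 \<le> r \<and> r \<le> t \<and> t \<le> T \<and> Y \<in> borel_measurable (F r) \<and> integrable M (\<lambda>\<omega>. (norm (Y \<omega>))\<^sup>2)"
  have int: "integrable M (\<lambda>\<omega>. Y \<omega> \<bullet> (K t \<omega> - K r \<omega>))" if "L2_martingale K" for K
  proof -
    have rt: "r \<in> {0..T}" "t \<in> {0..T}" using * by auto
    have "integrable M (\<lambda>\<omega>. Y \<omega> \<bullet> K s \<omega>)" if "s \<in> {0..T}" for s
      using * \<open>L2_martingale K\<close> that
      by (intro integrable_inner_L2) (auto simp: L2_martingale_def intro: measurable_F_M)
    from this[OF rt(1)] this[OF rt(2)] show ?thesis by (simp add: inner_diff_right)
  qed
  have "(\<integral>\<omega>. Y \<omega> \<bullet> ((N t \<omega> + N' t \<omega>) - (N r \<omega> + N' r \<omega>)) \<partial>M)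
      = (\<integral>\<omega>. Y \<omega> \<bullet> (N t \<omega> - N r \<omega>) + Y \<omega> \<bullet> (N' t \<omega> - N' r \<omega>) \<partial>M)"
    by (intro Bochner_Integration.integral_cong) (auto simp: inner_diff_right inner_add_right)
  also have "\<dots> = (\<integral>\<omega>. Y \<omega> \<bullet> (N t \<omega> - N r \<omega>) \<partial>M) + (\<integral>\<omega>. Y \<omega> \<bullet> (N' t \<omega> - N' r \<omega>) \<partial>M)"
    by (intro Bochner_Integration.integral_add int assms)
  also have "\<dots> = 0" using assms * by (auto simp: L2_martingale_def)
  finally show "(\<integral>\<omega>. Y \<omega> \<bullet> ((N t \<omega> + N' t \<omega>) - (N r \<omega> + N' r \<omega>)) \<partial>M) = 0" .
qed

text \<open>The pathwise inequality \<open>run_max_sq_le\<close> is applied to the norms along the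
  grid. Convexity of the norm replaces each increment of the norm by the inner product of an adapted
  vector \<open>Y k\<close> with an increment of \<open>N\<close>, and the duality form of the
  martingale property makes its expectation vanish; the submartingale property of the norm never has
  to be stated.\<close>

lemma doob_grid:
  fixes N :: "real \<Rightarrow> 'w \<Rightarrow> 'h::{real_inner, second_countable_topology}"
  assumes N: "L2_martingale N" and t: "t \<in> {0..T}"
  shows "(\<integral>\<^sup>+\<omega>. grid_max m t N \<omega> \<partial>M) \<le> 4 * (\<integral>\<^sup>+\<omega>. ennreal ((norm (N t \<omega>))\<^sup>2) \<partial>M)"
proof -
  define \<tau> where "\<tau> k = t * real k / real (Suc m)" for k
  have \<tau>_in: "\<tau> k \<in> {0..T}" if "k \<le> Suc m" for k
    using grid_point_in[of t k m] that t by (auto simp: \<tau>_def)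
  have \<tau>_mono: "\<tau> j \<le> \<tau> k" if "j \<le> k" for j k
    unfolding \<tau>_def using that t by (intro divide_right_mono mult_left_mono) auto
  have \<tau>_last: "\<tau> (Suc m) = t" by (simp add: \<tau>_def)
  define s where "s \<omega> k = norm (N (\<tau> k) \<omega>)" for k \<omega>
  have s0: "0 \<le> s \<omega> k" for \<omega> k by (simp add: s_def)
  \<comment> \<open>A subgradient of the norm at \<open>N (\<tau> k)\<close>, scaled by the running
    maximum; it is known at time \<open>\<tau> k\<close>.\<close>
  define Y where "Y k \<omega> = run_max (s \<omega>) k *\<^sub>R sgn (N (\<tau> k) \<omega>)" for k \<omega>
  have N_meas: "N (\<tau> j) \<in> borel_measurable (F (\<tau> k))" if "j \<le> k" "k \<le> Suc m" for j k
  proof (rule measurable_F_mono[OF _ \<tau>_mono[OF that(1)]])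
    show "N (\<tau> j) \<in> borel_measurable (F (\<tau> j))"
      using N \<tau>_in[of j] that by (auto simp: L2_martingale_def)
  qed
  have N_int: "integrable M (\<lambda>\<omega>. (s \<omega> k)\<^sup>2)" if "k \<le> Suc m" for k
    using N \<tau>_in[OF that] by (auto simp: L2_martingale_def s_def)
  have s_meas: "(\<lambda>\<omega>. s \<omega> j) \<in> borel_measurable (F (\<tau> k))" if "j \<le> k" "k \<le> Suc m" for j k
    unfolding s_def using N_meas[OF that] by measurable
  have rm_meas: "(\<lambda>\<omega>. run_max (s \<omega>) j) \<in> borel_measurable (F (\<tau> k))" if "j \<le> k" "k \<le> Suc m" for j k
    using that
  proof (induction j)
    case 0 then show ?case using s_meas[of 0 k] by simp
  next
    case (Suc j)
    then show ?case using s_meas[of "Suc j" k] by (auto intro!: borel_measurable_max)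
  qed
  have rm_int: "integrable M (\<lambda>\<omega>. (run_max (s \<omega>) k)\<^sup>2)" if "k \<le> Suc m" for k
  proof (rule Bochner_Integration.integrable_bound)
    show "integrable M (\<lambda>\<omega>. \<Sum>j\<le>k. (s \<omega> j)\<^sup>2)"
      using that by (intro Bochner_Integration.integrable_sum N_int) auto
    show "(\<lambda>\<omega>. (run_max (s \<omega>) k)\<^sup>2) \<in> borel_measurable M"
      using measurable_F_M[OF rm_meas[OF order_refl that]] by measurable
    show "AE \<omega> in M. norm ((run_max (s \<omega>) k)\<^sup>2) \<le> norm (\<Sum>j\<le>k. (s \<omega> j)\<^sup>2)"
      using run_max_sq_le_sum(2)[OF s0] by (auto simp: sum_nonneg)
  qed
  have Y_meas: "Y k \<in> borel_measurable (F (\<tau> k))" if "k \<le> Suc m" for k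
    unfolding Y_def sgn_div_norm
    using rm_meas[OF order_refl that] N_meas[OF order_refl that]
    by (intro borel_measurable_scaleR borel_measurable_inverse measurable_compose[OF _ borel_measurable_norm])
  have Y_int: "integrable M (\<lambda>\<omega>. (norm (Y k \<omega>))\<^sup>2)" if "k \<le> Suc m" for k
  proof (rule Bochner_Integration.integrable_bound[OF rm_int[OF that]])
    show "(\<lambda>\<omega>. (norm (Y k \<omega>))\<^sup>2) \<in> borel_measurable M"
      using measurable_F_M[OF Y_meas[OF that]] by measurable
    show "AE \<omega> in M. norm ((norm (Y k \<omega>))\<^sup>2) \<le> norm ((run_max (s \<omega>) k)\<^sup>2)"
      by (intro AE_I2) (auto simp: Y_def norm_sgn)
  qed
  define D where "D k \<omega> = N (\<tau> (Suc k)) \<omega> - N (\<tau> k) \<omega>" for k \<omega>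
  have YD_zero: "(\<integral>\<omega>. Y k \<omega> \<bullet> D k \<omega> \<partial>M) = 0" if "k < Suc m" for k
    using N Y_meas[of k] Y_int[of k] \<tau>_in[of k] \<tau>_in[of "Suc k"] \<tau>_mono[of k "Suc k"] that
    unfolding L2_martingale_def D_def by auto
  have YD_int: "integrable M (\<lambda>\<omega>. Y k \<omega> \<bullet> D k \<omega>)" if "k < Suc m" for k
  proof -
    have "integrable M (\<lambda>\<omega>. Y k \<omega> \<bullet> N (\<tau> j) \<omega>)" if "j \<le> Suc m" for j
      using measurable_F_M[OF Y_meas[of k]] Y_int[of k] measurable_F_M[OF N_meas[OF order_refl that]]
        N_int[OF that] \<open>k < Suc m\<close>
      unfolding s_def by (intro integrable_inner_L2) auto
    from this[of k] this[of "Suc k"] show ?thesis using that by (simp add: D_def inner_diff_right)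
  qed
  have path: "(run_max (s \<omega>) (Suc m))\<^sup>2 \<le> 4 * (norm (N t \<omega>))\<^sup>2 - 4 * (\<Sum>k<Suc m. Y k \<omega> \<bullet> D k \<omega>)" for \<omega>
  proof -
    have "Y k \<omega> \<bullet> D k \<omega> \<le> run_max (s \<omega>) k * (s \<omega> (Suc k) - s \<omega> k)" for k
    proof -
      \<comment> \<open>The subgradient inequality for the norm; it includes \<open>x = 0\<close>,
        where \<open>sgn\<close> is 0.\<close>
      have "sgn x \<bullet> (y - x) \<le> norm y - norm x" for x y :: 'h
      proof -
        have "sgn x \<bullet> x = norm x"
          by (cases "x = 0") (simp_all add: sgn_div_norm power2_norm_eq_inner[symmetric] power2_eq_square)
        moreover have "sgn x \<bullet> y \<le> norm (sgn x) * norm y" by (rule norm_cauchy_schwarz)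
        moreover have "norm (sgn x) * norm y \<le> 1 * norm y"
          by (intro mult_right_mono) (auto simp: norm_sgn)
        ultimately show ?thesis by (simp add: inner_diff_right)
      qed
      then show ?thesis
        unfolding Y_def D_def s_def inner_scaleR_left
        by (intro mult_left_mono run_max_sq_le_sum(1)) auto
    qed
    then have "(\<Sum>k<Suc m. Y k \<omega> \<bullet> D k \<omega>) \<le> (\<Sum>k<Suc m. run_max (s \<omega>) k * (s \<omega> (Suc k) - s \<omega> k))"
      by (intro sum_mono)
    with run_max_sq_le[of "s \<omega>" "Suc m", OF s0] show ?thesis
      by (simp add: s_def \<tau>_last)
  qed
  have int_t: "integrable M (\<lambda>\<omega>. (norm (N t \<omega>))\<^sup>2)" using N t by (auto simp: L2_martingale_def)
  have "(\<integral>\<omega>. (run_max (s \<omega>) (Suc m))\<^sup>2 \<partial>M) \<le> (\<integral>\<omega>. 4 * (norm (N t \<omega>))\<^sup>2 - 4 * (\<Sum>k<Suc m. Y k \<omega> \<bullet> D k \<omega>) \<partial>M)"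
    by (intro integral_mono path rm_int Bochner_Integration.integrable_diff integrable_mult_right
        Bochner_Integration.integrable_sum int_t YD_int) auto
  also have "\<dots> = (\<integral>\<omega>. 4 * (norm (N t \<omega>))\<^sup>2 \<partial>M) - (\<integral>\<omega>. 4 * (\<Sum>k<Suc m. Y k \<omega> \<bullet> D k \<omega>) \<partial>M)"
    by (intro Bochner_Integration.integral_diff integrable_mult_right
        Bochner_Integration.integrable_sum int_t YD_int) auto
  also have "(\<integral>\<omega>. 4 * (\<Sum>k<Suc m. Y k \<omega> \<bullet> D k \<omega>) \<partial>M) = 4 * (\<Sum>k<Suc m. \<integral>\<omega>. Y k \<omega> \<bullet> D k \<omega> \<partial>M)"
    using YD_int by (subst Bochner_Integration.integral_mult_right_zero, subst Bochner_Integration.integral_sum) auto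
  also have "(\<Sum>k<Suc m. \<integral>\<omega>. Y k \<omega> \<bullet> D k \<omega> \<partial>M) = 0"
    by (intro sum.neutral) (auto intro!: YD_zero)
  finally have le: "(\<integral>\<omega>. (run_max (s \<omega>) (Suc m))\<^sup>2 \<partial>M) \<le> 4 * (\<integral>\<omega>. (norm (N t \<omega>))\<^sup>2 \<partial>M)" by simp
  have "(\<integral>\<^sup>+\<omega>. grid_max m t N \<omega> \<partial>M) \<le> (\<integral>\<^sup>+\<omega>. ennreal ((run_max (s \<omega>) (Suc m))\<^sup>2) \<partial>M)"
  proof (intro nn_integral_mono)
    fix \<omega>
    show "grid_max m t N \<omega> \<le> ennreal ((run_max (s \<omega>) (Suc m))\<^sup>2)"
      unfolding grid_max_def
    proof (intro SUP_least ennreal_leI power_mono norm_ge_zero)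
      fix k assume "k \<in> {..Suc m}"
      then show "norm (N (t * real k / real (Suc m)) \<omega>) \<le> run_max (s \<omega>) (Suc m)"
        using run_max_ge[of k "Suc m" "s \<omega>"] by (simp add: s_def \<tau>_def)
    qed
  qed
  also have "\<dots> = ennreal (\<integral>\<omega>. (run_max (s \<omega>) (Suc m))\<^sup>2 \<partial>M)"
    by (intro nn_integral_eq_integral rm_int) auto
  also have "\<dots> \<le> ennreal (4 * (\<integral>\<omega>. (norm (N t \<omega>))\<^sup>2 \<partial>M))" by (intro ennreal_leI le)
  also have "\<dots> = 4 * (\<integral>\<^sup>+\<omega>. ennreal ((norm (N t \<omega>))\<^sup>2) \<partial>M)"
    by (subst nn_integral_eq_integral[OF int_t]) (auto simp: ennreal_mult)
  finally show ?thesis .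
qed

text \<open>Every grid ends at \<open>t\<close>, so all grid estimates share one right-hand side and
  pass to the limit by Fatou's lemma.\<close>

lemma doob_maximal:
  fixes N :: "real \<Rightarrow> 'w \<Rightarrow> 'h::{real_inner, second_countable_topology}"
  assumes N: "L2_martingale N" and cont: "AE \<omega> in M. continuous_on {0..T} (\<lambda>t. N t \<omega>)" and t: "t \<in> {0..T}"
  shows "sup_sq_moment M t N \<le> 4 * (\<integral>\<^sup>+\<omega>. ennreal ((norm (N t \<omega>))\<^sup>2) \<partial>M)"
proof -
  have N_meas: "N s \<in> borel_measurable M" if "s \<in> {0..T}" for s
    using N that by (intro measurable_F_M[of "N s" s]) (auto simp: L2_martingale_def)
  have "N (t * real k / real (Suc m)) \<in> borel_measurable M" if "k \<le> Suc m" for k m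
    using grid_point_in[of t k m] that t by (intro N_meas) auto
  then have meas: "(\<lambda>\<omega>. grid_max m t N \<omega>) \<in> borel_measurable M" for m
    unfolding grid_max_def
    by (intro borel_measurable_SUP measurable_compose[OF _ measurable_ennreal]
        borel_measurable_power measurable_compose[OF _ borel_measurable_norm]) auto
  have "AE \<omega> in M. sup_sq t N \<omega> = liminf (\<lambda>m. grid_max m t N \<omega>)"
    using cont
  proof eventually_elim
    case (elim \<omega>)
    then show ?case using t by (intro sup_sq_eq_liminf continuous_on_subset[OF elim]) auto
  qed
  then have "sup_sq_moment M t N = (\<integral>\<^sup>+\<omega>. liminf (\<lambda>m. grid_max m t N \<omega>) \<partial>M)"
    unfolding sup_sq_moment_eq by (rule nn_integral_cong_AE)
  also have "\<dots> \<le> liminf (\<lambda>m. \<integral>\<^sup>+\<omega>. grid_max m t N \<omega> \<partial>M)"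
    by (rule nn_integral_liminf[OF meas])
  also have "\<dots> \<le> 4 * (\<integral>\<^sup>+\<omega>. ennreal ((norm (N t \<omega>))\<^sup>2) \<partial>M)"
    by (intro Liminf_le always_eventually allI doob_grid N t) auto
  finally show ?thesis .
qed

end

section \<open>Increments of the cylindrical Wiener process\<close>

locale wiener_space = filtered_prob_space M F T
  for M :: "'w measure" and F :: "real \<Rightarrow> 'w measure" and T :: real +
  fixes W :: "real \<Rightarrow> 'h::{real_inner, banach, second_countable_topology} \<Rightarrow> 'w \<Rightarrow> real"
    and I :: "nat set" and e :: "nat \<Rightarrow> 'h"
  assumes wiener: "cylindrical_wiener M F T W"
    and basis: "orthonormal_basis I e"
begin

lemma W_measurable: "t \<in> {0..T} \<Longrightarrow> W t h \<in> borel_measurable (F t)"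
  using conjunct1[OF wiener[unfolded cylindrical_wiener_def]] by simp

lemma W_continuous: "AE \<omega> in M. continuous_on {0..T} (\<lambda>t. W t h \<omega>)"
  using conjunct1[OF conjunct2[OF conjunct2[OF wiener[unfolded cylindrical_wiener_def]]]] by simp

lemma W_linear:
  "t \<in> {0..T} \<Longrightarrow> AE \<omega> in M. W t (a *\<^sub>R g + b *\<^sub>R h) \<omega> = a * W t g \<omega> + b * W t h \<omega>"
  using conjunct1[OF conjunct2[OF conjunct2[OF conjunct2[OF wiener[unfolded cylindrical_wiener_def]]]]] by simp

lemma W_indep:
  "0 \<le> s \<Longrightarrow> s < u \<Longrightarrow> u \<le> T \<Longrightarrow> indep_set (sets (F s))
     (sets (vimage_algebra (space M) (\<lambda>\<omega>. W u h \<omega> - W s h \<omega>) borel))"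
  using conjunct2[OF conjunct2[OF conjunct2[OF conjunct2[OF wiener[unfolded cylindrical_wiener_def]]]]] by simp

lemma W_normal:
  "0 \<le> s \<Longrightarrow> s < u \<Longrightarrow> u \<le> T \<Longrightarrow> h \<noteq> 0 \<Longrightarrow>
     distributed M lborel (\<lambda>\<omega>. W u h \<omega> - W s h \<omega>) (normal_density 0 (sqrt (u - s) * norm h))"
  using conjunct2[OF conjunct2[OF conjunct2[OF conjunct2[OF wiener[unfolded cylindrical_wiener_def]]]]] by simp

definition W_incr :: "real \<Rightarrow> real \<Rightarrow> 'h \<Rightarrow> 'w \<Rightarrow> real" where
  "W_incr s u h \<omega> = W u h \<omega> - W s h \<omega>"

lemma W_incr_measurable:
  assumes "0 \<le> s" "s \<le> u" "u \<le> t" "t \<le> T"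
  shows "W_incr s u h \<in> borel_measurable (F t)"
  unfolding W_incr_def
  by (intro borel_measurable_diff measurable_F_mono[OF W_measurable]) (use assms in auto)

lemma W_incr_measurable_M:
  assumes "0 \<le> s" "s \<le> u" "u \<le> T"
  shows "W_incr s u h \<in> borel_measurable M"
  by (rule measurable_F_M[OF W_incr_measurable[OF assms order_refl]])

lemma W_incr_linear:
  assumes "0 \<le> s" "s \<le> u" "u \<le> T"
  shows "AE \<omega> in M. W_incr s u (a *\<^sub>R g + b *\<^sub>R h) \<omega> = a * W_incr s u g \<omega> + b * W_incr s u h \<omega>"
proof -
  have "s \<in> {0..T}" "u \<in> {0..T}" using assms by auto
  from W_linear[OF this(1), of a g b h] W_linear[OF this(2), of a g b h]
  show ?thesis by eventually_elim (simp add: W_incr_def algebra_simps)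
qed

lemma W_incr_zero:
  assumes "0 \<le> s" "s \<le> u" "u \<le> T"
  shows "AE \<omega> in M. W_incr s u 0 \<omega> = 0"
  using W_incr_linear[OF assms, of 0 0 0 0] by simp

lemma W_incr_moments:
  assumes "0 \<le> s" "s \<le> u" "u \<le> T"
  shows "integrable M (W_incr s u h)" "expectation (W_incr s u h) = 0"
    and "integrable M (\<lambda>\<omega>. (W_incr s u h \<omega>)\<^sup>2)"
    and "expectation (\<lambda>\<omega>. (W_incr s u h \<omega>)\<^sup>2) = (u - s) * (norm h)\<^sup>2"
proof -
  note [measurable] = W_incr_measurable_M[OF assms]
  have "integrable M (W_incr s u h) \<and> expectation (W_incr s u h) = 0 \<and>
     integrable M (\<lambda>\<omega>. (W_incr s u h \<omega>)\<^sup>2) \<and>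
     expectation (\<lambda>\<omega>. (W_incr s u h \<omega>)\<^sup>2) = (u - s) * (norm h)\<^sup>2"
  \<comment> \<open>Degenerate increments have no density. For \<open>h = 0\<close> the increment
    vanishes almost surely by linearity, for \<open>s = u\<close> identically.\<close>
  proof (cases "s = u \<or> h = 0")
    case True
    then have ae: "AE \<omega> in M. W_incr s u h \<omega> = 0"
      using W_incr_zero[OF assms] by (auto simp: W_incr_def)
    then have ae2: "AE \<omega> in M. (W_incr s u h \<omega>)\<^sup>2 = 0" by eventually_elim simp
    show ?thesis
      using True integrable_cong_AE[OF _ _ ae] integrable_cong_AE[OF _ _ ae2]
        integral_cong_AE[OF _ _ ae] integral_cong_AE[OF _ _ ae2] by auto
  next
    case False
    then have su: "s < u" "h \<noteq> 0" using assms by auto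
    define v where "v = sqrt (u - s) * norm h"
    have v: "0 < v" using su by (simp add: v_def)
    have D: "distributed M lborel (W_incr s u h) (\<lambda>x. ennreal (normal_density 0 v x))"
      using W_normal[OF assms(1) su(1) assms(3) su(2)] by (simp add: W_incr_def[abs_def] v_def)
    have i1: "integrable M (W_incr s u h)"
      using distributed_integrable[OF D, of "\<lambda>x. x"] integrable_normal_moment[OF v, of 0 1] by simp
    have i2: "integrable M (\<lambda>\<omega>. (W_incr s u h \<omega>)\<^sup>2)"
      using distributed_integrable[OF D, of "\<lambda>x. x\<^sup>2"] integrable_normal_moment[OF v, of 0 2] by simp
    have e1: "expectation (W_incr s u h) = 0"
      using distributed_integral[OF D, of "\<lambda>x. x"] integral_normal_moment_odd[OF v, of 0 0] by simp
    have "expectation (\<lambda>\<omega>. (W_incr s u h \<omega>)\<^sup>2) = v\<^sup>2"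
      using distributed_integral[OF D, of "\<lambda>x. x\<^sup>2"] integral_normal_moment_even[OF v, of 0 1] by simp
    also have "\<dots> = (u - s) * (norm h)\<^sup>2"
      using su by (simp add: v_def power_mult_distrib)
    finally show ?thesis using i1 i2 e1 by blast
  qed
  then show "integrable M (W_incr s u h)" "expectation (W_incr s u h) = 0"
    "integrable M (\<lambda>\<omega>. (W_incr s u h \<omega>)\<^sup>2)"
    "expectation (\<lambda>\<omega>. (W_incr s u h \<omega>)\<^sup>2) = (u - s) * (norm h)\<^sup>2" by auto
qed

text \<open>Independence is given between \<open>F s\<close> and the sigma-algebra of the increment;
  \<open>\<eta>\<close> and any Borel function of the increment generate smaller ones.\<close>

lemma indep_var_W_incr:
  fixes f :: "real \<Rightarrow> real"
  assumes "0 \<le> s" "s < u" "u \<le> T"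
    and \<eta>: "\<eta> \<in> borel_measurable (F s)" and f: "f \<in> borel_measurable borel"
  shows "indep_var borel \<eta> borel (\<lambda>\<omega>. f (W_incr s u h \<omega>))"
  unfolding indep_var_eq
proof (intro conjI)
  show "random_variable borel \<eta>" by (rule measurable_F_M[OF \<eta>])
  show "random_variable borel (\<lambda>\<omega>. f (W_incr s u h \<omega>))"
    by (rule measurable_compose[OF W_incr_measurable_M f]) (use assms in auto)
  define V where "V = vimage_algebra (space M) (\<lambda>\<omega>. W u h \<omega> - W s h \<omega>) borel"
  have "W_incr s u h \<in> measurable V borel"
    unfolding V_def W_incr_def[abs_def] by (rule measurable_vimage_algebra1) auto
  from measurable_compose[OF this f] have fV: "(\<lambda>\<omega>. f (W_incr s u h \<omega>)) \<in> borel_measurable V" .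
  have spV: "space V = space M" by (simp add: V_def)
  have "indep_set (sets (F s)) (sets V)" unfolding V_def using assms by (intro W_indep)
  then show "indep_set (sigma_sets (space M) {\<eta> -` A \<inter> space M |A. A \<in> sets borel})
     (sigma_sets (space M) {(\<lambda>\<omega>. f (W_incr s u h \<omega>)) -` A \<inter> space M |A. A \<in> sets borel})"
    unfolding indep_set_def
  proof (rule indep_sets_mono_sets)
    have "sigma_sets (space (F s)) {\<eta> -` A \<inter> space (F s) |A. A \<in> sets borel} \<subseteq> sets (F s)"
      using measurable_sets[OF \<eta>] by (intro sets.sigma_sets_subset) auto
    moreover have "sigma_sets (space V) {(\<lambda>\<omega>. f (W_incr s u h \<omega>)) -` A \<inter> space V |A. A \<in> sets borel} \<subseteq> sets V"
      using measurable_sets[OF fV] by (intro sets.sigma_sets_subset) auto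
    ultimately show "case_bool (sigma_sets (space M) {\<eta> -` A \<inter> space M |A. A \<in> sets borel})
        (sigma_sets (space M) {(\<lambda>\<omega>. f (W_incr s u h \<omega>)) -` A \<inter> space M |A. A \<in> sets borel}) i
      \<subseteq> case_bool (sets (F s)) (sets V) i" for i
      by (cases i) (simp_all add: spV)
  qed
qed

lemma integral_mult_W_incr:
  fixes f :: "real \<Rightarrow> real"
  assumes su: "0 \<le> s" "s \<le> u" "u \<le> T"
    and \<eta>: "\<eta> \<in> borel_measurable (F s)" "integrable M \<eta>"
    and f: "f \<in> borel_measurable borel" "integrable M (\<lambda>\<omega>. f (W_incr s u h \<omega>))"
  shows "integrable M (\<lambda>\<omega>. \<eta> \<omega> * f (W_incr s u h \<omega>))"
    and "expectation (\<lambda>\<omega>. \<eta> \<omega> * f (W_incr s u h \<omega>)) = expectation \<eta> * expectation (\<lambda>\<omega>. f (W_incr s u h \<omega>))"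
proof -
  have "integrable M (\<lambda>\<omega>. \<eta> \<omega> * f (W_incr s u h \<omega>)) \<and>
    expectation (\<lambda>\<omega>. \<eta> \<omega> * f (W_incr s u h \<omega>)) = expectation \<eta> * expectation (\<lambda>\<omega>. f (W_incr s u h \<omega>))"
  \<comment> \<open>Independence is available only for \<open>s < u\<close>; for
    \<open>s = u\<close> the second factor is the constant \<open>f 0\<close>.\<close>
  proof (cases "s = u")
    case True
    then show ?thesis using \<eta>(2) by (simp add: W_incr_def prob_space)
  next
    case False
    then have "indep_var borel \<eta> borel (\<lambda>\<omega>. f (W_incr s u h \<omega>))"
      using su by (intro indep_var_W_incr \<eta>(1) f(1)) auto
    from indep_var_integrable[OF this \<eta>(2) f(2)] indep_var_lebesgue_integral[OF this \<eta>(2) f(2)]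
    show ?thesis by simp
  qed
  then show "integrable M (\<lambda>\<omega>. \<eta> \<omega> * f (W_incr s u h \<omega>))"
    "expectation (\<lambda>\<omega>. \<eta> \<omega> * f (W_incr s u h \<omega>)) = expectation \<eta> * expectation (\<lambda>\<omega>. f (W_incr s u h \<omega>))"
    by auto
qed

lemma W_incr_mean:
  assumes su: "0 \<le> s" "s \<le> u" "u \<le> T"
    and \<eta>: "\<eta> \<in> borel_measurable (F s)" "integrable M \<eta>"
  shows "integrable M (\<lambda>\<omega>. \<eta> \<omega> * W_incr s u h \<omega>)" "expectation (\<lambda>\<omega>. \<eta> \<omega> * W_incr s u h \<omega>) = 0"
  using integral_mult_W_incr[OF su \<eta>, of "\<lambda>x. x" h] W_incr_moments[OF su, of h] by auto

text \<open>Only the law of the process tested against a single vector is known, not a joint law.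
  Polarisation together with almost sure linearity reduces the product to squares of increments in
  the directions \<open>g + h\<close> and \<open>g - h\<close>.\<close>

lemma W_incr_cov:
  assumes su: "0 \<le> s" "s \<le> u" "u \<le> T"
    and \<eta>: "\<eta> \<in> borel_measurable (F s)" "integrable M \<eta>"
  shows "integrable M (\<lambda>\<omega>. \<eta> \<omega> * (W_incr s u g \<omega> * W_incr s u h \<omega>))"
    and "expectation (\<lambda>\<omega>. \<eta> \<omega> * (W_incr s u g \<omega> * W_incr s u h \<omega>)) = (u - s) * (g \<bullet> h) * expectation \<eta>"
proof -
  note [measurable] = W_incr_measurable_M[OF su] measurable_F_M[OF \<eta>(1)]
  have sq: "integrable M (\<lambda>\<omega>. \<eta> \<omega> * (W_incr s u k \<omega>)\<^sup>2)"
    "expectation (\<lambda>\<omega>. \<eta> \<omega> * (W_incr s u k \<omega>)\<^sup>2) = expectation \<eta> * ((u - s) * (norm k)\<^sup>2)" for k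
    using integral_mult_W_incr[OF su \<eta>, of "\<lambda>x. x\<^sup>2" k] W_incr_moments[OF su, of k] by auto
  have ae: "AE \<omega> in M. \<eta> \<omega> * (W_incr s u g \<omega> * W_incr s u h \<omega>) =
     (\<eta> \<omega> * (W_incr s u (g + h) \<omega>)\<^sup>2 - \<eta> \<omega> * (W_incr s u (g - h) \<omega>)\<^sup>2) / 4"
    using W_incr_linear[OF su, of 1 g 1 h] W_incr_linear[OF su, of 1 g "-1" h]
  proof eventually_elim
    case (elim \<omega>)
    then have "W_incr s u (g + h) \<omega> = W_incr s u g \<omega> + W_incr s u h \<omega>"
      "W_incr s u (g - h) \<omega> = W_incr s u g \<omega> - W_incr s u h \<omega>" by simp_all
    then show ?case by (simp only:) (simp add: power2_eq_square algebra_simps)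
  qed
  show "integrable M (\<lambda>\<omega>. \<eta> \<omega> * (W_incr s u g \<omega> * W_incr s u h \<omega>))"
    by (subst integrable_cong_AE[OF _ _ ae]) (auto intro!: sq)
  have "expectation (\<lambda>\<omega>. \<eta> \<omega> * (W_incr s u g \<omega> * W_incr s u h \<omega>)) =
     expectation (\<lambda>\<omega>. (\<eta> \<omega> * (W_incr s u (g + h) \<omega>)\<^sup>2 - \<eta> \<omega> * (W_incr s u (g - h) \<omega>)\<^sup>2) / 4)"
    by (rule integral_cong_AE[OF _ _ ae]) auto
  also have "\<dots> = (expectation \<eta> * ((u - s) * (norm (g + h))\<^sup>2) - expectation \<eta> * ((u - s) * (norm (g - h))\<^sup>2)) / 4"
    using sq by simp
  also have "\<dots> = (u - s) * (g \<bullet> h) * expectation \<eta>"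
  proof -
    have "(norm (g + h))\<^sup>2 = (norm (g - h))\<^sup>2 + 4 * (g \<bullet> h)"
      by (simp add: power2_norm_eq_inner inner_add inner_diff inner_commute)
    then show ?thesis by (simp add: field_simps)
  qed
  finally show "expectation (\<lambda>\<omega>. \<eta> \<omega> * (W_incr s u g \<omega> * W_incr s u h \<omega>)) = (u - s) * (g \<bullet> h) * expectation \<eta>" .
qed

text \<open>The factor \<open>max 0 (min u u' - max s s')\<close> is the length of the overlap of
  the two time intervals. The increments are cut at the ends of the overlap: pieces over disjoint
  intervals are uncorrelated even after multiplication by \<open>\<eta>\<close>, and the common
  piece is \<open>W_incr_cov\<close>.\<close>

lemma W_incr_product:
  assumes su: "0 \<le> s" "s \<le> u" "u \<le> T" and su': "0 \<le> s'" "s' \<le> u'" "u' \<le> T"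
    and \<eta>: "\<eta> \<in> borel_measurable (F (max s s'))" "\<And>\<omega>. \<omega> \<in> space M \<Longrightarrow> \<bar>\<eta> \<omega>\<bar> \<le> B"
  shows "integrable M (\<lambda>\<omega>. \<eta> \<omega> * (W_incr s u g \<omega> * W_incr s' u' h \<omega>))"
    and "expectation (\<lambda>\<omega>. \<eta> \<omega> * (W_incr s u g \<omega> * W_incr s' u' h \<omega>)) =
           max 0 (min u u' - max s s') * (g \<bullet> h) * expectation \<eta>"
proof -
  let ?P = "\<lambda>s u g s' u' h. integrable M (\<lambda>\<omega>. \<eta> \<omega> * (W_incr s u g \<omega> * W_incr s' u' h \<omega>)) \<and>
    expectation (\<lambda>\<omega>. \<eta> \<omega> * (W_incr s u g \<omega> * W_incr s' u' h \<omega>)) =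
       max 0 (min u u' - max s s') * (g \<bullet> h) * expectation \<eta>"
  \<comment> \<open>The claim is symmetric in the two increments, so the one starting later may be
    the primed one.\<close>
  have main: "?P s u g s' u' h"
    if su: "0 \<le> s" "s \<le> u" "u \<le> T" and su': "0 \<le> s'" "s' \<le> u'" "u' \<le> T" and ss: "s \<le> s'"
      and \<eta>s: "\<eta> \<in> borel_measurable (F s')" for s u g s' u' h
  proof -
    have \<eta>int: "integrable M \<eta>"
      using \<eta>(2) measurable_F_M[OF \<eta>s] by (intro integrable_const_bound[where B=B]) auto
    have \<eta>b: "integrable M (\<lambda>\<omega>. \<eta> \<omega> * W_incr p q k \<omega>)" if "0 \<le> p" "p \<le> q" "q \<le> T" for p q k
    proof (rule Bochner_Integration.integrable_bound)
      show "integrable M (\<lambda>\<omega>. B * W_incr p q k \<omega>)"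
        by (intro integrable_mult_right W_incr_moments that)
      show "(\<lambda>\<omega>. \<eta> \<omega> * W_incr p q k \<omega>) \<in> borel_measurable M"
        using measurable_F_M[OF \<eta>s] W_incr_measurable_M[OF that] by (rule borel_measurable_times)
      show "AE \<omega> in M. norm (\<eta> \<omega> * W_incr p q k \<omega>) \<le> norm (B * W_incr p q k \<omega>)"
      proof (rule AE_I2)
        fix \<omega> assume "\<omega> \<in> space M"
        then have "\<bar>\<eta> \<omega>\<bar> \<le> \<bar>B\<bar>" using \<eta>(2) abs_ge_self[of B] order_trans by blast
        then show "norm (\<eta> \<omega> * W_incr p q k \<omega>) \<le> norm (B * W_incr p q k \<omega>)"
          by (simp add: abs_mult mult_right_mono)
      qed
    qed
    \<comment> \<open>The earlier increment is absorbed into the factor known at time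
      \<open>q'\<close>. That factor is unbounded, but \<open>W_incr_mean\<close> asks only for
      integrability.\<close>
    have zero: "integrable M (\<lambda>\<omega>. \<eta> \<omega> * W_incr p q k \<omega> * W_incr q' r k' \<omega>) \<and>
        expectation (\<lambda>\<omega>. \<eta> \<omega> * W_incr p q k \<omega> * W_incr q' r k' \<omega>) = 0"
      if "0 \<le> p" "p \<le> q" "q \<le> q'" "s' \<le> q'" "q' \<le> r" "r \<le> T" for p q q' r k k'
      using that W_incr_mean[of q' r "\<lambda>\<omega>. \<eta> \<omega> * W_incr p q k \<omega>" k'] \<eta>b[of p q k]
        measurable_F_mono[OF \<eta>s that(4)] W_incr_measurable[of p q q' k]
      by (auto intro!: borel_measurable_times)
    show ?thesis
    proof (cases "u \<le> s'")
      case True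
      then show ?thesis
        using zero[of s u s' u' g h] su su' ss by (simp add: mult.assoc min_def max_def)
    next
      case False
      define w where "w = min u u'"
      have w: "s' \<le> w" "w \<le> u" "w \<le> u'" "w \<le> T" "w = u \<or> w = u'"
        using False su su' by (auto simp: w_def)
      have s'0: "0 \<le> w" "0 \<le> s'" using w su' by auto
      let ?a = "W_incr s s' g" and ?m = "W_incr s' w g" and ?c = "W_incr w u g"
      let ?m' = "W_incr s' w h" and ?c' = "W_incr w u' h"
      have dec: "\<eta> \<omega> * (W_incr s u g \<omega> * W_incr s' u' h \<omega>) =
          \<eta> \<omega> * ?a \<omega> * ?m' \<omega> + \<eta> \<omega> * ?a \<omega> * ?c' \<omega> + \<eta> \<omega> * (?m \<omega> * ?m' \<omega>)
          + \<eta> \<omega> * ?m \<omega> * ?c' \<omega> + \<eta> \<omega> * ?m' \<omega> * ?c \<omega>" for \<omega>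
      proof -
        have "W_incr s u g \<omega> = ?a \<omega> + ?m \<omega> + ?c \<omega>" "W_incr s' u' h \<omega> = ?m' \<omega> + ?c' \<omega>"
          by (auto simp: W_incr_def)
        \<comment> \<open>\<open>w\<close> is one of the two right ends, so at most one of the
          increments sticks out beyond the overlap.\<close>
        moreover have "?c \<omega> * ?c' \<omega> = 0" using w(5) by (auto simp: W_incr_def)
        ultimately show ?thesis by (simp add: algebra_simps)
      qed
      have z1: "integrable M (\<lambda>\<omega>. \<eta> \<omega> * ?a \<omega> * ?m' \<omega>)" "expectation (\<lambda>\<omega>. \<eta> \<omega> * ?a \<omega> * ?m' \<omega>) = 0"
        using zero[of s s' s' w g h] su ss w by auto
      have z2: "integrable M (\<lambda>\<omega>. \<eta> \<omega> * ?a \<omega> * ?c' \<omega>)" "expectation (\<lambda>\<omega>. \<eta> \<omega> * ?a \<omega> * ?c' \<omega>) = 0"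
        using zero[of s s' w u' g h] su su' ss w by auto
      have z3: "integrable M (\<lambda>\<omega>. \<eta> \<omega> * (?m \<omega> * ?m' \<omega>))"
        "expectation (\<lambda>\<omega>. \<eta> \<omega> * (?m \<omega> * ?m' \<omega>)) = (w - s') * (g \<bullet> h) * expectation \<eta>"
        using W_incr_cov[OF s'0(2) w(1,4) \<eta>s \<eta>int, of g h] by auto
      have z4: "integrable M (\<lambda>\<omega>. \<eta> \<omega> * ?m \<omega> * ?c' \<omega>)" "expectation (\<lambda>\<omega>. \<eta> \<omega> * ?m \<omega> * ?c' \<omega>) = 0"
        using zero[of s' w w u' g h] s'0 su' w by auto
      have z5: "integrable M (\<lambda>\<omega>. \<eta> \<omega> * ?m' \<omega> * ?c \<omega>)" "expectation (\<lambda>\<omega>. \<eta> \<omega> * ?m' \<omega> * ?c \<omega>) = 0"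
        using zero[of s' w w u h g] s'0 su w by auto
      have "max 0 (min u u' - max s s') = w - s'" using ss w(1) by (simp add: w_def)
      then show ?thesis unfolding dec using z1 z2 z3 z4 z5 by simp
    qed
  qed
  have "?P s u g s' u' h"
  proof (cases "s \<le> s'")
    case True
    then show ?thesis using main[OF su su' True] \<eta>(1) by (simp add: max_def)
  next
    case False
    then show ?thesis using main[OF su' su, of h g] \<eta>(1)
      by (simp add: max.commute min.commute inner_commute mult.commute[of "W_incr s u g _"])
  qed
  then show "integrable M (\<lambda>\<omega>. \<eta> \<omega> * (W_incr s u g \<omega> * W_incr s' u' h \<omega>))"
    "expectation (\<lambda>\<omega>. \<eta> \<omega> * (W_incr s u g \<omega> * W_incr s' u' h \<omega>)) =
           max 0 (min u u' - max s s') * (g \<bullet> h) * expectation \<eta>" by auto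
qed

end

section \<open>The Ito isometry for elementary processes\<close>

lemma has_sum_finite_sum:
  fixes f :: "'a \<Rightarrow> 'b \<Rightarrow> real"
  assumes "\<And>j. j \<in> J \<Longrightarrow> (f j has_sum S j) I"
  shows "((\<lambda>k. \<Sum>j\<in>J. f j k) has_sum (\<Sum>j\<in>J. S j)) I"
  using assms by (induction J rule: infinite_finite_induct) (auto intro: has_sum_add)

text \<open>By \<open>parseval\<close>, the Hilbert--Schmidt inner product of two rank-one operators
  is the product of the inner products of their directions and of their values. Nonnegativity is
  recorded separately because \<open>ennreal\<close> truncates negative reals, so the equation alone
  would not yield it.\<close>

lemma hsq_finite_rank:
  fixes h x :: "nat \<Rightarrow> 'h::real_inner"
  assumes "orthonormal_basis I e" "finite J"
  shows "hsq I e (\<Sum>j\<in>J. a j *\<^sub>R (blinfun_scaleR_left (x j) o\<^sub>L blinfun_inner_right (h j)))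
      = ennreal (\<Sum>j\<in>J. \<Sum>l\<in>J. a j * a l * ((h j \<bullet> h l) * (x j \<bullet> x l)))"
    and "0 \<le> (\<Sum>j\<in>J. \<Sum>l\<in>J. a j * a l * ((h j \<bullet> h l) * (x j \<bullet> x l)))"
proof -
  let ?A = "\<Sum>j\<in>J. a j *\<^sub>R (blinfun_scaleR_left (x j) o\<^sub>L blinfun_inner_right (h j))"
  have sq: "(norm (?A (e k)))\<^sup>2 = (\<Sum>j\<in>J. \<Sum>l\<in>J. (a j * a l * (x j \<bullet> x l)) * ((h j \<bullet> e k) * (h l \<bullet> e k)))" for k
    by (simp add: blinfun.sum_left blinfun.scaleR_left power2_norm_eq_inner inner_sum_left inner_sum_right
        sum_distrib_left mult_ac) (subst sum.swap, simp add: inner_commute mult_ac)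
  have hs: "((\<lambda>k. (norm (?A (e k)))\<^sup>2) has_sum
      (\<Sum>j\<in>J. \<Sum>l\<in>J. (a j * a l * (x j \<bullet> x l)) * (h j \<bullet> h l))) I"
    unfolding sq by (intro has_sum_finite_sum has_sum_cmult_right parseval assms)
  have eq: "(\<Sum>j\<in>J. \<Sum>l\<in>J. (a j * a l * (x j \<bullet> x l)) * (h j \<bullet> h l)) =
     (\<Sum>j\<in>J. \<Sum>l\<in>J. a j * a l * ((h j \<bullet> h l) * (x j \<bullet> x l)))"
    by (simp add: mult_ac)
  show "hsq I e ?A = ennreal (\<Sum>j\<in>J. \<Sum>l\<in>J. a j * a l * ((h j \<bullet> h l) * (x j \<bullet> x l)))"
    unfolding hsq_def eq[symmetric] infsumI[OF hs, symmetric]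
    by (rule summable_on_iff_ennreal_suminf(2)[symmetric]) (use has_sum_imp_summable[OF hs] in auto)
  show "0 \<le> (\<Sum>j\<in>J. \<Sum>l\<in>J. a j * a l * ((h j \<bullet> h l) * (x j \<bullet> x l)))"
    unfolding eq[symmetric] by (rule has_sum_nonneg[OF hs]) simp
qed

lemma hs_sq_moment_eq:
  assumes "\<And>s \<omega>. s \<in> {0..t} \<Longrightarrow> \<omega> \<in> space M \<Longrightarrow> hilbert_schmidt I e (\<Phi> s \<omega>)"
  shows "hs_sq_moment I e M t \<Phi> = (\<integral>\<^sup>+\<omega>. (\<integral>\<^sup>+s\<in>{0..t}. hsq I e (\<Phi> s \<omega>) \<partial>lborel) \<partial>M)"
  unfolding hs_sq_moment_def
  using assms by (intro nn_integral_cong) (auto simp: hs_norm_sq_eq_hsq split: split_indicator)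

section \<open>Elementary processes as indexed sums\<close>

definition el_start :: "real \<times> real \<times> 'h \<times> ('w \<Rightarrow> 'h) \<Rightarrow> real" where "el_start z = fst z"
definition el_end :: "real \<times> real \<times> 'h \<times> ('w \<Rightarrow> 'h) \<Rightarrow> real" where "el_end z = fst (snd z)"
definition el_dir :: "real \<times> real \<times> 'h \<times> ('w \<Rightarrow> 'h) \<Rightarrow> 'h" where "el_dir z = fst (snd (snd z))"
definition el_coeff :: "real \<times> real \<times> 'h \<times> ('w \<Rightarrow> 'h) \<Rightarrow> 'w \<Rightarrow> 'h" where "el_coeff z = snd (snd (snd z))"

lemma elementary_value_sum:
  "elementary_value Z t \<omega> = (\<Sum>j<length Z. indicat_real {el_start (Z!j)<..el_end (Z!j)} t *\<^sub>R
      (blinfun_scaleR_left (el_coeff (Z!j) \<omega>) o\<^sub>L blinfun_inner_right (el_dir (Z!j))))"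
  unfolding elementary_value_def
  by (simp add: sum_list_sum_nth atLeast0LessThan case_prod_unfold el_start_def el_end_def el_dir_def el_coeff_def)

lemma elementary_processD:
  assumes "elementary_process M F T Z" "j < length Z"
  shows "0 \<le> el_start (Z!j)" "el_start (Z!j) \<le> el_end (Z!j)" "el_end (Z!j) \<le> T"
    "el_coeff (Z!j) \<in> borel_measurable (F (el_start (Z!j)))" "\<exists>B. \<forall>\<omega>\<in>space M. norm (el_coeff (Z!j) \<omega>) \<le> B"
  using assms(1) nth_mem[OF assms(2)]
  unfolding elementary_process_def by (auto simp: case_prod_unfold el_start_def el_end_def el_dir_def el_coeff_def)

lemma hilbert_schmidt_elementary_value:
  "orthonormal_basis I e \<Longrightarrow> hilbert_schmidt I e (elementary_value Z t \<omega>)"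
  unfolding hilbert_schmidt_iff_hsq elementary_value_sum by (subst hsq_finite_rank(1)) auto

context wiener_space
begin

lemma elementary_integral_sum:
  "elementary_integral W Z t \<omega> = (\<Sum>j<length Z. W_incr (min (el_start (Z!j)) t) (min (el_end (Z!j)) t) (el_dir (Z!j)) \<omega> *\<^sub>R el_coeff (Z!j) \<omega>)"
  unfolding elementary_integral_def W_incr_def
  by (simp add: sum_list_sum_nth atLeast0LessThan case_prod_unfold el_start_def el_end_def el_dir_def el_coeff_def)

text \<open>Between \<open>r\<close> and \<open>t\<close> the term changes by an increment over the
  part of \<open>(s, u]\<close> inside \<open>(r, t]\<close>. The test vector and
  \<open>\<xi>\<close> are both known when that part begins, so \<open>W_incr_mean\<close> with the
  factor \<open>Y \<omega> \<bullet> \<xi> \<omega>\<close> applies.\<close>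

lemma L2_martingale_term:
  fixes \<xi> :: "'w \<Rightarrow> 'h"
  assumes su: "0 \<le> s" "s \<le> u" "u \<le> T" and \<xi>: "\<xi> \<in> borel_measurable (F s)"
    and B: "\<And>\<omega>. \<omega> \<in> space M \<Longrightarrow> norm (\<xi> \<omega>) \<le> B"
  shows "L2_martingale (\<lambda>t \<omega>. W_incr (min s t) (min u t) h \<omega> *\<^sub>R \<xi> \<omega>)"
  unfolding L2_martingale_def
proof (intro conjI ballI allI impI)
  note [measurable] = measurable_F_M[OF \<xi>]
  fix t assume t: "t \<in> {0..T}"
  show "(\<lambda>\<omega>. W_incr (min s t) (min u t) h \<omega> *\<^sub>R \<xi> \<omega>) \<in> borel_measurable (F t)"
  \<comment> \<open>Before time \<open>s\<close> the coefficient \<open>\<xi>\<close> need not be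
    known, but then the increment is identically 0.\<close>
  proof (cases "t < s")
    case True
    then have "(\<lambda>\<omega>. W_incr (min s t) (min u t) h \<omega> *\<^sub>R \<xi> \<omega>) = (\<lambda>\<omega>. 0)"
      using su by (auto simp: W_incr_def min_def)
    then show ?thesis by simp
  next
    case False
    then show ?thesis
      using su t by (intro borel_measurable_scaleR W_incr_measurable measurable_F_mono[OF \<xi>]) auto
  qed
  have mt: "0 \<le> min s t" "min s t \<le> min u t" "min u t \<le> T" using su t by auto
  note [measurable] = W_incr_measurable_M[OF mt]
  show "integrable M (\<lambda>\<omega>. (norm (W_incr (min s t) (min u t) h \<omega> *\<^sub>R \<xi> \<omega>))\<^sup>2)"
  proof (rule Bochner_Integration.integrable_bound)
    show "integrable M (\<lambda>\<omega>. B\<^sup>2 * (W_incr (min s t) (min u t) h \<omega>)\<^sup>2)"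
      by (intro integrable_mult_right W_incr_moments mt)
    show "AE \<omega> in M. norm ((norm (W_incr (min s t) (min u t) h \<omega> *\<^sub>R \<xi> \<omega>))\<^sup>2)
        \<le> norm (B\<^sup>2 * (W_incr (min s t) (min u t) h \<omega>)\<^sup>2)"
    proof (rule AE_I2)
      fix \<omega> assume "\<omega> \<in> space M"
      then have "(norm (\<xi> \<omega>))\<^sup>2 \<le> B\<^sup>2" using B by (intro power_mono) auto
      then show "norm ((norm (W_incr (min s t) (min u t) h \<omega> *\<^sub>R \<xi> \<omega>))\<^sup>2)
        \<le> norm (B\<^sup>2 * (W_incr (min s t) (min u t) h \<omega>)\<^sup>2)"
        by (simp add: power_mult_distrib mult.commute[of "B\<^sup>2"] mult_left_mono)
    qed
  qed measurable
next
  fix r t and Y :: "'w \<Rightarrow> 'h"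
  assume *: "0 \<le> r \<and> r \<le> t \<and> t \<le> T \<and> Y \<in> borel_measurable (F r) \<and> integrable M (\<lambda>\<omega>. (norm (Y \<omega>))\<^sup>2)"
  \<comment> \<open>The intersection of \<open>(s, u]\<close> and \<open>(r, t]\<close> is
    \<open>(p, q]\<close>.\<close>
  define p where "p = max r s"
  define q where "q = min u t"
  show "(\<integral>\<omega>. Y \<omega> \<bullet> (W_incr (min s t) (min u t) h \<omega> *\<^sub>R \<xi> \<omega> - W_incr (min s r) (min u r) h \<omega> *\<^sub>R \<xi> \<omega>) \<partial>M) = 0"
  proof (cases "t < s \<or> u < r")
    case True
    then have "W_incr (min s t) (min u t) h \<omega> = W_incr (min s r) (min u r) h \<omega>" for \<omega>
      using * su by (auto simp: W_incr_def min_def)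
    then show ?thesis by simp
  next
    case False
    then have pq: "0 \<le> p" "p \<le> q" "q \<le> T" using * su by (auto simp: p_def q_def)
    have eq: "W_incr (min s t) (min u t) h \<omega> - W_incr (min s r) (min u r) h \<omega> = W_incr p q h \<omega>" for \<omega>
      using False * su by (cases "r \<le> s") (auto simp: W_incr_def p_def q_def min_def max_def)
    have Ym: "Y \<in> borel_measurable (F p)" "\<xi> \<in> borel_measurable (F p)"
    proof -
      show "\<xi> \<in> borel_measurable (F p)" by (rule measurable_F_mono[OF \<xi>]) (simp add: p_def)
      have "Y \<in> borel_measurable (F r)" using * by simp
      then show "Y \<in> borel_measurable (F p)" by (rule measurable_F_mono) (simp add: p_def)
    qed
    have "integrable M (\<lambda>\<omega>. (norm (\<xi> \<omega>))\<^sup>2)"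
    proof (rule integrable_const_bound[where B="B\<^sup>2"])
      show "AE \<omega> in M. norm ((norm (\<xi> \<omega>))\<^sup>2) \<le> B\<^sup>2"
        by (intro AE_I2) (auto intro!: power_mono B)
      show "(\<lambda>\<omega>. (norm (\<xi> \<omega>))\<^sup>2) \<in> borel_measurable M"
        using measurable_F_M[OF \<xi>] by measurable
    qed
    moreover have "Y \<in> borel_measurable M" "integrable M (\<lambda>\<omega>. (norm (Y \<omega>))\<^sup>2)"
      using * by (blast intro: measurable_F_M)+
    ultimately have YX: "integrable M (\<lambda>\<omega>. Y \<omega> \<bullet> \<xi> \<omega>)"
      by (intro integrable_inner_L2 measurable_F_M[OF \<xi>])
    have "(\<integral>\<omega>. (Y \<omega> \<bullet> \<xi> \<omega>) * W_incr p q h \<omega> \<partial>M) = 0"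
      by (rule W_incr_mean(2)[OF pq borel_measurable_inner[OF Ym] YX])
    moreover have "Y \<omega> \<bullet> (W_incr (min s t) (min u t) h \<omega> *\<^sub>R \<xi> \<omega> - W_incr (min s r) (min u r) h \<omega> *\<^sub>R \<xi> \<omega>)
        = (Y \<omega> \<bullet> \<xi> \<omega>) * W_incr p q h \<omega>" for \<omega>
      unfolding scaleR_left_diff_distrib[symmetric] eq by simp
    ultimately show ?thesis by simp
  qed
qed

lemma L2_martingale_sum:
  "(\<And>j. j < n \<Longrightarrow> L2_martingale (N j)) \<Longrightarrow> L2_martingale (\<lambda>t \<omega>. \<Sum>j<n::nat. N j t \<omega>)"
  by (induction n) (auto simp: L2_martingale_zero intro!: L2_martingale_add)

lemma L2_martingale_elementary_integral:
  assumes "elementary_process M F T Z"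
  shows "L2_martingale (elementary_integral W Z)"
proof -
  have "L2_martingale (\<lambda>t \<omega>. W_incr (min (el_start (Z!j)) t) (min (el_end (Z!j)) t) (el_dir (Z!j)) \<omega> *\<^sub>R el_coeff (Z!j) \<omega>)"
    if j: "j < length Z" for j
  proof -
    obtain B where "\<forall>\<omega>\<in>space M. norm (el_coeff (Z!j) \<omega>) \<le> B" using elementary_processD(5)[OF assms j] by auto
    with elementary_processD(1-4)[OF assms j] show ?thesis by (intro L2_martingale_term) auto
  qed
  then have "L2_martingale (\<lambda>t \<omega>. \<Sum>j<length Z. W_incr (min (el_start (Z!j)) t) (min (el_end (Z!j)) t) (el_dir (Z!j)) \<omega> *\<^sub>R el_coeff (Z!j) \<omega>)"
    by (rule L2_martingale_sum)
  then show ?thesis by (simp add: elementary_integral_sum[abs_def])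
qed

lemma elementary_integral_continuous:
  assumes "elementary_process M F T Z"
  shows "AE \<omega> in M. continuous_on {0..T} (\<lambda>t. elementary_integral W Z t \<omega>)"
proof -
  have "AE \<omega> in M. \<forall>j. continuous_on {0..T} (\<lambda>t. W t (el_dir (Z!j)) \<omega>)"
    by (subst AE_all_countable) (auto intro: W_continuous)
  then show ?thesis
  proof eventually_elim
    case (elim \<omega>)
    have cont: "continuous_on {0..T} (\<lambda>t. W (min c t) (el_dir (Z!j)) \<omega>)" if "0 \<le> c" "c \<le> T" for c j
      by (rule continuous_on_compose2[OF elim[rule_format, of j]])
        (use that in \<open>auto intro!: continuous_intros\<close>)
    then show ?case
      unfolding elementary_integral_sum W_incr_def
    proof (intro continuous_on_sum continuous_on_scaleR continuous_on_diff continuous_on_const)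
      fix j assume "j \<in> {..<length Z}"
      then have "0 \<le> el_start (Z!j)" "el_start (Z!j) \<le> el_end (Z!j)" "el_end (Z!j) \<le> T"
        using elementary_processD(1-3)[OF assms, of j] by auto
      then show "continuous_on {0..T} (\<lambda>t. W (min (el_end (Z!j)) t) (el_dir (Z!j)) \<omega>)"
        "continuous_on {0..T} (\<lambda>t. W (min (el_start (Z!j)) t) (el_dir (Z!j)) \<omega>)"
        by (auto intro!: cont)
    qed
  qed
qed

lemma elementary_integral_ae_continuous_adapted:
  assumes "elementary_process M F T Z"
  shows "ae_continuous_adapted (elementary_integral W Z)"
  using L2_martingale_elementary_integral[OF assms] elementary_integral_continuous[OF assms]
  by (auto simp: ae_continuous_adapted_def L2_martingale_def)

text \<open>Both sides expand into the same double sum over pairs of terms. The overlap length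
  \<open>lam j l\<close> arises on the left as the covariance of two Wiener increments and on the
  right as the time integral of a product of two indicators.\<close>

lemma ito_isometry:
  assumes Z: "elementary_process M F T Z" and t: "t \<in> {0..T}"
  shows "(\<integral>\<^sup>+\<omega>. ennreal ((norm (elementary_integral W Z t \<omega>))\<^sup>2) \<partial>M)
     = hs_sq_moment I e M t (elementary_value Z)"
proof -
  define n where "n = length Z"
  define s u h x where "s j = el_start (Z!j)" and "u j = el_end (Z!j)" and "h j = el_dir (Z!j)" and "x j = el_coeff (Z!j)" for j
  have su: "0 \<le> s j" "s j \<le> u j" "u j \<le> T" "x j \<in> borel_measurable (F (s j))" if "j < n" for j
    using elementary_processD[OF Z] that by (auto simp: n_def s_def u_def x_def)
  have "\<exists>B. \<forall>\<omega>\<in>space M. norm (x j \<omega>) \<le> B" if "j < n" for j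
    using elementary_processD(5)[OF Z] that by (auto simp: n_def x_def)
  then obtain B where B: "norm (x j \<omega>) \<le> B j" if "j < n" "\<omega> \<in> space M" for j \<omega> by metis
  define lam where "lam j l = max 0 (min (min (u j) t) (min (u l) t) - max (min (s j) t) (min (s l) t))" for j l
  define dW where "dW j \<omega> = W_incr (min (s j) t) (min (u j) t) (h j) \<omega>" for j \<omega>
  have xx_bound: "\<bar>x j \<omega> \<bullet> x l \<omega>\<bar> \<le> B j * B l" if "j < n" "l < n" "\<omega> \<in> space M" for j l \<omega>
  proof -
    have "\<bar>x j \<omega> \<bullet> x l \<omega>\<bar> \<le> norm (x j \<omega>) * norm (x l \<omega>)" by (rule Cauchy_Schwarz_ineq2)
    also have "\<dots> \<le> B j * B l"
      using B that by (intro mult_mono) (auto intro: order_trans[OF norm_ge_zero])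
    finally show ?thesis .
  qed
  have xx_int: "integrable M (\<lambda>\<omega>. x j \<omega> \<bullet> x l \<omega>)" if "j < n" "l < n" for j l
    using xx_bound[OF that] measurable_F_M[OF su(4)] that
    by (intro integrable_const_bound[where B="B j * B l"]) (auto intro: borel_measurable_inner)
  have pair: "integrable M (\<lambda>\<omega>. (x j \<omega> \<bullet> x l \<omega>) * (dW j \<omega> * dW l \<omega>)) \<and>
     expectation (\<lambda>\<omega>. (x j \<omega> \<bullet> x l \<omega>) * (dW j \<omega> * dW l \<omega>)) = lam j l * (h j \<bullet> h l) * expectation (\<lambda>\<omega>. x j \<omega> \<bullet> x l \<omega>)"
    if jl: "j < n" "l < n" for j l
  \<comment> \<open>If a term has not started by time \<open>t\<close>, its increment vanishes. This
    must be separated, because \<open>x j\<close> is known only from time \<open>s j\<close> on,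
    later than the clipped start \<open>min (s j) t\<close> that \<open>W_incr_product\<close> would
    use.\<close>
  proof (cases "t < s j \<or> t < s l")
    case True
    have "dW j \<omega> = 0" if "t < s j" "j < n" for j \<omega>
      using su[OF that(2)] that by (auto simp: dW_def W_incr_def min_def)
    then have "(\<lambda>\<omega>. (x j \<omega> \<bullet> x l \<omega>) * (dW j \<omega> * dW l \<omega>)) = (\<lambda>\<omega>. 0)" using True jl by fastforce
    moreover have "lam j l = 0" using True by (auto simp: lam_def)
    ultimately show ?thesis by simp
  next
    case False
    then have eq: "min (s j) t = s j" "min (s l) t = s l" by auto
    have m: "(\<lambda>\<omega>. x j \<omega> \<bullet> x l \<omega>) \<in> borel_measurable (F (max (s j) (s l)))"
      using measurable_F_mono[OF su(4)[OF jl(1)], of "max (s j) (s l)"]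
        measurable_F_mono[OF su(4)[OF jl(2)], of "max (s j) (s l)"]
      by (auto intro: borel_measurable_inner)
    show ?thesis
      using W_incr_product[of "s j" "min (u j) t" "s l" "min (u l) t" "\<lambda>\<omega>. x j \<omega> \<bullet> x l \<omega>" "B j * B l" "h j" "h l"]
        su[OF jl(1)] su[OF jl(2)] t m xx_bound[OF jl] False
      unfolding dW_def lam_def eq by (auto simp: min_def)
  qed
  have lhs: "(\<integral>\<^sup>+\<omega>. ennreal ((norm (elementary_integral W Z t \<omega>))\<^sup>2) \<partial>M)
    = ennreal (\<Sum>j<n. \<Sum>l<n. lam j l * (h j \<bullet> h l) * expectation (\<lambda>\<omega>. x j \<omega> \<bullet> x l \<omega>))"
  proof -
    have sq: "(norm (elementary_integral W Z t \<omega>))\<^sup>2 = (\<Sum>j<n. \<Sum>l<n. (x j \<omega> \<bullet> x l \<omega>) * (dW j \<omega> * dW l \<omega>))" for \<omega>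
      unfolding elementary_integral_sum n_def[symmetric] s_def[symmetric] u_def[symmetric] h_def[symmetric]
        x_def[symmetric] dW_def[symmetric] power2_norm_eq_inner
      by (simp add: inner_sum_left inner_sum_right sum_distrib_left mult_ac)
        (subst sum.swap, simp add: inner_commute mult_ac)
    have int: "integrable M (\<lambda>\<omega>. \<Sum>j<n. \<Sum>l<n. (x j \<omega> \<bullet> x l \<omega>) * (dW j \<omega> * dW l \<omega>))"
      using pair by (intro Bochner_Integration.integrable_sum) auto
    have "(\<integral>\<^sup>+\<omega>. ennreal ((norm (elementary_integral W Z t \<omega>))\<^sup>2) \<partial>M) =
       ennreal (expectation (\<lambda>\<omega>. \<Sum>j<n. \<Sum>l<n. (x j \<omega> \<bullet> x l \<omega>) * (dW j \<omega> * dW l \<omega>)))"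
      unfolding sq by (rule nn_integral_eq_integral[OF int]) (auto simp: sq[symmetric])
    also have "expectation (\<lambda>\<omega>. \<Sum>j<n. \<Sum>l<n. (x j \<omega> \<bullet> x l \<omega>) * (dW j \<omega> * dW l \<omega>)) =
       (\<Sum>j<n. \<Sum>l<n. expectation (\<lambda>\<omega>. (x j \<omega> \<bullet> x l \<omega>) * (dW j \<omega> * dW l \<omega>)))"
      using pair by (subst Bochner_Integration.integral_sum; (intro Bochner_Integration.integrable_sum sum.cong Bochner_Integration.integral_sum)?) auto
    also have "\<dots> = (\<Sum>j<n. \<Sum>l<n. lam j l * (h j \<bullet> h l) * expectation (\<lambda>\<omega>. x j \<omega> \<bullet> x l \<omega>))"
      using pair by (intro sum.cong) auto
    finally show ?thesis .
  qed
  define c where "c j l \<omega> = (h j \<bullet> h l) * (x j \<omega> \<bullet> x l \<omega>)" for j l \<omega>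
  define ind where "ind j r = indicat_real {s j<..u j} r" for j r
  have hsq_eq: "hsq I e (elementary_value Z r \<omega>) = ennreal (\<Sum>j<n. \<Sum>l<n. ind j r * ind l r * c j l \<omega>)"
    and hsq_nn: "0 \<le> (\<Sum>j<n. \<Sum>l<n. ind j r * ind l r * c j l \<omega>)" for r \<omega>
    unfolding elementary_value_sum n_def[symmetric] s_def[symmetric] u_def[symmetric] h_def[symmetric]
        x_def[symmetric] ind_def[symmetric] c_def
    by (intro hsq_finite_rank[OF basis]; simp)+
  have ind_int: "has_bochner_integral lborel (\<lambda>r. indicat_real {0..t} r * (ind j r * ind l r)) (lam j l)"
    if jl: "j < n" "l < n" for j l
  proof -
    define p q where "p = max (s j) (s l)" and "q = min (min (u j) (u l)) t"
    have eq: "indicat_real {0..t} r * (ind j r * ind l r) = indicat_real {p<..q} r" for r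
      using su[OF jl(1)] su[OF jl(2)] by (auto simp: ind_def p_def q_def indicator_def)
    have "has_bochner_integral lborel (indicat_real {p<..q}) (max 0 (q - p))"
    proof (cases "p \<le> q")
      case True
      then show ?thesis
        using has_bochner_integral_real_indicator[of "{p<..q}" lborel] by (simp add: measure_def)
    next
      case False
      then have "indicat_real {p<..q} = (\<lambda>r. 0)" by (auto simp: indicator_def)
      then show ?thesis using False has_bochner_integral_zero[of lborel] by (simp only:) simp
    qed
    moreover have "max 0 (q - p) = lam j l"
      using su[OF jl(1)] su[OF jl(2)] t
      by (auto simp: lam_def p_def q_def min_def max_def)
    ultimately show ?thesis unfolding eq by simp
  qed
  have sum_int: "has_bochner_integral lborel
      (\<lambda>r. \<Sum>j<n. \<Sum>l<n. indicat_real {0..t} r * (ind j r * ind l r) * c j l \<omega>) (\<Sum>j<n. \<Sum>l<n. lam j l * c j l \<omega>)" for \<omega>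
    by (intro has_bochner_integral_sum has_bochner_integral_mult_left ind_int) auto
  have inner: "(\<integral>\<^sup>+r\<in>{0..t}. hsq I e (elementary_value Z r \<omega>) \<partial>lborel) = ennreal (\<Sum>j<n. \<Sum>l<n. lam j l * c j l \<omega>)"
    and inner_nn: "0 \<le> (\<Sum>j<n. \<Sum>l<n. lam j l * c j l \<omega>)" for \<omega>
  proof -
    have eq: "(\<Sum>j<n. \<Sum>l<n. indicat_real {0..t} r * (ind j r * ind l r) * c j l \<omega>)
       = indicat_real {0..t} r * (\<Sum>j<n. \<Sum>l<n. ind j r * ind l r * c j l \<omega>)" for r
      by (simp add: sum_distrib_left mult_ac)
    have nn: "0 \<le> (\<Sum>j<n. \<Sum>l<n. indicat_real {0..t} r * (ind j r * ind l r) * c j l \<omega>)" for r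
      unfolding eq using hsq_nn by (intro mult_nonneg_nonneg) auto
    show "0 \<le> (\<Sum>j<n. \<Sum>l<n. lam j l * c j l \<omega>)"
      unfolding has_bochner_integral_integral_eq[OF sum_int, symmetric] by (intro integral_nonneg_AE AE_I2 nn)
    have "(\<integral>\<^sup>+r\<in>{0..t}. hsq I e (elementary_value Z r \<omega>) \<partial>lborel) =
       (\<integral>\<^sup>+r. ennreal (\<Sum>j<n. \<Sum>l<n. indicat_real {0..t} r * (ind j r * ind l r) * c j l \<omega>) \<partial>lborel)"
      unfolding eq hsq_eq by (intro nn_integral_cong) (auto split: split_indicator)
    also have "\<dots> = ennreal (\<Sum>j<n. \<Sum>l<n. lam j l * c j l \<omega>)"
      unfolding has_bochner_integral_integral_eq[OF sum_int, symmetric]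
      by (intro nn_integral_eq_integral integrable.intros[OF sum_int] AE_I2 nn)
    finally show "(\<integral>\<^sup>+r\<in>{0..t}. hsq I e (elementary_value Z r \<omega>) \<partial>lborel) = ennreal (\<Sum>j<n. \<Sum>l<n. lam j l * c j l \<omega>)" .
  qed
  have c_int: "integrable M (\<lambda>\<omega>. lam j l * c j l \<omega>)" if "j < n" "l < n" for j l
    unfolding c_def by (intro integrable_mult_right xx_int that)
  have "hs_sq_moment I e M t (elementary_value Z) = (\<integral>\<^sup>+\<omega>. ennreal (\<Sum>j<n. \<Sum>l<n. lam j l * c j l \<omega>) \<partial>M)"
    by (subst hs_sq_moment_eq) (auto simp: inner hilbert_schmidt_elementary_value[OF basis])
  also have "\<dots> = ennreal (expectation (\<lambda>\<omega>. \<Sum>j<n. \<Sum>l<n. lam j l * c j l \<omega>))"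
    by (intro nn_integral_eq_integral Bochner_Integration.integrable_sum c_int) (auto simp: inner_nn)
  also have "expectation (\<lambda>\<omega>. \<Sum>j<n. \<Sum>l<n. lam j l * c j l \<omega>) = (\<Sum>j<n. \<Sum>l<n. expectation (\<lambda>\<omega>. lam j l * c j l \<omega>))"
    using c_int by (subst Bochner_Integration.integral_sum; (intro Bochner_Integration.integrable_sum sum.cong Bochner_Integration.integral_sum)?) auto
  also have "\<dots> = (\<Sum>j<n. \<Sum>l<n. lam j l * (h j \<bullet> h l) * expectation (\<lambda>\<omega>. x j \<omega> \<bullet> x l \<omega>))"
    by (simp add: c_def mult_ac)
  finally show ?thesis using lhs by simp
qed

lemma elementary_integral_sup_bound:
  assumes "elementary_process M F T Z" "t \<in> {0..T}"
  shows "sup_sq_moment M t (elementary_integral W Z) \<le> 4 * hs_sq_moment I e M t (elementary_value Z)"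
  unfolding ito_isometry[OF assms, symmetric]
  by (intro doob_maximal L2_martingale_elementary_integral elementary_integral_continuous assms)

end

section \<open>Stability and existence of the stochastic integral\<close>

context wiener_space
begin

abbreviation time_space :: "real measure" where
  "time_space \<equiv> restrict_space lborel {0..T}"

definition op_measurable :: "(real \<Rightarrow> 'w \<Rightarrow> ('h \<Rightarrow>\<^sub>L 'h)) \<Rightarrow> bool" where
  "op_measurable \<Phi> \<longleftrightarrow> (\<forall>h. (\<lambda>(t, \<omega>). \<Phi> t \<omega> h) \<in> borel_measurable (time_space \<Otimes>\<^sub>M M))"

text \<open>Counts an operator outside the Hilbert--Schmidt class as infinite, where
  \<open>hs_sq_moment\<close> would count 0; so its triangle inequality needs measurability
  only.\<close>

definition hs_int :: "real \<Rightarrow> (real \<Rightarrow> 'w \<Rightarrow> ('h \<Rightarrow>\<^sub>L 'h)) \<Rightarrow> ennreal" where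
  "hs_int t \<Phi> = (\<integral>\<^sup>+\<omega>. (\<integral>\<^sup>+s\<in>{0..t}. hsq I e (\<Phi> s \<omega>) \<partial>lborel) \<partial>M)"

abbreviation hs_dist :: "real \<Rightarrow> (real \<Rightarrow> 'w \<Rightarrow> ('h \<Rightarrow>\<^sub>L 'h)) \<Rightarrow> (real \<Rightarrow> 'w \<Rightarrow> ('h \<Rightarrow>\<^sub>L 'h)) \<Rightarrow> ennreal" where
  "hs_dist t \<Phi> \<Psi> \<equiv> hs_int t (\<lambda>s \<omega>. \<Phi> s \<omega> - \<Psi> s \<omega>)"

lemma sigma_finite_time_space: "sigma_finite_measure time_space"
  by (rule sigma_finite_measure_restrict_space[OF sigma_finite_lborel]) simp

text \<open>Joint measurability is known only on \<open>{0..T}\<close>. Moving set integrals to the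
  restricted measure makes Tonelli's theorem applicable.\<close>

lemma set_nn_integral_time_space:
  assumes "t \<le> T"
  shows "(\<integral>\<^sup>+s\<in>{0..t}. f s \<partial>lborel) = (\<integral>\<^sup>+s. f s * indicator {0..t} s \<partial>time_space)"
  using assms by (subst nn_integral_restrict_space) (auto intro!: nn_integral_cong split: split_indicator)

lemma op_measurable_diff:
  assumes "op_measurable \<Phi>" "op_measurable \<Psi>"
  shows "op_measurable (\<lambda>t \<omega>. \<Phi> t \<omega> - \<Psi> t \<omega>)"
  using assms unfolding op_measurable_def
  by (auto simp: blinfun.diff_left case_prod_unfold intro!: borel_measurable_diff)

lemma measurable_fst_time_space: "(\<lambda>p. fst p) \<in> borel_measurable (time_space \<Otimes>\<^sub>M M)"
  by (rule measurable_compose[OF measurable_fst]) (auto intro: measurable_restrict_space1)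

lemma op_measurable_elementary_value:
  assumes "elementary_process M F T Z"
  shows "op_measurable (elementary_value Z)"
  unfolding op_measurable_def elementary_value_sum
proof
  fix g
  have x: "(\<lambda>p. el_coeff (Z!j) (snd p)) \<in> borel_measurable (time_space \<Otimes>\<^sub>M M)" if "j < length Z" for j
    by (rule measurable_compose[OF measurable_snd measurable_F_M[OF elementary_processD(4)[OF assms that]]])
  show "(\<lambda>(t, \<omega>). (\<Sum>j<length Z. indicat_real {el_start (Z ! j)<..el_end (Z ! j)} t *\<^sub>R
        (blinfun_scaleR_left (el_coeff (Z ! j) \<omega>) o\<^sub>L blinfun_inner_right (el_dir (Z ! j)))) g) \<in> borel_measurable (time_space \<Otimes>\<^sub>M M)"
    unfolding blinfun.sum_left blinfun.scaleR_left case_prod_unfold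
    by (intro borel_measurable_sum borel_measurable_scaleR measurable_compose[OF measurable_fst_time_space])
      (auto intro!: borel_measurable_scaleR x)
qed

lemma hsq_measurable_pair:
  assumes "op_measurable \<Phi>"
  shows "(\<lambda>(t, \<omega>). hsq I e (\<Phi> t \<omega>)) \<in> borel_measurable (time_space \<Otimes>\<^sub>M M)"
proof -
  have [measurable]: "(\<lambda>p. \<Phi> (fst p) (snd p) (e k)) \<in> borel_measurable (time_space \<Otimes>\<^sub>M M)" for k
    using assms by (simp add: op_measurable_def case_prod_unfold)
  show ?thesis unfolding hsq_def case_prod_unfold by measurable
qed

lemma hsq_measurable_time:
  assumes "op_measurable \<Phi>" "\<omega> \<in> space M"
  shows "(\<lambda>t. hsq I e (\<Phi> t \<omega>)) \<in> borel_measurable time_space"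
  using measurable_compose[OF measurable_Pair2'[OF assms(2)] hsq_measurable_pair[OF assms(1)]] by simp

lemma hsq_integral_measurable:
  assumes "op_measurable \<Phi>" "t \<le> T"
  shows "(\<lambda>\<omega>. \<integral>\<^sup>+s\<in>{0..t}. hsq I e (\<Phi> s \<omega>) \<partial>lborel) \<in> borel_measurable M"
  unfolding set_nn_integral_time_space[OF assms(2)]
proof (rule sigma_finite_measure.borel_measurable_nn_integral[OF sigma_finite_time_space])
  have [measurable]: "(\<lambda>p. hsq I e (\<Phi> (snd p) (fst p))) \<in> borel_measurable (M \<Otimes>\<^sub>M time_space)"
    using measurable_pair_swap[OF hsq_measurable_pair[OF assms(1)]] by (simp add: case_prod_unfold)
  have [measurable]: "(\<lambda>p. snd p) \<in> borel_measurable (M \<Otimes>\<^sub>M time_space)"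
    by (rule measurable_compose[OF measurable_snd]) (auto intro: measurable_restrict_space1)
  show "(\<lambda>(\<omega>, s). hsq I e (\<Phi> s \<omega>) * indicator {0..t} s) \<in> borel_measurable (M \<Otimes>\<^sub>M time_space)"
    unfolding case_prod_unfold by measurable
qed

lemma hs_int_mono_time: "s \<le> t \<Longrightarrow> hs_int s \<Phi> \<le> hs_int t \<Phi>"
  unfolding hs_int_def by (intro nn_integral_mono) (auto split: split_indicator)

lemma hs_int_diff:
  assumes "op_measurable \<Phi>" "op_measurable \<Psi>" "t \<le> T"
  shows "hs_dist t \<Phi> \<Psi> \<le> 2 * hs_int t \<Phi> + 2 * hs_int t \<Psi>"
proof -
  let ?K = "\<lambda>\<Phi> \<omega>. \<integral>\<^sup>+s\<in>{0..t}. hsq I e (\<Phi> s \<omega>) \<partial>lborel"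
  note [measurable] = hsq_integral_measurable[OF assms(1,3)] hsq_integral_measurable[OF assms(2,3)]
  have "?K (\<lambda>s \<omega>. \<Phi> s \<omega> - \<Psi> s \<omega>) \<omega> \<le> 2 * ?K \<Phi> \<omega> + 2 * ?K \<Psi> \<omega>" if \<omega>: "\<omega> \<in> space M" for \<omega>
  proof -
    note [measurable] = hsq_measurable_time[OF assms(1) \<omega>] hsq_measurable_time[OF assms(2) \<omega>]
    have [measurable]: "(\<lambda>s. s) \<in> borel_measurable time_space" by (auto intro: measurable_restrict_space1)
    have "?K (\<lambda>s \<omega>. \<Phi> s \<omega> - \<Psi> s \<omega>) \<omega> \<le> (\<integral>\<^sup>+s. (2 * hsq I e (\<Phi> s \<omega>) + 2 * hsq I e (\<Psi> s \<omega>)) * indicator {0..t} s \<partial>time_space)"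
      unfolding set_nn_integral_time_space[OF assms(3)]
      by (intro nn_integral_mono mult_right_mono hsq_diff) auto
    also have "\<dots> = (\<integral>\<^sup>+s. 2 * (hsq I e (\<Phi> s \<omega>) * indicator {0..t} s) + 2 * (hsq I e (\<Psi> s \<omega>) * indicator {0..t} s) \<partial>time_space)"
      by (simp add: distrib_right mult.assoc)
    also have "\<dots> = 2 * ?K \<Phi> \<omega> + 2 * ?K \<Psi> \<omega>"
      unfolding set_nn_integral_time_space[OF assms(3)]
      by (subst nn_integral_add, measurable) (subst nn_integral_cmult, measurable, subst nn_integral_cmult, measurable)
    finally show ?thesis .
  qed
  then have "hs_dist t \<Phi> \<Psi> \<le> (\<integral>\<^sup>+\<omega>. 2 * ?K \<Phi> \<omega> + 2 * ?K \<Psi> \<omega> \<partial>M)"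
    unfolding hs_int_def by (intro nn_integral_mono)
  also have "\<dots> = 2 * hs_int t \<Phi> + 2 * hs_int t \<Psi>"
    unfolding hs_int_def
    by (subst nn_integral_add, measurable) (subst nn_integral_cmult, measurable, subst nn_integral_cmult, measurable)
  finally show ?thesis .
qed

section \<open>Differences of elementary processes; they turn the isometry into a distance
  estimate\<close>

definition elementary_minus :: "('w, 'h) elementary \<Rightarrow> ('w, 'h) elementary \<Rightarrow> ('w, 'h) elementary" where
  "elementary_minus Z Z' = Z @ map (\<lambda>(s, u, h, \<xi>). (s, u, h, \<lambda>\<omega>. - \<xi> \<omega>)) Z'"

lemma elementary_minus_process:
  "elementary_process M F T Z \<Longrightarrow> elementary_process M F T Z' \<Longrightarrow> elementary_process M F T (elementary_minus Z Z')"
  unfolding elementary_process_def elementary_minus_def by (fastforce intro!: borel_measurable_uminus)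

lemma elementary_minus_value:
  "elementary_value (elementary_minus Z Z') t \<omega> = elementary_value Z t \<omega> - elementary_value Z' t \<omega>"
proof -
  have "elementary_value (map (\<lambda>(s, u, h, \<xi>). (s, u, h, \<lambda>\<omega>. - \<xi> \<omega>)) Z') t \<omega> = - elementary_value Z' t \<omega>"
    unfolding elementary_value_def
  proof (induction Z')
    case (Cons z Z')
    obtain s u h \<xi> where z: "z = (s, u, h, \<xi>)" by (cases z)
    have "blinfun_scaleR_left (- \<xi> \<omega>) o\<^sub>L blinfun_inner_right h = - (blinfun_scaleR_left (\<xi> \<omega>) o\<^sub>L blinfun_inner_right h)"
      by (rule blinfun_eqI) (simp add: blinfun.minus_left)
    then show ?case using Cons by (simp add: z)
  qed simp
  then show ?thesis by (simp add: elementary_minus_def elementary_value_def)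
qed

lemma elementary_minus_integral:
  "elementary_integral W (elementary_minus Z Z') t \<omega> = elementary_integral W Z t \<omega> - elementary_integral W Z' t \<omega>"
proof -
  have "elementary_integral W (map (\<lambda>(s, u, h, \<xi>). (s, u, h, \<lambda>\<omega>. - \<xi> \<omega>)) Z') t \<omega> = - elementary_integral W Z' t \<omega>"
    unfolding elementary_integral_def
    by (induction Z') (auto simp: case_prod_unfold)
  then show ?thesis by (simp add: elementary_minus_def elementary_integral_def)
qed

lemma elementary_integral_diff_bound:
  assumes "elementary_process M F T Z" "elementary_process M F T Z'" "t \<in> {0..T}"
  shows "sup_dist t (elementary_integral W Z) (elementary_integral W Z')
    \<le> 4 * hs_dist t (elementary_value Z) (elementary_value Z')"
proof -
  have "hs_sq_moment I e M t (elementary_value (elementary_minus Z Z')) = hs_int t (elementary_value (elementary_minus Z Z'))"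
    unfolding hs_int_def by (intro hs_sq_moment_eq hilbert_schmidt_elementary_value basis)
  then show ?thesis
    using elementary_integral_sup_bound[OF elementary_minus_process[OF assms(1,2)] assms(3)]
    by (simp add: elementary_minus_value[abs_def] elementary_minus_integral[abs_def])
qed

lemma L2_integrand_op_measurable: "L2_integrand I e M F T \<Phi> \<Longrightarrow> op_measurable \<Phi>"
  by (auto simp: L2_integrand_def op_measurable_def)

lemma L2_integrand_hs_int:
  assumes "L2_integrand I e M F T \<Phi>" "elementary_process M F T Z"
  shows "hs_sq_moment I e M T (\<lambda>t \<omega>. \<Phi> t \<omega> - elementary_value Z t \<omega>) = hs_dist T \<Phi> (elementary_value Z)"
  unfolding hs_int_def
  using assms(1) hilbert_schmidt_elementary_value[OF basis]
  by (intro hs_sq_moment_eq hilbert_schmidt_diff) (auto simp: L2_integrand_def)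

abbreviation "ito_integral \<equiv> has_stochastic_integral I e M F T W"

text \<open>Passes the elementary estimate to the limit along two arbitrary approximating sequences,
  so for equal integrands it also shows that the integral is unique up to indistinguishability. The
  constant is \<open>16 = 2 * 4 * 2\<close>: a split of \<open>J - J'\<close>, the Doob and Ito
  factor 4, and a split of the integrands. All other terms tend to 0.\<close>

lemma stochastic_integral_diff_bound:
  assumes 1: "ito_integral \<Phi> J" and 2: "ito_integral \<Phi>' J'"
    and t: "t \<in> {0..T}"
  shows "sup_dist t J J' \<le> 16 * hs_dist t \<Phi> \<Phi>'"
proof -
  obtain Z where Z: "\<And>n. elementary_process M F T (Z n)"
    "(\<lambda>n. hs_sq_moment I e M T (\<lambda>t \<omega>. \<Phi> t \<omega> - elementary_value (Z n) t \<omega>)) \<longlonglongrightarrow> 0"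
    "(\<lambda>n. sup_dist T J (elementary_integral W (Z n))) \<longlonglongrightarrow> 0"
    using 1 unfolding has_stochastic_integral_def by blast
  obtain Z' where Z': "\<And>n. elementary_process M F T (Z' n)"
    "(\<lambda>n. hs_sq_moment I e M T (\<lambda>t \<omega>. \<Phi>' t \<omega> - elementary_value (Z' n) t \<omega>)) \<longlonglongrightarrow> 0"
    "(\<lambda>n. sup_dist T J' (elementary_integral W (Z' n))) \<longlonglongrightarrow> 0"
    using 2 unfolding has_stochastic_integral_def by blast
  have \<Phi>: "L2_integrand I e M F T \<Phi>" "L2_integrand I e M F T \<Phi>'"
    and J: "ae_continuous_adapted J" "ae_continuous_adapted J'"
    using 1 2 by (auto simp: has_stochastic_integral_def L2_continuous_adapted_ae)
  let ?v = "\<lambda>n. elementary_value (Z n)" and ?v' = "\<lambda>n. elementary_value (Z' n)"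
  let ?i = "\<lambda>n. elementary_integral W (Z n)" and ?i' = "\<lambda>n. elementary_integral W (Z' n)"
  note om = op_measurable_diff op_measurable_elementary_value L2_integrand_op_measurable \<Phi> Z(1) Z'(1)
  note ca = ae_continuous_adapted_diff elementary_integral_ae_continuous_adapted J Z(1) Z'(1)
  have tT: "t \<le> T" using t by auto
  define a a' where "a n = hs_dist T \<Phi> (?v n)" and "a' n = hs_dist T \<Phi>' (?v' n)" for n
  define c c' where "c n = sup_dist T J (?i n)"
    and "c' n = sup_dist T J' (?i' n)" for n
  define A where "A = hs_dist t \<Phi> \<Phi>'"
  have bound: "sup_dist t J J' \<le> 16 * A + (32 * (a n + a' n) + 4 * (c n + c' n))" for n
  proof -
    have "hs_dist t (?v n) (?v' n) =
       hs_int t (\<lambda>s \<omega>. (\<Phi> s \<omega> - \<Phi>' s \<omega>) - ((\<Phi> s \<omega> - ?v n s \<omega>) - (\<Phi>' s \<omega> - ?v' n s \<omega>)))"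
      by (simp add: algebra_simps)
    also have "\<dots> \<le> 2 * A + 2 * hs_int t (\<lambda>s \<omega>. (\<Phi> s \<omega> - ?v n s \<omega>) - (\<Phi>' s \<omega> - ?v' n s \<omega>))"
      unfolding A_def by (intro hs_int_diff om tT)
    also have "hs_int t (\<lambda>s \<omega>. (\<Phi> s \<omega> - ?v n s \<omega>) - (\<Phi>' s \<omega> - ?v' n s \<omega>)) \<le>
       2 * hs_dist t \<Phi> (?v n) + 2 * hs_dist t \<Phi>' (?v' n)"
      by (intro hs_int_diff om tT)
    also have "\<dots> \<le> 2 * a n + 2 * a' n"
      unfolding a_def a'_def by (intro add_mono mult_left_mono hs_int_mono_time tT) auto
    finally have v: "hs_dist t (?v n) (?v' n) \<le> 2 * A + 2 * (2 * a n + 2 * a' n)"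
      by (simp add: add_left_mono mult_left_mono)
    have "sup_dist t J J' =
       sup_sq_moment M t (\<lambda>s \<omega>. ((J s \<omega> - ?i n s \<omega>) - (J' s \<omega> - ?i' n s \<omega>)) + (?i n s \<omega> - ?i' n s \<omega>))"
      by (simp add: algebra_simps)
    also have "\<dots> \<le> 2 * sup_sq_moment M t (\<lambda>s \<omega>. (J s \<omega> - ?i n s \<omega>) - (J' s \<omega> - ?i' n s \<omega>))
        + 2 * sup_dist t (?i n) (?i' n)"
      by (intro sup_sq_moment_add ca t)
    also have "\<dots> \<le> 2 * (2 * c n + 2 * c' n) + 2 * (4 * (2 * A + 2 * (2 * a n + 2 * a' n)))"
    proof (intro add_mono mult_left_mono)
      have "sup_sq_moment M t (\<lambda>s \<omega>. (J s \<omega> - ?i n s \<omega>) - (J' s \<omega> - ?i' n s \<omega>)) \<le>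
         2 * sup_dist t J (?i n) + 2 * sup_dist t J' (?i' n)"
        by (intro sup_sq_moment_diff ca t)
      also have "\<dots> \<le> 2 * c n + 2 * c' n"
        unfolding c_def c'_def by (intro add_mono mult_left_mono sup_sq_moment_mono_time tT) auto
      finally show "sup_sq_moment M t (\<lambda>s \<omega>. (J s \<omega> - ?i n s \<omega>) - (J' s \<omega> - ?i' n s \<omega>)) \<le> 2 * c n + 2 * c' n" .
      show "sup_dist t (?i n) (?i' n) \<le> 4 * (2 * A + 2 * (2 * a n + 2 * a' n))"
        by (rule order_trans[OF elementary_integral_diff_bound[OF Z(1) Z'(1) t]]) (intro mult_left_mono v, simp)
    qed auto
    also have "\<dots> = 16 * A + (32 * (a n + a' n) + 4 * (c n + c' n))"
      by (simp add: distrib_left mult.assoc[symmetric] add_ac)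
    finally show ?thesis .
  qed
  have lims: "a \<longlonglongrightarrow> 0" "a' \<longlonglongrightarrow> 0" "c \<longlonglongrightarrow> 0" "c' \<longlonglongrightarrow> 0"
    using Z(2,3) Z'(2,3) L2_integrand_hs_int[OF \<Phi>(1) Z(1)] L2_integrand_hs_int[OF \<Phi>(2) Z'(1)]
    unfolding a_def[abs_def] a'_def[abs_def] c_def[abs_def] c'_def[abs_def] by simp_all
  have "(\<lambda>n. 16 * A + (32 * (a n + a' n) + 4 * (c n + c' n))) \<longlonglongrightarrow> 16 * A + (32 * (0 + 0) + 4 * (0 + 0))"
    by (intro tendsto_add tendsto_const ennreal_tendsto_cmult lims) auto
  from LIMSEQ_le_const[OF this] bound show ?thesis unfolding A_def by auto
qed

text \<open>\<open>L2_continuous_limit\<close> asks for a geometric rate, while the approximation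
  comes without any; a subsequence with errors below \<open>(1/16)^n\<close> is chosen.\<close>

lemma stochastic_integral_exists:
  assumes \<Phi>: "L2_integrand I e M F T \<Phi>" and Z: "\<And>n. elementary_process M F T (Z n)"
    and lim: "(\<lambda>n. hs_dist T \<Phi> (elementary_value (Z n))) \<longlonglongrightarrow> 0"
  obtains J where "ito_integral \<Phi> J"
proof -
  have "\<forall>n. \<exists>k. hs_dist T \<Phi> (elementary_value (Z k)) < ennreal ((1/16)^n)"
  proof
    fix n
    have "\<forall>\<^sub>F k in sequentially. hs_dist T \<Phi> (elementary_value (Z k)) < ennreal ((1/16)^n)"
      by (rule order_tendstoD(2)[OF lim]) simp
    then show "\<exists>k. hs_dist T \<Phi> (elementary_value (Z k)) < ennreal ((1/16)^n)"
      by (rule eventually_happens'[OF sequentially_bot])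
  qed
  from choice[OF this] obtain \<kappa> where \<kappa>: "\<And>n. hs_int T (\<lambda>t \<omega>. \<Phi> t \<omega> - elementary_value (Z (\<kappa> n)) t \<omega>) < ennreal ((1/16)^n)"
    by blast
  define Y where "Y n = Z (\<kappa> n)" for n
  have Y: "elementary_process M F T (Y n)" for n unfolding Y_def by (rule Z)
  have TT: "T \<in> {0..T}" using T_pos by auto
  note om = op_measurable_diff op_measurable_elementary_value L2_integrand_op_measurable \<Phi> Y
  have Yb: "hs_dist T \<Phi> (elementary_value (Y n)) \<le> ennreal ((1/16)^n)" for n
    using \<kappa>[of n] by (simp add: Y_def)
  obtain J where J: "L2_process J"
    "(\<lambda>n. sup_dist T J (elementary_integral W (Y n))) \<longlonglongrightarrow> 0"
  \<comment> \<open>Here \<open>16 = 4 * (2 + 2)\<close>: the elementary bound 4, and the factor 2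
    for the distance of each of two consecutive integrands from \<open>\<Phi>\<close>.\<close>
  proof (rule L2_continuous_limit[of "\<lambda>n. elementary_integral W (Y n)" 16])
    fix n
    show "ae_continuous_adapted (elementary_integral W (Y n))"
      by (rule elementary_integral_ae_continuous_adapted[OF Y])
    have "integrable M (\<lambda>\<omega>. (norm (elementary_integral W (Y n) T \<omega>))\<^sup>2)"
      using L2_martingale_elementary_integral[OF Y] TT by (auto simp: L2_martingale_def)
    then have "(\<integral>\<^sup>+\<omega>. ennreal ((norm (elementary_integral W (Y n) T \<omega>))\<^sup>2) \<partial>M) < \<infinity>"
      by (simp add: integrable_iff_bounded)
    then show "sup_sq_moment M T (elementary_integral W (Y n)) < \<infinity>"
      using doob_maximal[OF L2_martingale_elementary_integral[OF Y] elementary_integral_continuous[OF Y] TT, of n]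
      by (auto simp: ennreal_mult_less_top intro: le_less_trans)
    have "sup_sq_moment M T (\<lambda>t \<omega>. elementary_integral W (Y (Suc n)) t \<omega> - elementary_integral W (Y n) t \<omega>)
      \<le> 4 * hs_int T (\<lambda>t \<omega>. elementary_value (Y (Suc n)) t \<omega> - elementary_value (Y n) t \<omega>)"
      by (rule elementary_integral_diff_bound[OF Y Y TT])
    also have "hs_int T (\<lambda>t \<omega>. elementary_value (Y (Suc n)) t \<omega> - elementary_value (Y n) t \<omega>) =
       hs_int T (\<lambda>t \<omega>. (\<Phi> t \<omega> - elementary_value (Y n) t \<omega>) - (\<Phi> t \<omega> - elementary_value (Y (Suc n)) t \<omega>))"
      by simp
    also have "\<dots> \<le> 2 * hs_dist T \<Phi> (elementary_value (Y n))
        + 2 * hs_int T (\<lambda>t \<omega>. \<Phi> t \<omega> - elementary_value (Y (Suc n)) t \<omega>)"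
      by (intro hs_int_diff om order_refl)
    also have "\<dots> \<le> 2 * ennreal ((1/16)^n) + 2 * ennreal ((1/16)^n)"
    proof (intro add_mono mult_left_mono Yb)
      have "(1/16::real)^Suc n \<le> (1/16)^n" by simp
      then show "hs_int T (\<lambda>t \<omega>. \<Phi> t \<omega> - elementary_value (Y (Suc n)) t \<omega>) \<le> ennreal ((1/16)^n)"
        by (intro order_trans[OF Yb] ennreal_leI)
    qed auto
    finally have "sup_sq_moment M T (\<lambda>t \<omega>. elementary_integral W (Y (Suc n)) t \<omega> - elementary_integral W (Y n) t \<omega>)
       \<le> 4 * (2 * ennreal ((1/16)^n) + 2 * ennreal ((1/16)^n))" by (simp add: mult_left_mono)
    also have "\<dots> = ennreal (16 * (1/16)^n)"
      by (simp add: ennreal_mult distrib_left mult.assoc[symmetric]) (simp add: distrib_right[symmetric])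
    finally show "sup_sq_moment M T (\<lambda>t \<omega>. elementary_integral W (Y (Suc n)) t \<omega> - elementary_integral W (Y n) t \<omega>)
       \<le> ennreal (16 * (1/16)^n)" .
  qed auto
  have "(\<lambda>n. hs_sq_moment I e M T (\<lambda>t \<omega>. \<Phi> t \<omega> - elementary_value (Y n) t \<omega>)) \<longlonglongrightarrow> 0"
    unfolding L2_integrand_hs_int[OF \<Phi> Y]
  proof (rule tendsto_sandwich[OF _ _ tendsto_const])
    have "(\<lambda>n. ennreal ((1/16)^n)) \<longlonglongrightarrow> ennreal 0"
      by (intro tendsto_ennrealI LIMSEQ_power_zero) auto
    then show "(\<lambda>n. ennreal ((1/16)^n)) \<longlonglongrightarrow> 0" by simp
    show "\<forall>\<^sub>F n in sequentially. hs_dist T \<Phi> (elementary_value (Y n)) \<le> ennreal ((1/16)^n)"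
      using Yb by simp
  qed auto
  then have "ito_integral \<Phi> J"
    unfolding has_stochastic_integral_def using \<Phi> J Y by blast
  then show thesis by (rule that)
qed

end

section \<open>Approximation by elementary processes\<close>

lemma ennreal_suminf_tail_tendsto_0:
  fixes f :: "nat \<Rightarrow> ennreal"
  assumes "(\<Sum>l. f l) < \<infinity>"
  shows "(\<lambda>n. \<Sum>l. f l * indicator {n..} l) \<longlonglongrightarrow> 0"
proof -
  have "(\<lambda>n. \<integral>\<^sup>+l. f l * indicator {n..} l \<partial>count_space UNIV) \<longlonglongrightarrow> (\<integral>\<^sup>+l. 0 \<partial>count_space (UNIV::nat set))"
  proof (rule nn_integral_dominated_convergence[where w=f])
    show "(\<integral>\<^sup>+l. f l \<partial>count_space UNIV) < \<infinity>"
      using assms by (simp add: nn_integral_count_space_nat)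
    show "AE l in count_space UNIV. (\<lambda>n. f l * indicator {n..} l) \<longlonglongrightarrow> 0"
    proof (rule AE_I2)
      fix l :: nat
      have "\<forall>\<^sub>F n in sequentially. f l * indicator {n..} l = 0"
        using eventually_gt_at_top[of l] by eventually_elim simp
      then show "(\<lambda>n. f l * indicator {n..} l) \<longlonglongrightarrow> 0" by (rule tendsto_eventually)
    qed
  qed (auto split: split_indicator)
  then show ?thesis by (simp add: nn_integral_count_space_nat)
qed

text \<open>The cells are open on the left, as in \<open>elementary_value\<close>; they partition
  the times with \<open>0 < t \<le> T\<close> and miss the time 0.\<close>

lemma uniform_grid_index:
  fixes t T :: real
  assumes "0 < t" "t \<le> T"
  obtains i where "i < Suc n" "\<And>j. t \<in> {T * real j / real (Suc n)<..T * real (Suc j) / real (Suc n)} \<longleftrightarrow> j = i"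
proof -
  define y where "y = t * real (Suc n) / T"
  have T: "0 < T" using assms by simp
  have y: "0 < y" using assms by (simp add: y_def)
  have "t * real (Suc n) \<le> T * real (Suc n)" using assms by (intro mult_right_mono) auto
  then have y_le: "y \<le> real (Suc n)" using T unfolding y_def by (simp add: divide_le_eq mult.commute)
  have mem: "t \<in> {T * real j / real (Suc n)<..T * real (Suc j) / real (Suc n)} \<longleftrightarrow> real j < y \<and> y \<le> real (Suc j)" for j
  proof -
    have "T * real j / real (Suc n) < t \<longleftrightarrow> real j < y"
      using T unfolding y_def by (simp add: less_divide_eq divide_less_eq mult.commute)
    moreover have "t \<le> T * real (Suc j) / real (Suc n) \<longleftrightarrow> y \<le> real (Suc j)"
      using T unfolding y_def by (simp add: le_divide_eq divide_le_eq mult.commute del: of_nat_Suc)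
    ultimately show ?thesis by simp
  qed
  \<comment> \<open>Left-open cells call for the ceiling minus 1 instead of the floor, so that a
    grid point belongs to the cell it ends.\<close>
  define i where "i = nat (\<lceil>y\<rceil> - 1)"
  have c: "1 \<le> \<lceil>y\<rceil>" using y by (simp add: one_le_ceiling)
  have ri: "real i = real_of_int \<lceil>y\<rceil> - 1" using c by (simp add: i_def)
  have "real i < y" "y \<le> real (Suc i)" unfolding of_nat_Suc ri by linarith+
  moreover have "j = i" if "real j < y" "y \<le> real (Suc j)" for j
  proof -
    have "real j < real (Suc i)" "real i < real (Suc j)"
      using that calculation by linarith+
    then show ?thesis by linarith
  qed
  ultimately have "t \<in> {T * real j / real (Suc n)<..T * real (Suc j) / real (Suc n)} \<longleftrightarrow> j = i" for j
    unfolding mem by blast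
  moreover have "i < Suc n"
    using \<open>real i < y\<close> y_le by linarith
  ultimately show thesis using that by blast
qed

text \<open>The time is rounded down to a grid, which leaves a countable case distinction, and path
  continuity recovers the limit. The measure \<open>N\<close> is free: \<open>M\<close> gives joint
  measurability, while \<open>F t\<close> gives progressive measurability up to time
  \<open>t\<close>.\<close>

lemma joint_measurable_continuous:
  fixes X :: "real \<Rightarrow> 'w \<Rightarrow> 'b::metric_space"
  assumes X: "\<And>s. s \<in> {0..t} \<Longrightarrow> X s \<in> borel_measurable N"
    and cont: "\<And>\<omega>. \<omega> \<in> space N \<Longrightarrow> continuous_on {0..t} (\<lambda>s. X s \<omega>)"
    and \<tau>[measurable]: "\<tau> \<in> borel_measurable K" and \<tau>_in: "\<And>p. p \<in> space K \<Longrightarrow> \<tau> p \<in> {0..t}"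
    and \<omega>: "f \<in> measurable K N"
  shows "(\<lambda>p. X (\<tau> p) (f p)) \<in> borel_measurable K"
proof (rule borel_measurable_LIMSEQ_metric)
  fix m :: nat
  \<comment> \<open>On \<open>space K\<close> the minimum changes nothing, but it confines the index
    to a finite set for every argument.\<close>
  define \<kappa> where "\<kappa> p = min (nat \<lfloor>\<tau> p * real (Suc m) / t\<rfloor>) (Suc m)" for p
  have "(\<lambda>p. X (t * real (\<kappa> p) / real (Suc m)) (f p)) \<in> borel_measurable K"
  \<comment> \<open>Only a point of \<open>K\<close> guarantees that \<open>{0..t}\<close> is
    nonempty.\<close>
  proof (cases "space K = {}")
    case True
    then show ?thesis by (auto simp: measurable_def sets_eq_bot space_empty_iff)
  next
    case False
    then have t: "0 \<le> t" using \<tau>_in by fastforce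
    show ?thesis
    proof (rule measurable_compose_countable'[where I="{..Suc m}" and g=\<kappa>
        and f="\<lambda>k p. X (t * real k / real (Suc m)) (f p)"])
      fix k assume k: "k \<in> {..Suc m}"
      have "t * real k / real (Suc m) \<in> {0..t}" using k by (intro grid_point_in t) auto
      then show "(\<lambda>p. X (t * real k / real (Suc m)) (f p)) \<in> borel_measurable K"
        by (rule measurable_compose[OF \<omega> X])
    next
      have "(\<lambda>p. min (nat \<lfloor>\<tau> p * real (Suc m) / t\<rfloor>) (Suc m)) \<in> measurable K (count_space UNIV)"
        by measurable
      then show "\<kappa> \<in> measurable K (count_space {..Suc m})"
        unfolding \<kappa>_def[abs_def] by (auto simp: measurable_count_space_eq2_countable)
    qed auto
  qed
  then show "(\<lambda>p. X (round_down m t (\<tau> p)) (f p)) \<in> borel_measurable K"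
  proof (rule measurable_cong[THEN iffD1, rotated])
    fix p assume "p \<in> space K"
    then show "X (t * real (\<kappa> p) / real (Suc m)) (f p) = X (round_down m t (\<tau> p)) (f p)"
      using round_down_bounds(1)[OF \<tau>_in, of p m] by (simp add: \<kappa>_def round_down_def)
  qed
next
  fix p assume p: "p \<in> space K"
  show "(\<lambda>m. X (round_down m t (\<tau> p)) (f p)) \<longlonglongrightarrow> X (\<tau> p) (f p)"
    using cont[OF measurable_space[OF \<omega> p]] round_down_tendsto[OF \<tau>_in[OF p]] round_down_in[OF \<tau>_in[OF p]] \<tau>_in[OF p]
    unfolding continuous_on_sequentially by (auto simp: comp_def)
qed

context wiener_space
begin

text \<open>Frozen at the left endpoints of a uniform grid, restricted to the first \<open>n\<close> basis vectors,
  and cut off at height \<open>n\<close>.\<close>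

definition elementary_approx :: "(real \<Rightarrow> 'w \<Rightarrow> ('h \<Rightarrow>\<^sub>L 'h)) \<Rightarrow> nat \<Rightarrow> ('w, 'h) elementary" where
  "elementary_approx \<Phi> n = map (\<lambda>(i, k). (T * real i / real (Suc n), T * real (Suc i) / real (Suc n), e k,
      \<lambda>\<omega>. if norm (\<Phi> (T * real i / real (Suc n)) \<omega> (e k)) \<le> real n
           then \<Phi> (T * real i / real (Suc n)) \<omega> (e k) else 0))
    (List.product [0..<Suc n] (filter (\<lambda>k. k \<in> I) [0..<n]))"

lemma elementary_approx_process:
  fixes \<Phi> :: "real \<Rightarrow> 'w \<Rightarrow> ('h \<Rightarrow>\<^sub>L 'h)"
  assumes "\<And>t h. t \<in> {0..T} \<Longrightarrow> (\<lambda>\<omega>. \<Phi> t \<omega> h) \<in> borel_measurable (F t)"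
  shows "elementary_process M F T (elementary_approx \<Phi> n)"
  unfolding elementary_process_def
proof (rule ballI, clarify)
  fix s u h \<xi> assume "(s, u, h, \<xi>) \<in> set (elementary_approx \<Phi> n)"
  then obtain i k where i: "i < Suc n"
    and eq: "s = T * real i / real (Suc n)" "u = T * real (Suc i) / real (Suc n)"
      "\<xi> = (\<lambda>\<omega>. if norm (\<Phi> (T * real i / real (Suc n)) \<omega> (e k)) \<le> real n
        then \<Phi> (T * real i / real (Suc n)) \<omega> (e k) else 0)"
    unfolding elementary_approx_def by (auto simp del: of_nat_Suc upt_Suc)
  have s: "s \<in> {0..T}" unfolding eq using i T_pos by (intro grid_point_in) auto
  have u: "u \<in> {0..T}" unfolding eq using i T_pos by (intro grid_point_in) auto
  have su: "s \<le> u"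
    unfolding eq using T_pos by (intro divide_right_mono mult_left_mono) auto
  note [measurable] = assms[OF s, of "e k"]
  have "\<xi> \<in> borel_measurable (F s)" unfolding eq(3) eq(1)[symmetric] by measurable
  moreover have "\<forall>\<omega>\<in>space M. norm (\<xi> \<omega>) \<le> real n" unfolding eq(3) by auto
  ultimately show "0 \<le> s \<and> s \<le> u \<and> u \<le> T \<and> \<xi> \<in> borel_measurable (F s) \<and> (\<exists>B. \<forall>\<omega>\<in>space M. norm (\<xi> \<omega>) \<le> B)"
    using s u su by auto
qed

text \<open>At a positive time exactly one grid cell is active; \<open>r\<close> is its left
  endpoint, and by orthonormality each basis vector sees only its own summand.\<close>

lemma elementary_approx_value:
  assumes t: "0 < t" "t \<le> T"
  obtains r where "r \<in> {0..T}" "\<bar>r - t\<bar> \<le> T / real (Suc n)"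
    "\<And>\<omega> l. l \<in> I \<Longrightarrow> elementary_value (elementary_approx \<Phi> n) t \<omega> (e l) =
       (if l < n then if norm (\<Phi> r \<omega> (e l)) \<le> real n then \<Phi> r \<omega> (e l) else 0 else 0)"
proof -
  obtain i where i: "i < Suc n"
    "\<And>j. t \<in> {T * real j / real (Suc n)<..T * real (Suc j) / real (Suc n)} \<longleftrightarrow> j = i"
    using uniform_grid_index[OF t, of n] by metis
  define r where "r = T * real i / real (Suc n)"
  define K where "K = {k. k < n \<and> k \<in> I}"
  define \<xi> where "\<xi> j k \<omega> = (if norm (\<Phi> (T * real j / real (Suc n)) \<omega> (e k)) \<le> real n
           then \<Phi> (T * real j / real (Suc n)) \<omega> (e k) else 0)" for j k \<omega>
  have ind: "indicat_real {T * real j / real (Suc n)<..T * real (Suc j) / real (Suc n)} t = (if j = i then 1 else 0)" for j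
    using i(2)[of j] unfolding indicator_def by auto
  have dist: "distinct (List.product [0..<Suc n] (filter (\<lambda>k. k \<in> I) [0..<n]))"
    by (intro distinct_product distinct_filter distinct_upt)
  have set: "set (List.product [0..<Suc n] (filter (\<lambda>k. k \<in> I) [0..<n])) = {..<Suc n} \<times> K"
    by (auto simp: K_def)
  have val: "elementary_value (elementary_approx \<Phi> n) t \<omega> =
     (\<Sum>k\<in>K. blinfun_scaleR_left (\<xi> i k \<omega>) o\<^sub>L blinfun_inner_right (e k))" for \<omega>
  proof -
    have "elementary_value (elementary_approx \<Phi> n) t \<omega> =
      (\<Sum>(j, k)\<leftarrow>List.product [0..<Suc n] (filter (\<lambda>k. k \<in> I) [0..<n]).
         (if j = i then 1 else 0) *\<^sub>R (blinfun_scaleR_left (\<xi> j k \<omega>) o\<^sub>L blinfun_inner_right (e k)))"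
      unfolding elementary_value_def elementary_approx_def ind[symmetric] \<xi>_def map_map comp_def
      by (simp add: case_prod_unfold)
    also have "\<dots> = (\<Sum>(j, k)\<in>{..<Suc n} \<times> K. (if j = i then 1 else 0) *\<^sub>R (blinfun_scaleR_left (\<xi> j k \<omega>) o\<^sub>L blinfun_inner_right (e k)))"
      unfolding set[symmetric] by (rule sum_list_distinct_conv_sum_set[OF dist])
    also have "\<dots> = (\<Sum>j<Suc n. \<Sum>k\<in>K. (if j = i then 1 else 0) *\<^sub>R (blinfun_scaleR_left (\<xi> j k \<omega>) o\<^sub>L blinfun_inner_right (e k)))"
      by (rule sum.cartesian_product[symmetric])
    also have "\<dots> = (\<Sum>j<Suc n. if j = i then (\<Sum>k\<in>K. blinfun_scaleR_left (\<xi> i k \<omega>) o\<^sub>L blinfun_inner_right (e k)) else 0)"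
      by (intro sum.cong) auto
    also have "\<dots> = (\<Sum>k\<in>K. blinfun_scaleR_left (\<xi> i k \<omega>) o\<^sub>L blinfun_inner_right (e k))"
      using i(1) by (subst sum.delta) auto
    finally show ?thesis .
  qed
  have "elementary_value (elementary_approx \<Phi> n) t \<omega> (e l) =
       (if l < n then if norm (\<Phi> r \<omega> (e l)) \<le> real n then \<Phi> r \<omega> (e l) else 0 else 0)" if l: "l \<in> I" for \<omega> l
  proof -
    have "elementary_value (elementary_approx \<Phi> n) t \<omega> (e l) = (\<Sum>k\<in>K. (e k \<bullet> e l) *\<^sub>R \<xi> i k \<omega>)"
      unfolding val by (simp add: blinfun.sum_left)
    also have "\<dots> = (\<Sum>k\<in>K. if k = l then \<xi> i l \<omega> else 0)"
      using basis l unfolding orthonormal_basis_def by (intro sum.cong) (auto simp: K_def)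
    also have "\<dots> = (if l \<in> K then \<xi> i l \<omega> else 0)"
      by (subst sum.delta) (auto simp: K_def)
    also have "\<dots> = (if l < n then if norm (\<Phi> r \<omega> (e l)) \<le> real n then \<Phi> r \<omega> (e l) else 0 else 0)"
      using l by (auto simp: K_def \<xi>_def r_def)
    finally show ?thesis .
  qed
  moreover have "r \<in> {0..T}" unfolding r_def using i(1) T_pos by (intro grid_point_in) auto
  moreover have "\<bar>r - t\<bar> \<le> T / real (Suc n)"
  proof -
    have "t \<in> {T * real i / real (Suc n)<..T * real (Suc i) / real (Suc n)}" using i(2) by blast
    moreover have "T * real (Suc i) / real (Suc n) = r + T / real (Suc n)"
      unfolding r_def by (simp add: add_divide_distrib distrib_left)
    ultimately show ?thesis unfolding r_def[symmetric] by auto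
  qed
  ultimately show thesis using that by blast
qed

text \<open>Dominated convergence, first in time for a fixed path and then over the probability
  space, with \<open>4 * G \<omega>\<close> as the dominating bound at each time. Freezing,
  truncation and cutoff are controlled respectively by continuity of the path in Hilbert--Schmidt
  norm, by the tail of a convergent series, and by \<open>G\<close>.\<close>

lemma elementary_approximation:
  fixes \<Phi> :: "real \<Rightarrow> 'w \<Rightarrow> ('h \<Rightarrow>\<^sub>L 'h)"
  assumes adapted: "\<And>t h. t \<in> {0..T} \<Longrightarrow> (\<lambda>\<omega>. \<Phi> t \<omega> h) \<in> borel_measurable (F t)"
    and om: "op_measurable \<Phi>"
    and cont: "\<And>\<omega> t r. \<omega> \<in> space M \<Longrightarrow> t \<in> {0..T} \<Longrightarrow> (\<And>n. r n \<in> {0..T}) \<Longrightarrow> r \<longlonglongrightarrow> t \<Longrightarrow>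
       (\<lambda>n. hsq I e (\<Phi> t \<omega> - \<Phi> (r n) \<omega>)) \<longlonglongrightarrow> 0"
    and bound: "\<And>\<omega> t. \<omega> \<in> space M \<Longrightarrow> t \<in> {0..T} \<Longrightarrow> hsq I e (\<Phi> t \<omega>) \<le> G \<omega>"
    and G: "G \<in> borel_measurable M" "(\<integral>\<^sup>+\<omega>. G \<omega> \<partial>M) < \<infinity>"
  shows "(\<lambda>n. hs_dist T \<Phi> (elementary_value (elementary_approx \<Phi> n))) \<longlonglongrightarrow> 0"
proof -
  let ?v = "\<lambda>n. elementary_value (elementary_approx \<Phi> n)"
  have om_d: "op_measurable (\<lambda>t \<omega>. \<Phi> t \<omega> - ?v n t \<omega>)" for n
    by (intro op_measurable_diff om op_measurable_elementary_value elementary_approx_process adapted)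
  \<comment> \<open>Truncation and cutoff only replace columns of \<open>\<Phi> r\<close> by 0, so
    the approximant obeys the same bound \<open>G\<close>; the triangle inequality turns this into
    \<open>2 G + 2 G\<close>.\<close>
  have b: "hsq I e (\<Phi> t \<omega> - ?v n t \<omega>) \<le> 4 * G \<omega>" if \<omega>: "\<omega> \<in> space M" and t: "0 < t" "t \<le> T" for n t \<omega>
  proof -
    obtain r where r: "r \<in> {0..T}" "\<And>\<omega> l. l \<in> I \<Longrightarrow> ?v n t \<omega> (e l) =
       (if l < n then if norm (\<Phi> r \<omega> (e l)) \<le> real n then \<Phi> r \<omega> (e l) else 0 else 0)"
      using elementary_approx_value[OF t, of n \<Phi>] by metis
    have "hsq I e (?v n t \<omega>) \<le> hsq I e (\<Phi> r \<omega>)"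
      unfolding hsq_def by (intro suminf_le ennreal_leI) (auto simp: r(2))
    also have "\<dots> \<le> G \<omega>" by (rule bound[OF \<omega> r(1)])
    finally have "hsq I e (\<Phi> t \<omega> - ?v n t \<omega>) \<le> 2 * G \<omega> + 2 * G \<omega>"
      using bound[OF \<omega>, of t] t
      by (intro order_trans[OF hsq_diff] add_mono mult_left_mono) auto
    then show ?thesis by (simp add: distrib_right[symmetric])
  qed
  have conv: "(\<lambda>n. hsq I e (\<Phi> t \<omega> - ?v n t \<omega>)) \<longlonglongrightarrow> 0"
    if \<omega>: "\<omega> \<in> space M" "G \<omega> < \<infinity>" and t: "0 < t" "t \<le> T" for t \<omega>
  proof -
    have "\<forall>n. \<exists>r. r \<in> {0..T} \<and> \<bar>r - t\<bar> \<le> T / real (Suc n) \<and> (\<forall>l\<in>I. ?v n t \<omega> (e l) =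
       (if l < n then if norm (\<Phi> r \<omega> (e l)) \<le> real n then \<Phi> r \<omega> (e l) else 0 else 0))"
      using elementary_approx_value[OF t, of _ \<Phi>] by metis
    then obtain r where r: "\<And>n. r n \<in> {0..T}" "\<And>n. \<bar>r n - t\<bar> \<le> T / real (Suc n)"
      "\<And>n l. l \<in> I \<Longrightarrow> ?v n t \<omega> (e l) =
       (if l < n then if norm (\<Phi> (r n) \<omega> (e l)) \<le> real n then \<Phi> (r n) \<omega> (e l) else 0 else 0)" by metis
    have tin: "t \<in> {0..T}" using t by auto
    have "(\<lambda>n. r n - t) \<longlonglongrightarrow> 0"
      by (rule Lim_null_comparison[OF _ LIMSEQ_Suc[OF lim_const_over_n[of T]]]) (use r(2) in auto)
    then have "r \<longlonglongrightarrow> t" by (simp add: LIM_zero_iff)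
    then have c: "(\<lambda>n. hsq I e (\<Phi> t \<omega> - \<Phi> (r n) \<omega>)) \<longlonglongrightarrow> 0" by (rule cont[OF \<omega>(1) tin r(1)])
    let ?f = "\<lambda>l. ennreal (if l \<in> I then (norm (\<Phi> t \<omega> (e l)))\<^sup>2 else 0)"
    have "(\<Sum>l. ?f l) < \<infinity>" using bound[OF \<omega>(1) tin] \<omega>(2) unfolding hsq_def by (rule le_less_trans)
    then have tail: "(\<lambda>n. \<Sum>l. ?f l * indicator {n..} l) \<longlonglongrightarrow> 0" by (rule ennreal_suminf_tail_tendsto_0)
    obtain g where g: "G \<omega> = ennreal g" "0 \<le> g" using \<omega>(2) by (auto simp: less_top_ennreal)
    \<comment> \<open>On a fixed path all columns are bounded by one number, uniformly in time, so
      the cutoff at height \<open>n\<close> is eventually inactive.\<close>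
    have small: "norm (\<Phi> (r n) \<omega> (e l)) \<le> sqrt g" if "l \<in> I" for n l
    proof -
      have "ennreal ((norm (\<Phi> (r n) \<omega> (e l)))\<^sup>2) \<le> hsq I e (\<Phi> (r n) \<omega>) * ennreal ((norm (e l))\<^sup>2)"
        by (rule norm_blinfun_le_hsq[OF basis])
      also have "(norm (e l))\<^sup>2 = 1"
        using basis that by (auto simp: orthonormal_basis_def power2_norm_eq_inner)
      also have "hsq I e (\<Phi> (r n) \<omega>) * ennreal 1 \<le> ennreal g"
        using bound[OF \<omega>(1) r(1)] g(1) by simp
      finally show ?thesis using g(2) by (auto intro: real_le_rsqrt)
    qed
    \<comment> \<open>Columns below \<open>n\<close> contribute at most the freezing error; columns
      from \<open>n\<close> on are missing from the approximant and contribute a tail of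
      \<open>\<Phi> t\<close> itself.\<close>
    have up: "\<forall>\<^sub>F n in sequentially. hsq I e (\<Phi> t \<omega> - ?v n t \<omega>) \<le>
        hsq I e (\<Phi> t \<omega> - \<Phi> (r n) \<omega>) + (\<Sum>l. ?f l * indicator {n..} l)"
      using eventually_ge_at_top[of "nat \<lceil>sqrt g\<rceil>"]
    proof eventually_elim
      case (elim n)
      then have "sqrt g \<le> real n" by linarith
      then have v: "?v n t \<omega> (e l) = (if l < n then \<Phi> (r n) \<omega> (e l) else 0)" if "l \<in> I" for l
        using small[OF that, of n] r(3)[OF that, of n] by auto
      have "hsq I e (\<Phi> t \<omega> - ?v n t \<omega>) \<le>
         (\<Sum>l. ennreal (if l \<in> I then (norm ((\<Phi> t \<omega> - \<Phi> (r n) \<omega>) (e l)))\<^sup>2 else 0) + ?f l * indicator {n..} l)"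
        unfolding hsq_def
        by (intro suminf_le) (auto simp: blinfun.diff_left v split: split_indicator)
      also have "\<dots> = hsq I e (\<Phi> t \<omega> - \<Phi> (r n) \<omega>) + (\<Sum>l. ?f l * indicator {n..} l)"
        unfolding hsq_def by (rule suminf_add[symmetric]) auto
      finally show ?case .
    qed
    show ?thesis
    proof (rule tendsto_sandwich[OF _ up tendsto_const])
      show "(\<lambda>n. hsq I e (\<Phi> t \<omega> - \<Phi> (r n) \<omega>) + (\<Sum>l. ?f l * indicator {n..} l)) \<longlonglongrightarrow> 0"
        using tendsto_add[OF c tail] by simp
    qed auto
  qed
  \<comment> \<open>At time 0 no cell is active and the approximant is 0; this single time is
    discarded.\<close>
  have AE_pos: "AE t in lborel. t \<noteq> (0::real)" by (rule AE_lborel_singleton)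
  have AE_pos: "AE t in time_space. 0 < t \<and> t \<le> T"
  proof (rule AE_restrict_space_iff[THEN iffD2])
    show "AE t in lborel. t \<in> {0..T} \<longrightarrow> 0 < t \<and> t \<le> T"
      using AE_pos by eventually_elim auto
  qed simp
  have fin_time: "(\<integral>\<^sup>+t. c \<partial>time_space) = c * ennreal T" for c :: ennreal
    using T_pos by (simp add: nn_integral_const emeasure_restrict_space space_restrict_space)
  have TT: "(\<integral>\<^sup>+s\<in>{0..T}. f s \<partial>lborel) = (\<integral>\<^sup>+s. f s \<partial>time_space)" for f :: "real \<Rightarrow> ennreal"
    by (simp add: nn_integral_restrict_space)
  have inner: "(\<lambda>n. \<integral>\<^sup>+t\<in>{0..T}. hsq I e (\<Phi> t \<omega> - ?v n t \<omega>) \<partial>lborel) \<longlonglongrightarrow> 0"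
    if \<omega>: "\<omega> \<in> space M" "G \<omega> < \<infinity>" for \<omega>
  proof -
    have "(\<lambda>n. \<integral>\<^sup>+t. hsq I e (\<Phi> t \<omega> - ?v n t \<omega>) \<partial>time_space) \<longlonglongrightarrow> (\<integral>\<^sup>+t. 0 \<partial>time_space)"
    proof (rule nn_integral_dominated_convergence[where w="\<lambda>t. 4 * G \<omega>"])
      show "(\<integral>\<^sup>+t. 4 * G \<omega> \<partial>time_space) < \<infinity>"
        using \<omega>(2) unfolding fin_time by (simp add: ennreal_mult_less_top)
      show "AE t in time_space. hsq I e (\<Phi> t \<omega> - ?v n t \<omega>) \<le> 4 * G \<omega>" for n
        using AE_pos by eventually_elim (auto intro: b[OF \<omega>(1)])
      show "AE t in time_space. (\<lambda>n. hsq I e (\<Phi> t \<omega> - ?v n t \<omega>)) \<longlonglongrightarrow> 0"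
        using AE_pos by eventually_elim (auto intro: conv[OF \<omega>])
    qed (auto intro: hsq_measurable_time[OF om_d \<omega>(1)])
    then show ?thesis unfolding TT by simp
  qed
  have "(\<lambda>n. hs_dist T \<Phi> (?v n)) \<longlonglongrightarrow> (\<integral>\<^sup>+\<omega>. 0 \<partial>M)"
    unfolding hs_int_def
  proof (rule nn_integral_dominated_convergence[where w="\<lambda>\<omega>. 4 * G \<omega> * ennreal T"])
    note G(1)[measurable]
    show "(\<lambda>\<omega>. 4 * G \<omega> * ennreal T) \<in> borel_measurable M" by measurable
    show "(\<integral>\<^sup>+\<omega>. 4 * G \<omega> * ennreal T \<partial>M) < \<infinity>"
      using G by (simp add: nn_integral_multc nn_integral_cmult ennreal_mult_less_top)
    have "AE \<omega> in M. G \<omega> \<noteq> \<infinity>" using G by (intro nn_integral_PInf_AE) auto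
    with AE_space show "AE \<omega> in M. (\<lambda>n. \<integral>\<^sup>+t\<in>{0..T}. hsq I e (\<Phi> t \<omega> - ?v n t \<omega>) \<partial>lborel) \<longlonglongrightarrow> 0"
      by eventually_elim (rule inner, auto simp: less_top)
    show "AE \<omega> in M. (\<integral>\<^sup>+t\<in>{0..T}. hsq I e (\<Phi> t \<omega> - ?v n t \<omega>) \<partial>lborel) \<le> 4 * G \<omega> * ennreal T" for n
    proof (rule AE_I2)
      fix \<omega> assume \<omega>: "\<omega> \<in> space M"
      have "(\<integral>\<^sup>+t. hsq I e (\<Phi> t \<omega> - ?v n t \<omega>) \<partial>time_space) \<le> (\<integral>\<^sup>+t. 4 * G \<omega> \<partial>time_space)"
      proof (rule nn_integral_mono_AE)
        show "AE t in time_space. hsq I e (\<Phi> t \<omega> - ?v n t \<omega>) \<le> 4 * G \<omega>"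
          using AE_pos by eventually_elim (auto intro: b[OF \<omega>])
      qed
      then show "(\<integral>\<^sup>+t\<in>{0..T}. hsq I e (\<Phi> t \<omega> - ?v n t \<omega>) \<partial>lborel) \<le> 4 * G \<omega> * ennreal T"
        unfolding TT fin_time .
    qed
  qed (auto intro: hsq_integral_measurable[OF om_d])
  then show ?thesis by simp
qed

end

section \<open>Drift and diffusion terms\<close>

text \<open>The drift is merely measurable in time but continuous in space. For a simple function in
  place of \<open>Z\<close> only countably many values of the second argument occur; continuity
  gives the limit.\<close>

lemma caratheodory_measurable:
  fixes f :: "real \<Rightarrow> 'b::{metric_space, second_countable_topology} \<Rightarrow> 'c::metric_space"
  assumes f: "\<And>x. (\<lambda>s. f s x) \<in> borel_measurable borel" "\<And>s. continuous_on UNIV (f s)"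
    and \<tau>: "\<tau> \<in> borel_measurable K" and Z: "Z \<in> borel_measurable K"
  shows "(\<lambda>p. f (\<tau> p) (Z p)) \<in> borel_measurable K"
proof -
  obtain S where S: "\<And>i. simple_function K (S i)" "\<And>p. p \<in> space K \<Longrightarrow> (\<lambda>i. S i p) \<longlonglongrightarrow> Z p"
    using borel_measurable_implies_sequence_metric[OF Z] by blast
  show ?thesis
  proof (rule borel_measurable_LIMSEQ_metric)
    fix i
    show "(\<lambda>p. f (\<tau> p) (S i p)) \<in> borel_measurable K"
    proof (rule measurable_compose_countable'[where I="S i ` space K" and g="S i" and f="\<lambda>x p. f (\<tau> p) x"])
      show "(\<lambda>p. f (\<tau> p) x) \<in> borel_measurable K" for x
        by (rule measurable_compose[OF \<tau> f(1)])
      show "S i \<in> measurable K (count_space (S i ` space K))"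
        using S(1)[of i] unfolding simple_function_def by (subst measurable_count_space_eq2) auto
      show "countable (S i ` space K)"
        using S(1)[of i] by (auto simp: simple_function_def intro: countable_finite)
    qed
  next
    fix p assume p: "p \<in> space K"
    show "(\<lambda>i. f (\<tau> p) (S i p)) \<longlonglongrightarrow> f (\<tau> p) (Z p)"
      using f(2)[of "\<tau> p"] S(2)[OF p] unfolding continuous_on_sequentially by (auto simp: comp_def)
  qed
qed

text \<open>The abstract equation: \<open>g\<close> stands for the square root of
  \<open>\<beta>\<close> and \<open>\<sigma>\<close> for the product of the two operator square
  roots. \<open>cg\<close> bounds the square of \<open>g\<close>, and \<open>Ls\<close> is a squared
  Lipschitz constant, in line with the squared estimates.\<close>

locale sde_space = wiener_space M F T W I e
  for M :: "'w measure" and F :: "real \<Rightarrow> 'w measure" and T :: real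
    and W :: "real \<Rightarrow> 'h::{real_inner, banach, second_countable_topology} \<Rightarrow> 'w \<Rightarrow> real"
    and I :: "nat set" and e :: "nat \<Rightarrow> 'h" +
  fixes b :: "real \<Rightarrow> 'h \<Rightarrow> 'h" and g :: "real \<Rightarrow> real" and \<sigma> :: "'h \<Rightarrow> ('h \<Rightarrow>\<^sub>L 'h)"
    and Lb Ls cg :: real
  assumes b_lipschitz: "\<And>t. t \<in> {0..T} \<Longrightarrow> Lb-lipschitz_on UNIV (b t)"
    and b_integrable: "\<And>x. set_integrable lborel {0..T} (\<lambda>t. b t x)"
    and g_continuous: "continuous_on {0..T} g" and g_bound: "\<And>t. t \<in> {0..T} \<Longrightarrow> (g t)\<^sup>2 \<le> cg"
    and \<sigma>_hs: "\<And>x. hilbert_schmidt I e (\<sigma> x)"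
    and \<sigma>_lipschitz: "\<And>x y. hsq I e (\<sigma> x - \<sigma> y) \<le> ennreal (Ls * (norm (x - y))\<^sup>2)"
    and Ls_nonneg: "0 \<le> Ls"
begin

lemma Lb_nonneg: "0 \<le> Lb"
  using b_lipschitz[of 0] T_pos lipschitz_on_nonneg by fastforce

lemma cg_nonneg: "0 \<le> cg"
  using order_trans[OF zero_le_power2 g_bound[of 0]] T_pos by simp

lemma \<sigma>_apply_continuous: "continuous_on UNIV (\<lambda>x. \<sigma> x h)"
proof (rule lipschitz_on_continuous_on)
  show "(sqrt (Ls * (norm h)\<^sup>2))-lipschitz_on UNIV (\<lambda>x. \<sigma> x h)"
  proof (rule lipschitz_onI)
    fix x y
    have "ennreal ((norm ((\<sigma> x - \<sigma> y) h))\<^sup>2) \<le> hsq I e (\<sigma> x - \<sigma> y) * ennreal ((norm h)\<^sup>2)"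
      by (rule norm_blinfun_le_hsq[OF basis])
    also have "\<dots> \<le> ennreal (Ls * (norm (x - y))\<^sup>2) * ennreal ((norm h)\<^sup>2)"
      by (intro mult_right_mono \<sigma>_lipschitz) auto
    also have "\<dots> = ennreal ((sqrt (Ls * (norm h)\<^sup>2) * norm (x - y))\<^sup>2)"
      using Ls_nonneg by (simp add: ennreal_mult[symmetric] power_mult_distrib mult_ac)
    finally have "(norm ((\<sigma> x - \<sigma> y) h))\<^sup>2 \<le> (sqrt (Ls * (norm h)\<^sup>2) * norm (x - y))\<^sup>2"
      by (subst (asm) ennreal_le_iff) auto
    then have "norm ((\<sigma> x - \<sigma> y) h) \<le> sqrt (Ls * (norm h)\<^sup>2) * norm (x - y)"
      by (rule power2_le_imp_le) (use Ls_nonneg in auto)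
    then show "dist (\<sigma> x h) (\<sigma> y h) \<le> sqrt (Ls * (norm h)\<^sup>2) * dist x y"
      by (simp add: dist_norm blinfun.diff_left)
  qed (use Ls_nonneg in auto)
qed

section \<open>The diffusion coefficient along a process\<close>

definition diffusion :: "(real \<Rightarrow> 'w \<Rightarrow> 'h) \<Rightarrow> real \<Rightarrow> 'w \<Rightarrow> ('h \<Rightarrow>\<^sub>L 'h)" where
  "diffusion X t \<omega> = g t *\<^sub>R \<sigma> (X t \<omega>)"

lemma hilbert_schmidt_diffusion: "hilbert_schmidt I e (diffusion X t \<omega>)"
  using \<sigma>_hs[of "X t \<omega>"] unfolding hilbert_schmidt_iff_hsq diffusion_def hsq_scaleR
  by (simp add: ennreal_mult_less_top)

lemma diffusion_adapted:
  assumes "path_process X" "t \<in> {0..T}"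
  shows "(\<lambda>\<omega>. diffusion X t \<omega> h) \<in> borel_measurable (F t)"
  using assms unfolding diffusion_def blinfun.scaleR_left continuous_adapted_def
  by (intro borel_measurable_scaleR borel_measurable_const
      measurable_compose[OF _ borel_measurable_continuous_onI[OF \<sigma>_apply_continuous]]) auto

lemma diffusion_op_measurable:
  assumes "path_process X"
  shows "op_measurable (diffusion X)"
  unfolding op_measurable_def case_prod_unfold
proof
  fix h
  have c: "continuous_on {0..T} (\<lambda>t. diffusion X t \<omega> h)" if "\<omega> \<in> space M" for \<omega>
    using assms that unfolding diffusion_def blinfun.scaleR_left continuous_adapted_def
    by (intro continuous_on_scaleR g_continuous continuous_on_compose2[OF \<sigma>_apply_continuous]) auto
  have m: "(\<lambda>\<omega>. diffusion X t \<omega> h) \<in> borel_measurable M" if "t \<in> {0..T}" for t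
    by (rule measurable_F_M[OF diffusion_adapted[OF assms that]])
  show "(\<lambda>p. diffusion X (fst p) (snd p) h) \<in> borel_measurable (time_space \<Otimes>\<^sub>M M)"
    by (rule joint_measurable_continuous[where t=T and N=M, OF m c measurable_fst_time_space _ measurable_snd])
      (auto simp: space_pair_measure space_restrict_space)
qed

lemma hsq_diffusion_diff:
  assumes "t \<in> {0..T}"
  shows "hsq I e (diffusion X t \<omega> - diffusion Y t \<omega>) \<le> ennreal (cg * Ls) * ennreal ((norm (X t \<omega> - Y t \<omega>))\<^sup>2)"
proof -
  have "hsq I e (diffusion X t \<omega> - diffusion Y t \<omega>) = ennreal ((g t)\<^sup>2) * hsq I e (\<sigma> (X t \<omega>) - \<sigma> (Y t \<omega>))"
    unfolding diffusion_def scaleR_diff_right[symmetric] hsq_scaleR ..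
  also have "\<dots> \<le> ennreal cg * ennreal (Ls * (norm (X t \<omega> - Y t \<omega>))\<^sup>2)"
    by (intro mult_mono ennreal_leI g_bound assms \<sigma>_lipschitz) auto
  finally show ?thesis using cg_nonneg Ls_nonneg by (simp add: ennreal_mult[symmetric] mult.assoc)
qed

lemma hsq_diffusion_continuous:
  assumes X: "continuous_on {0..T} (\<lambda>t. X t \<omega>)" and t: "t \<in> {0..T}"
    and r: "\<And>n::nat. r n \<in> {0..T}" "r \<longlonglongrightarrow> t"
  shows "(\<lambda>n. hsq I e (diffusion X t \<omega> - diffusion X (r n) \<omega>)) \<longlonglongrightarrow> 0"
proof -
  obtain H where H: "hsq I e (\<sigma> (X t \<omega>)) = ennreal H" "0 \<le> H"
    using \<sigma>_hs[of "X t \<omega>"] unfolding hilbert_schmidt_iff_hsq by (auto simp: less_top_ennreal)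
  have Xr: "(\<lambda>n. X (r n) \<omega>) \<longlonglongrightarrow> X t \<omega>" and gr: "(\<lambda>n. g (r n)) \<longlonglongrightarrow> g t"
    using X g_continuous t r unfolding continuous_on_sequentially by (auto simp: comp_def)
  show ?thesis
  proof (rule tendsto_sandwich[OF _ _ tendsto_const])
    have "(\<lambda>n. ennreal (2 * ((g t - g (r n))\<^sup>2 * H) + 2 * (cg * (Ls * (norm (X t \<omega> - X (r n) \<omega>))\<^sup>2))))
       \<longlonglongrightarrow> ennreal (2 * ((g t - g t)\<^sup>2 * H) + 2 * (cg * (Ls * (norm (X t \<omega> - X t \<omega>))\<^sup>2)))"
      by (intro tendsto_ennrealI tendsto_intros Xr gr)
    then show "(\<lambda>n. ennreal (2 * ((g t - g (r n))\<^sup>2 * H) + 2 * (cg * (Ls * (norm (X t \<omega> - X (r n) \<omega>))\<^sup>2)))) \<longlonglongrightarrow> 0"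
      by simp
    show "\<forall>\<^sub>F n in sequentially. hsq I e (diffusion X t \<omega> - diffusion X (r n) \<omega>) \<le>
        ennreal (2 * ((g t - g (r n))\<^sup>2 * H) + 2 * (cg * (Ls * (norm (X t \<omega> - X (r n) \<omega>))\<^sup>2)))"
    proof (intro always_eventually allI)
      fix n
      \<comment> \<open>The split compares values of \<open>g\<close> at the fixed operator
        \<open>\<sigma> (X t \<omega>)\<close>, whose size \<open>H\<close> does not vary with
        \<open>n\<close>; the operator difference is multiplied by \<open>g (r n)\<close>, which
        \<open>cg\<close> controls.\<close>
      have "diffusion X t \<omega> - diffusion X (r n) \<omega> =
          (g t - g (r n)) *\<^sub>R \<sigma> (X t \<omega>) + g (r n) *\<^sub>R (\<sigma> (X t \<omega>) - \<sigma> (X (r n) \<omega>))"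
        by (simp add: diffusion_def scaleR_diff_left scaleR_diff_right)
      then have "hsq I e (diffusion X t \<omega> - diffusion X (r n) \<omega>) \<le>
         2 * (ennreal ((g t - g (r n))\<^sup>2) * hsq I e (\<sigma> (X t \<omega>))) +
         2 * (ennreal ((g (r n))\<^sup>2) * hsq I e (\<sigma> (X t \<omega>) - \<sigma> (X (r n) \<omega>)))"
        using hsq_add[of I e "(g t - g (r n)) *\<^sub>R \<sigma> (X t \<omega>)" "g (r n) *\<^sub>R (\<sigma> (X t \<omega>) - \<sigma> (X (r n) \<omega>))"]
        by (simp add: hsq_scaleR)
      also have "\<dots> \<le> 2 * (ennreal ((g t - g (r n))\<^sup>2) * ennreal H) +
         2 * (ennreal cg * ennreal (Ls * (norm (X t \<omega> - X (r n) \<omega>))\<^sup>2))"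
        unfolding H(1) by (intro add_mono mult_mono order_refl ennreal_leI g_bound r(1) \<sigma>_lipschitz) auto
      also have "\<dots> = ennreal (2 * ((g t - g (r n))\<^sup>2 * H) + 2 * (cg * (Ls * (norm (X t \<omega> - X (r n) \<omega>))\<^sup>2)))"
        using H(2) cg_nonneg Ls_nonneg by (simp add: ennreal_mult)
      finally show "hsq I e (diffusion X t \<omega> - diffusion X (r n) \<omega>) \<le>
        ennreal (2 * ((g t - g (r n))\<^sup>2 * H) + 2 * (cg * (Ls * (norm (X t \<omega> - X (r n) \<omega>))\<^sup>2)))" .
    qed
  qed auto
qed

lemma diffusion_integral_exists:
  assumes X: "L2_process X"
  obtains J where "ito_integral (diffusion X) J"
proof -
  have ca: "path_process X" and fin: "sup_sq_moment M T X < \<infinity>"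
    using X by (auto simp: L2_continuous_adapted_def)
  \<comment> \<open>Linear growth of \<open>\<sigma>\<close> around 0, evaluated at the supremum of
    the path: a bound for all times at once whose expectation is finite.\<close>
  define G where "G \<omega> = ennreal cg * (2 * (ennreal Ls * sup_sq T X \<omega>) + 2 * hsq I e (\<sigma> 0))" for \<omega>
  have TT: "T \<in> {0..T}" using T_pos by auto
  note [measurable] = sup_sq_measurable[OF continuous_adapted_ae[OF ca] TT]
  have G_meas[measurable]: "G \<in> borel_measurable M" unfolding G_def by measurable
  have \<sigma>0: "hsq I e (\<sigma> 0) < \<infinity>" using \<sigma>_hs[of 0] by (simp add: hilbert_schmidt_iff_hsq)
  have "(\<integral>\<^sup>+\<omega>. G \<omega> \<partial>M) = ennreal cg * (2 * (ennreal Ls * sup_sq_moment M T X) + 2 * hsq I e (\<sigma> 0))"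
    unfolding G_def sup_sq_moment_eq
    by (simp add: nn_integral_cmult nn_integral_add emeasure_space_1)
  then have G_fin: "(\<integral>\<^sup>+\<omega>. G \<omega> \<partial>M) < \<infinity>"
    using fin \<sigma>0 by (simp add: ennreal_mult_less_top)
  have bound: "hsq I e (diffusion X t \<omega>) \<le> G \<omega>" if t: "t \<in> {0..T}" for t \<omega>
  proof -
    have "hsq I e (\<sigma> (X t \<omega>)) \<le> 2 * hsq I e (\<sigma> (X t \<omega>) - \<sigma> 0) + 2 * hsq I e (\<sigma> 0)"
      using hsq_add[of I e "\<sigma> (X t \<omega>) - \<sigma> 0" "\<sigma> 0"] by simp
    also have "\<dots> \<le> 2 * (ennreal Ls * sup_sq T X \<omega>) + 2 * hsq I e (\<sigma> 0)"
    proof (intro add_mono mult_left_mono order_refl)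
      have "hsq I e (\<sigma> (X t \<omega>) - \<sigma> 0) \<le> ennreal Ls * ennreal ((norm (X t \<omega>))\<^sup>2)"
        using \<sigma>_lipschitz[of "X t \<omega>" 0] Ls_nonneg by (simp add: ennreal_mult)
      also have "\<dots> \<le> ennreal Ls * sup_sq T X \<omega>"
        by (intro mult_left_mono sup_sq_upper t) auto
      finally show "hsq I e (\<sigma> (X t \<omega>) - \<sigma> 0) \<le> ennreal Ls * sup_sq T X \<omega>" .
    qed auto
    finally show ?thesis
      unfolding diffusion_def hsq_scaleR G_def by (intro mult_mono ennreal_leI g_bound t) auto
  qed
  have "hs_sq_moment I e M T (diffusion X) < \<infinity>"
  proof -
    have "hs_sq_moment I e M T (diffusion X) = (\<integral>\<^sup>+\<omega>. (\<integral>\<^sup>+s\<in>{0..T}. hsq I e (diffusion X s \<omega>) \<partial>lborel) \<partial>M)"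
      by (intro hs_sq_moment_eq hilbert_schmidt_diffusion)
    also have "\<dots> \<le> (\<integral>\<^sup>+\<omega>. (\<integral>\<^sup>+s\<in>{0..T}. G \<omega> \<partial>lborel) \<partial>M)"
      by (intro nn_integral_mono) (auto split: split_indicator intro: bound)
    also have "\<dots> = (\<integral>\<^sup>+\<omega>. G \<omega> * ennreal T \<partial>M)"
      using T_pos by (simp add: nn_integral_cmult_indicator)
    also have "\<dots> = (\<integral>\<^sup>+\<omega>. G \<omega> \<partial>M) * ennreal T" by (simp add: nn_integral_multc)
    also have "\<dots> < \<infinity>" using G_fin by (simp add: ennreal_mult_less_top)
    finally show ?thesis .
  qed
  then have L2: "L2_integrand I e M F T (diffusion X)"
    using diffusion_op_measurable[OF ca] diffusion_adapted[OF ca] hilbert_schmidt_diffusion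
    by (auto simp: L2_integrand_def op_measurable_def)
  have "(\<lambda>n. hs_int T (\<lambda>t \<omega>. diffusion X t \<omega> - elementary_value (elementary_approx (diffusion X) n) t \<omega>)) \<longlonglongrightarrow> 0"
  proof (rule elementary_approximation[OF diffusion_adapted[OF ca] diffusion_op_measurable[OF ca] _ _ G_meas G_fin])
    show "(\<lambda>n. hsq I e (diffusion X t \<omega> - diffusion X (r n) \<omega>)) \<longlonglongrightarrow> 0"
      if "\<omega> \<in> space M" "t \<in> {0..T}" "\<And>n. r n \<in> {0..T}" "r \<longlonglongrightarrow> t" for \<omega> t r
      using ca that by (intro hsq_diffusion_continuous) (auto simp: continuous_adapted_def)
  qed (auto intro: bound)
  from stochastic_integral_exists[OF L2 elementary_approx_process[OF diffusion_adapted[OF ca]] this] that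
  show thesis by blast
qed

section \<open>The drift along a process\<close>

definition drift_int :: "(real \<Rightarrow> 'w \<Rightarrow> 'h) \<Rightarrow> real \<Rightarrow> 'w \<Rightarrow> 'h" where
  "drift_int X t \<omega> = (LINT s:{0..t}|lborel. b s (X s \<omega>))"

text \<open>Extension by 0, so that measurability in time and continuity in space hold on the whole
  line, as \<open>caratheodory_measurable\<close> requires.\<close>

definition b_cut :: "real \<Rightarrow> 'h \<Rightarrow> 'h" where
  "b_cut s x = indicat_real {0..T} s *\<^sub>R b s x"

lemma b_cut_measurable: "(\<lambda>s. b_cut s x) \<in> borel_measurable borel"
  using b_integrable[of x] unfolding set_integrable_def b_cut_def
  by (auto dest: borel_measurable_integrable)

lemma b_cut_continuous: "continuous_on UNIV (b_cut s)"
proof (cases "s \<in> {0..T}")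
  case True
  then show ?thesis using lipschitz_on_continuous_on[OF b_lipschitz[OF True]] by (simp add: b_cut_def[abs_def])
qed (simp add: b_cut_def[abs_def])

lemma b_diff: "s \<in> {0..T} \<Longrightarrow> norm (b s x - b s y) \<le> Lb * norm (x - y)"
  using lipschitz_onD[OF b_lipschitz, of s x y] by (simp add: dist_norm)

lemma joint_drift_measurable:
  assumes X: "\<And>s. s \<in> {0..t} \<Longrightarrow> X s \<in> borel_measurable N"
    and cont: "\<And>\<omega>. \<omega> \<in> space N \<Longrightarrow> continuous_on {0..t} (\<lambda>s. X s \<omega>)" and t: "t \<in> {0..T}"
  shows "(\<lambda>(\<omega>, s). indicat_real {0..t} s *\<^sub>R b s (X s \<omega>)) \<in> borel_measurable (N \<Otimes>\<^sub>M lborel)"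
proof -
  have [measurable]: "snd \<in> borel_measurable (N \<Otimes>\<^sub>M lborel)"
    using measurable_snd[of N lborel] by simp
  \<comment> \<open>Clamping keeps the time inside \<open>{0..t}\<close> for every real argument;
    the indicator of \<open>{0..t}\<close> later makes the clamp invisible.\<close>
  have "(\<lambda>p. X (max 0 (min t (snd p))) (fst p)) \<in> borel_measurable (N \<Otimes>\<^sub>M lborel)"
    by (rule joint_measurable_continuous[where t=t and N=N, OF X cont _ _ measurable_fst]) (use t in auto)
  from caratheodory_measurable[OF b_cut_measurable b_cut_continuous, OF _ this, of snd]
  have [measurable]: "(\<lambda>p. b_cut (snd p) (X (max 0 (min t (snd p))) (fst p))) \<in> borel_measurable (N \<Otimes>\<^sub>M lborel)"
    by simp
  have "(\<lambda>p. indicat_real {0..t} (snd p) *\<^sub>R b_cut (snd p) (X (max 0 (min t (snd p))) (fst p))) \<in> borel_measurable (N \<Otimes>\<^sub>M lborel)"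
    by measurable
  also have "(\<lambda>p. indicat_real {0..t} (snd p) *\<^sub>R b_cut (snd p) (X (max 0 (min t (snd p))) (fst p)))
     = (\<lambda>(\<omega>, s). indicat_real {0..t} s *\<^sub>R b s (X s \<omega>))"
    using t by (auto simp: fun_eq_iff b_cut_def indicator_def)
  finally show ?thesis .
qed

lemma drift_set_integrable:
  assumes X: "path_process X" and \<omega>: "\<omega> \<in> space M"
  shows "set_integrable lborel {0..T} (\<lambda>s. b s (X s \<omega>))"
proof -
  have TT: "T \<in> {0..T}" using T_pos by auto
  have c: "continuous_on {0..T} (\<lambda>s. X s \<omega>)" using X \<omega> by (auto simp: continuous_adapted_def)
  then have "compact ((\<lambda>s. X s \<omega>) ` {0..T})" by (rule compact_continuous_image) auto
  then have "bounded ((\<lambda>s. X s \<omega>) ` {0..T})" by (rule compact_imp_bounded)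
  then obtain B where B: "\<And>s. s \<in> {0..T} \<Longrightarrow> norm (X s \<omega>) \<le> B"
    unfolding bounded_iff by blast
  have "integrable lborel (\<lambda>s. indicat_real {0..T} s *\<^sub>R b s 0)"
    using b_integrable[of 0] by (simp add: set_integrable_def)
  moreover have "integrable lborel (\<lambda>s. indicat_real {0..T} s * (Lb * B))"
    by (intro integrable_mult_left integrable_real_indicator) (auto simp: emeasure_lborel_Icc_eq)
  \<comment> \<open>The drift at 0 is only integrable in time, not bounded, so it enters the
    dominating function as it is; the Lipschitz bound and the boundedness of a continuous path cover
    the rest.\<close>
  ultimately have dom: "integrable lborel (\<lambda>s. norm (indicat_real {0..T} s *\<^sub>R b s 0) + indicat_real {0..T} s * (Lb * B))"
    by (intro Bochner_Integration.integrable_add integrable_norm)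
  show ?thesis
    unfolding set_integrable_def
  proof (rule Bochner_Integration.integrable_bound[OF dom])
    show "(\<lambda>s. indicat_real {0..T} s *\<^sub>R b s (X s \<omega>)) \<in> borel_measurable lborel"
    proof -
      have "X s \<in> borel_measurable M" if "s \<in> {0..T}" for s
        by (rule measurable_F_M[of "X s" s]) (use X that in \<open>simp add: continuous_adapted_def\<close>)
      moreover have "continuous_on {0..T} (\<lambda>s. X s \<omega>)" if "\<omega> \<in> space M" for \<omega>
        using X that by (auto simp: continuous_adapted_def)
      ultimately have "(\<lambda>(\<omega>, s). indicat_real {0..T} s *\<^sub>R b s (X s \<omega>)) \<in> borel_measurable (M \<Otimes>\<^sub>M lborel)"
        by (rule joint_drift_measurable[OF _ _ TT])
      from measurable_compose[OF measurable_Pair1'[OF \<omega>] this] show ?thesis by simp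
    qed
    show "AE s in lborel. norm (indicat_real {0..T} s *\<^sub>R b s (X s \<omega>)) \<le>
        norm (norm (indicat_real {0..T} s *\<^sub>R b s 0) + indicat_real {0..T} s * (Lb * B))"
    proof (rule AE_I2)
      fix s
      show "norm (indicat_real {0..T} s *\<^sub>R b s (X s \<omega>)) \<le>
        norm (norm (indicat_real {0..T} s *\<^sub>R b s 0) + indicat_real {0..T} s * (Lb * B))"
      proof (cases "s \<in> {0..T}")
        case True
        have "norm (b s (X s \<omega>)) \<le> norm (b s 0) + norm (b s (X s \<omega>) - b s 0)"
          using norm_triangle_sub by blast
        also have "\<dots> \<le> norm (b s 0) + Lb * B"
          using b_diff[OF True, of "X s \<omega>" 0] mult_left_mono[OF B[OF True] Lb_nonneg] by simp
        finally show ?thesis using True by simp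
      qed simp
    qed
  qed
qed

lemma drift_int_adapted:
  assumes X: "path_process X" and t: "t \<in> {0..T}"
  shows "drift_int X t \<in> borel_measurable (F t)"
proof -
  have "X s \<in> borel_measurable (F t)" if "s \<in> {0..t}" for s
    using X t that by (intro measurable_F_mono[of "X s" s borel t]) (simp_all add: continuous_adapted_def)
  moreover have "continuous_on {0..t} (\<lambda>s. X s \<omega>)" if "\<omega> \<in> space (F t)" for \<omega>
    using X t that by (auto simp: continuous_adapted_def intro: continuous_on_subset)
  ultimately have "(\<lambda>(\<omega>, s). indicat_real {0..t} s *\<^sub>R b s (X s \<omega>)) \<in> borel_measurable (F t \<Otimes>\<^sub>M lborel)"
    by (rule joint_drift_measurable[OF _ _ t])
  then show ?thesis
    unfolding drift_int_def[abs_def] set_lebesgue_integral_def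
    by (rule sigma_finite_measure.borel_measurable_lebesgue_integral[OF sigma_finite_lborel])
qed

lemma continuous_set_integral:
  fixes f :: "real \<Rightarrow> 'h"
  assumes "set_integrable lborel {0..T} f"
  shows "continuous_on {0..T} (\<lambda>t. LINT s:{0..t}|lborel. f s)"
  unfolding continuous_on_sequentially set_lebesgue_integral_def comp_def
proof (intro allI ballI impI)
  fix r t assume t: "t \<in> {0..T}" and r: "(\<forall>n. r n \<in> {0..T}) \<and> r \<longlonglongrightarrow> t"
  have ind: "indicat_real {0..c} s *\<^sub>R f s = indicat_real {0..c} s *\<^sub>R (indicat_real {0..T} s *\<^sub>R f s)"
    if "c \<in> {0..T}" for c s
    using that by (auto split: split_indicator)
  have [measurable]: "(\<lambda>s. indicat_real {0..T} s *\<^sub>R f s) \<in> borel_measurable lborel"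
    using assms by (auto simp: set_integrable_def dest: borel_measurable_integrable)
  show "(\<lambda>n. \<integral>s. indicat_real {0..r n} s *\<^sub>R f s \<partial>lborel) \<longlonglongrightarrow> (\<integral>s. indicat_real {0..t} s *\<^sub>R f s \<partial>lborel)"
  proof (rule integral_dominated_convergence[where w="\<lambda>s. norm (indicat_real {0..T} s *\<^sub>R f s)"])
    show "integrable lborel (\<lambda>s. norm (indicat_real {0..T} s *\<^sub>R f s))"
      using assms by (intro integrable_norm) (simp add: set_integrable_def)
    show "(\<lambda>s. indicat_real {0..t} s *\<^sub>R f s) \<in> borel_measurable lborel"
      unfolding ind[OF t] by measurable
    show "(\<lambda>s. indicat_real {0..r n} s *\<^sub>R f s) \<in> borel_measurable lborel" for n
    proof -
      have rn: "r n \<in> {0..T}" using r by blast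
      show ?thesis unfolding ind[OF rn] by measurable
    qed
    show "AE s in lborel. norm (indicat_real {0..r n} s *\<^sub>R f s) \<le> norm (indicat_real {0..T} s *\<^sub>R f s)" for n
    proof -
      have "r n \<in> {0..T}" using r by blast
      then show ?thesis by (intro AE_I2) (auto split: split_indicator)
    qed
    \<comment> \<open>The indicators of the intervals \<open>{0..r n}\<close> converge everywhere
      except possibly at \<open>t\<close>.\<close>
    have "AE s in lborel. s \<noteq> t" by (rule AE_lborel_singleton)
    then show "AE s in lborel. (\<lambda>n. indicat_real {0..r n} s *\<^sub>R f s) \<longlonglongrightarrow> indicat_real {0..t} s *\<^sub>R f s"
    proof eventually_elim
      case (elim s)
      have "\<forall>\<^sub>F n in sequentially. indicat_real {0..r n} s *\<^sub>R f s = indicat_real {0..t} s *\<^sub>R f s"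
      proof (cases "s < t")
        case True
        with r have "\<forall>\<^sub>F n in sequentially. s < r n" by (intro order_tendstoD(1)) auto
        then show ?thesis by eventually_elim (use True in \<open>auto simp: indicator_def\<close>)
      next
        case False
        with elim have "t < s" by simp
        with r have "\<forall>\<^sub>F n in sequentially. r n < s" by (intro order_tendstoD(2)) auto
        then show ?thesis by eventually_elim (use \<open>t < s\<close> in \<open>auto simp: indicator_def\<close>)
      qed
      then show ?case by (rule tendsto_eventually)
    qed
  qed
qed

lemma drift_int_continuous_adapted:
  "path_process X \<Longrightarrow> path_process (drift_int X)"
  using drift_int_adapted[of X] continuous_set_integral[OF drift_set_integrable[of X]]
  by (auto simp: continuous_adapted_def drift_int_def)

abbreviation path_dist :: "real \<Rightarrow> (real \<Rightarrow> 'w \<Rightarrow> 'h) \<Rightarrow> (real \<Rightarrow> 'w \<Rightarrow> 'h) \<Rightarrow> 'w \<Rightarrow> ennreal" where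
  "path_dist t X Y \<omega> \<equiv> (\<integral>\<^sup>+s\<in>{0..t}. ennreal ((norm (X s \<omega> - Y s \<omega>))\<^sup>2) \<partial>lborel)"

text \<open>Cauchy--Schwarz in time: a squared integral over an interval of length at most
  \<open>T\<close> costs a factor \<open>T\<close>, and the Lipschitz bound the square of
  \<open>Lb\<close>.\<close>

lemma drift_int_diff_bound:
  assumes X: "path_process X" and Y: "path_process Y"
    and \<omega>: "\<omega> \<in> space M" and t: "t \<in> {0..T}"
  shows "sup_sq t (\<lambda>s \<omega>. drift_int X s \<omega> - drift_int Y s \<omega>) \<omega>
    \<le> ennreal (T * Lb\<^sup>2) * path_dist t X Y \<omega>"
proof (rule sup_sq_least)
  fix u assume u: "u \<in> {0..t}"
  have uT: "{0..u} \<subseteq> {0..T}" using u t by auto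
  have intX: "integrable lborel (\<lambda>s. indicat_real {0..u} s *\<^sub>R b s (X s \<omega>))"
    and intY: "integrable lborel (\<lambda>s. indicat_real {0..u} s *\<^sub>R b s (Y s \<omega>))"
    using set_integrable_subset[OF drift_set_integrable[OF X \<omega>] _ uT]
      set_integrable_subset[OF drift_set_integrable[OF Y \<omega>] _ uT] by (auto simp: set_integrable_def)
  have [measurable]: "(\<lambda>s. indicat_real {0..T} s *\<^sub>R (X s \<omega> - Y s \<omega>)) \<in> borel_measurable borel"
    using X Y \<omega> by (intro borel_measurable_continuous_on_indicator) (auto simp: continuous_adapted_def intro!: continuous_intros)
  \<comment> \<open>Path continuity is known only on \<open>{0..T}\<close>; with the indicator the
    distance is Borel on the whole line.\<close>
  define d where "d s = norm (indicat_real {0..T} s *\<^sub>R (X s \<omega> - Y s \<omega>))" for s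
  have d_meas[measurable]: "d \<in> borel_measurable borel" unfolding d_def by measurable
  have d_eq: "d s = norm (X s \<omega> - Y s \<omega>)" if "s \<in> {0..u}" for s
    using that uT by (auto simp: d_def)
  have "drift_int X u \<omega> - drift_int Y u \<omega> = (\<integral>s. indicat_real {0..u} s *\<^sub>R b s (X s \<omega>) - indicat_real {0..u} s *\<^sub>R b s (Y s \<omega>) \<partial>lborel)"
    unfolding drift_int_def set_lebesgue_integral_def using intX intY by simp
  also have "ennreal (norm \<dots>) \<le> (\<integral>\<^sup>+s. ennreal (norm (indicat_real {0..u} s *\<^sub>R b s (X s \<omega>) - indicat_real {0..u} s *\<^sub>R b s (Y s \<omega>))) \<partial>lborel)"
    by (rule integral_norm_bound_ennreal) (intro Bochner_Integration.integrable_diff intX intY)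
  also have "\<dots> \<le> (\<integral>\<^sup>+s. ennreal (Lb * d s) * indicator {0..u} s \<partial>lborel)"
  proof (intro nn_integral_mono)
    fix s
    show "ennreal (norm (indicat_real {0..u} s *\<^sub>R b s (X s \<omega>) - indicat_real {0..u} s *\<^sub>R b s (Y s \<omega>))) \<le> ennreal (Lb * d s) * indicator {0..u} s"
      using b_diff[of s "X s \<omega>" "Y s \<omega>"] uT d_eq[of s] by (auto split: split_indicator intro!: ennreal_leI)
  qed
  finally have "ennreal (norm (drift_int X u \<omega> - drift_int Y u \<omega>)) \<le> (\<integral>\<^sup>+s. ennreal (Lb * d s) * indicator {0..u} s \<partial>lborel)" .
  \<comment> \<open>The indicator is idempotent; its second copy is the function 1 against which
    Cauchy--Schwarz is applied.\<close>
  then have "(ennreal (norm (drift_int X u \<omega> - drift_int Y u \<omega>)))\<^sup>2 \<le> (\<integral>\<^sup>+s. (ennreal (Lb * d s) * indicator {0..u} s) * indicator {0..u} s \<partial>lborel)\<^sup>2"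
    by (intro power_mono) (auto simp: mult.assoc indicator_inter_arith[symmetric])
  also have "\<dots> \<le> (\<integral>\<^sup>+s. (ennreal (Lb * d s) * indicator {0..u} s)\<^sup>2 \<partial>lborel) * (\<integral>\<^sup>+s. (indicator {0..u} s)\<^sup>2 \<partial>lborel)"
    by (rule Cauchy_Schwarz_nn_integral) measurable
  also have "(\<integral>\<^sup>+s. (indicator {0..u} s)\<^sup>2 \<partial>lborel) = (\<integral>\<^sup>+s. indicator {0..u} s \<partial>lborel)"
    by (intro nn_integral_cong) (auto split: split_indicator)
  also have "\<dots> = ennreal u" using u by simp
  also have "(\<integral>\<^sup>+s. (ennreal (Lb * d s) * indicator {0..u} s)\<^sup>2 \<partial>lborel) =
      (\<integral>\<^sup>+s. ennreal (Lb\<^sup>2) * (ennreal ((d s)\<^sup>2) * indicator {0..u} s) \<partial>lborel)"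
    using Lb_nonneg by (intro nn_integral_cong) (auto simp: ennreal_power ennreal_mult[symmetric] power_mult_distrib d_def split: split_indicator)
  also have "\<dots> = ennreal (Lb\<^sup>2) * (\<integral>\<^sup>+s. ennreal ((d s)\<^sup>2) * indicator {0..u} s \<partial>lborel)"
    by (rule nn_integral_cmult) measurable
  also have "(\<integral>\<^sup>+s. ennreal ((d s)\<^sup>2) * indicator {0..u} s \<partial>lborel) \<le> path_dist t X Y \<omega>"
    using u d_eq by (intro nn_integral_mono) (auto split: split_indicator)
  finally have "(ennreal (norm (drift_int X u \<omega> - drift_int Y u \<omega>)))\<^sup>2 \<le>
     ennreal (Lb\<^sup>2) * path_dist t X Y \<omega> * ennreal u"
    by (simp add: mult_left_mono mult_right_mono)
  also have "\<dots> \<le> ennreal (Lb\<^sup>2) * path_dist t X Y \<omega> * ennreal T"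
    using u t by (intro mult_left_mono ennreal_leI) auto
  also have "\<dots> = ennreal (T * Lb\<^sup>2) * path_dist t X Y \<omega>"
    using T_pos by (simp add: ennreal_mult mult_ac)
  finally show "ennreal ((norm (drift_int X u \<omega> - drift_int Y u \<omega>))\<^sup>2) \<le>
    ennreal (T * Lb\<^sup>2) * path_dist t X Y \<omega>"
    by (simp add: ennreal_power)
qed

end

section \<open>Picard iteration\<close>

lemma nn_integral_exp_le:
  fixes lam t m :: real
  assumes "0 < lam" "0 \<le> t" "0 \<le> m"
  shows "ennreal lam * (\<integral>\<^sup>+r\<in>{0..t}. ennreal (m * exp (lam * r)) \<partial>lborel) \<le> ennreal (m * exp (lam * t))"
proof -
  have "(\<integral>\<^sup>+r\<in>{0..t}. ennreal (m * exp (lam * r)) \<partial>lborel) = ennreal (m / lam * exp (lam * t) - m / lam * exp (lam * 0))"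
  proof (rule nn_integral_FTC_Icc)
    show "((\<lambda>r. m / lam * exp (lam * r)) has_real_derivative m * exp (lam * r)) (at r)" for r
      using assms(1) by (auto intro!: derivative_eq_intros)
  qed (use assms in auto)
  also have "ennreal lam * \<dots> = ennreal (m * exp (lam * t) - m)"
  proof -
    have "m * 1 \<le> m * exp (lam * t)" using assms by (intro mult_left_mono) auto
    then have "0 \<le> m / lam * exp (lam * t) - m / lam * exp (lam * 0)"
      using assms(1) by (simp add: divide_right_mono)
    then show ?thesis
      using assms(1) by (subst ennreal_mult[symmetric]) (auto simp: right_diff_distrib)
  qed
  also have "\<dots> \<le> ennreal (m * exp (lam * t))"
    using assms by (intro ennreal_leI) simp
  finally show ?thesis .
qed

text \<open>Integrating the weight gains the factor \<open>1 / (16 * C)\<close>, so a multiplication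
  by \<open>C\<close> leaves \<open>1/16\<close>. Only monotonicity of \<open>nn_integral\<close> is
  used, so it applies to \<open>sup_dist\<close> as a function of time without a measurability
  proof.\<close>

lemma weighted_integral_bound:
  fixes C m t :: real and u :: "real \<Rightarrow> ennreal"
  assumes C: "0 < C" and m: "0 \<le> m" and t: "0 \<le> t"
    and u: "\<And>r. r \<in> {0..t} \<Longrightarrow> u r \<le> ennreal (m * exp (16 * C * r))"
  shows "ennreal C * (\<integral>\<^sup>+r\<in>{0..t}. u r \<partial>lborel) \<le> ennreal (m / 16 * exp (16 * C * t))"
proof -
  have "ennreal C * (\<integral>\<^sup>+r\<in>{0..t}. u r \<partial>lborel) \<le> ennreal C * (\<integral>\<^sup>+r\<in>{0..t}. ennreal (m * exp (16 * C * r)) \<partial>lborel)"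
    using u by (intro mult_left_mono nn_integral_mono) (auto split: split_indicator)
  also have "\<dots> = ennreal (1/16) * (ennreal (16 * C) * (\<integral>\<^sup>+r\<in>{0..t}. ennreal (m * exp (16 * C * r)) \<partial>lborel))"
    using C by (simp add: mult.assoc[symmetric] ennreal_mult[symmetric])
  also have "\<dots> \<le> ennreal (1/16) * ennreal (m * exp (16 * C * t))"
    using C m t by (intro mult_left_mono nn_integral_exp_le) auto
  also have "\<dots> = ennreal (m / 16 * exp (16 * C * t))"
    using m by (subst ennreal_mult[symmetric]) auto
  finally show ?thesis .
qed

text \<open>The inequality is iterated from the a priori bound \<open>B\<close>; each round divides
  the part stemming from \<open>B\<close> by 16. A finite starting bound is essential, since a
  function that is constantly infinite for positive times satisfies the same inequality when its
  integrals are infinite.\<close>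

lemma gronwall_weighted:
  fixes D :: "real \<Rightarrow> ennreal"
  assumes C: "0 < C" and a: "0 \<le> a" and T: "0 \<le> T" and fin: "\<And>t. t \<in> {0..T} \<Longrightarrow> D t \<le> ennreal B" "0 \<le> B"
    and D: "\<And>t. t \<in> {0..T} \<Longrightarrow> D t \<le> ennreal a + ennreal C * (\<integral>\<^sup>+r\<in>{0..t}. D r \<partial>lborel)"
  shows "D T \<le> ennreal (2 * a * exp (16 * C * T))"
proof -
  have step: "\<forall>t\<in>{0..T}. D t \<le> ennreal ((2 * a + B * (1/16)^n) * exp (16 * C * t))" for n
  proof (induction n)
    case 0
    show ?case
    proof
      fix t assume t: "t \<in> {0..T}"
      have "B * 1 \<le> (2 * a + B) * exp (16 * C * t)"
        using C a fin(2) t by (intro mult_mono) auto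
      then show "D t \<le> ennreal ((2 * a + B * (1/16)^0) * exp (16 * C * t))"
        using fin(1)[OF t] by (auto intro: order_trans ennreal_leI)
    qed
  next
    case (Suc n)
    show ?case
    proof
      fix t assume t: "t \<in> {0..T}"
      let ?m = "2 * a + B * (1/16)^n"
      have m: "0 \<le> ?m" using a fin(2) by simp
      have "D t \<le> ennreal a + ennreal C * (\<integral>\<^sup>+r\<in>{0..t}. D r \<partial>lborel)" by (rule D[OF t])
      also have "\<dots> \<le> ennreal a + ennreal (?m / 16 * exp (16 * C * t))"
        using Suc t by (intro add_left_mono weighted_integral_bound C m) auto
      also have "\<dots> = ennreal (a + ?m / 16 * exp (16 * C * t))"
        using a m by (subst ennreal_plus[symmetric]) (auto intro!: mult_nonneg_nonneg divide_nonneg_nonneg)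
      also have "\<dots> \<le> ennreal ((2 * a + B * (1/16)^Suc n) * exp (16 * C * t))"
      proof (rule ennreal_leI)
        have "1 \<le> exp (16 * C * t)" using C t by simp
        \<comment> \<open>Of \<open>2 * a\<close>, one round reproduces \<open>2 * a / 16\<close>;
          what is left of \<open>2 * a\<close> is \<open>15/8 * a\<close>, enough to absorb the new
          summand \<open>a\<close>.\<close>
        then have "a * 1 \<le> (15/8 * a) * exp (16 * C * t)" using a by (intro mult_mono) auto
        then show "a + ?m / 16 * exp (16 * C * t) \<le> (2 * a + B * (1/16)^Suc n) * exp (16 * C * t)"
          by (simp add: algebra_simps add_divide_distrib)
      qed
      finally show "D t \<le> ennreal ((2 * a + B * (1/16)^Suc n) * exp (16 * C * t))" .
    qed
  qed
  have "(\<lambda>n. ennreal ((2 * a + B * (1/16)^n) * exp (16 * C * T))) \<longlonglongrightarrow> ennreal ((2 * a + B * 0) * exp (16 * C * T))"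
    by (intro tendsto_ennrealI tendsto_intros LIMSEQ_power_zero) auto
  moreover have "\<forall>n. D T \<le> ennreal ((2 * a + B * (1/16)^n) * exp (16 * C * T))"
    using step T by auto
  ultimately show ?thesis using LIMSEQ_le_const by force
qed

context sde_space
begin

lemma L2_continuous_adaptedD:
  assumes "L2_process X"
  shows "path_process X" "ae_continuous_adapted X" "sup_sq_moment M T X < \<infinity>"
  using assms by (auto simp: L2_continuous_adapted_def continuous_adapted_ae)

section \<open>Lipschitz estimates for one iteration\<close>

lemma time_average_bound:
  fixes X Y :: "real \<Rightarrow> 'w \<Rightarrow> 'h"
  assumes X: "path_process X" and Y: "path_process Y" and t: "t \<in> {0..T}"
  shows "(\<integral>\<^sup>+\<omega>. path_dist t X Y \<omega> \<partial>M)
     \<le> (\<integral>\<^sup>+s\<in>{0..t}. sup_dist s X Y \<partial>lborel)"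
    and "(\<lambda>\<omega>. path_dist t X Y \<omega>) \<in> borel_measurable M"
proof -
  have tT: "t \<le> T" using t by auto
  interpret TS: sigma_finite_measure time_space by (rule sigma_finite_time_space)
  interpret P: pair_sigma_finite M time_space ..
  have XYm: "(\<lambda>\<omega>. X s \<omega> - Y s \<omega>) \<in> borel_measurable M" if "s \<in> {0..T}" for s
    by (rule measurable_F_M[of "\<lambda>\<omega>. X s \<omega> - Y s \<omega>" s], rule borel_measurable_diff)
      (use X Y that in \<open>simp_all add: continuous_adapted_def\<close>)
  have XYc: "continuous_on {0..T} (\<lambda>s. X s \<omega> - Y s \<omega>)" if "\<omega> \<in> space M" for \<omega>
    using X Y that by (auto simp: continuous_adapted_def intro: continuous_on_diff)
  have snd_m: "(\<lambda>p. snd p) \<in> borel_measurable (M \<Otimes>\<^sub>M time_space)"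
    by (rule measurable_compose[OF measurable_snd]) (auto intro: measurable_restrict_space1)
  note [measurable] = snd_m
  have [measurable]: "(\<lambda>p. X (snd p) (fst p) - Y (snd p) (fst p)) \<in> borel_measurable (M \<Otimes>\<^sub>M time_space)"
    by (rule joint_measurable_continuous[where t=T and N=M, OF XYm XYc snd_m _ measurable_fst])
      (auto simp: space_pair_measure space_restrict_space)
  have m: "(\<lambda>(\<omega>, s). ennreal ((norm (X s \<omega> - Y s \<omega>))\<^sup>2) * indicator {0..t} s) \<in> borel_measurable (M \<Otimes>\<^sub>M time_space)"
    unfolding case_prod_unfold by measurable
  show "(\<lambda>\<omega>. path_dist t X Y \<omega>) \<in> borel_measurable M"
    unfolding set_nn_integral_time_space[OF tT] by (rule TS.borel_measurable_nn_integral[OF m])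
  \<comment> \<open>Tonelli exchanges time and expectation; the squared distance at time
    \<open>s\<close> is then at most the running supremum up to \<open>s\<close>, which produces the
    quantity that the Gronwall argument tracks.\<close>
  have "(\<integral>\<^sup>+\<omega>. path_dist t X Y \<omega> \<partial>M)
     = (\<integral>\<^sup>+s. (\<integral>\<^sup>+\<omega>. ennreal ((norm (X s \<omega> - Y s \<omega>))\<^sup>2) * indicator {0..t} s \<partial>M) \<partial>time_space)"
    unfolding set_nn_integral_time_space[OF tT] by (rule P.Fubini'[OF m, symmetric])
  also have "\<dots> \<le> (\<integral>\<^sup>+s. sup_dist s X Y * indicator {0..t} s \<partial>time_space)"
  proof (rule nn_integral_mono)
    fix s
    show "(\<integral>\<^sup>+\<omega>. ennreal ((norm (X s \<omega> - Y s \<omega>))\<^sup>2) * indicator {0..t} s \<partial>M)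
       \<le> sup_dist s X Y * indicator {0..t} s"
    proof (cases "s \<in> {0..t}")
      case True
      then have "ennreal ((norm (X s \<omega> - Y s \<omega>))\<^sup>2) \<le> sup_sq s (\<lambda>s \<omega>. X s \<omega> - Y s \<omega>) \<omega>" for \<omega>
        using sup_sq_upper[of s s "\<lambda>s \<omega>. X s \<omega> - Y s \<omega>" \<omega>] by simp
      then show ?thesis using True unfolding sup_sq_moment_eq by (auto intro: nn_integral_mono)
    qed simp
  qed
  also have "\<dots> = (\<integral>\<^sup>+s\<in>{0..t}. sup_dist s X Y \<partial>lborel)"
    unfolding set_nn_integral_time_space[OF tT] ..
  finally show "(\<integral>\<^sup>+\<omega>. path_dist t X Y \<omega> \<partial>M)
     \<le> (\<integral>\<^sup>+s\<in>{0..t}. sup_dist s X Y \<partial>lborel)" .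
qed

lemma drift_moment_diff_bound:
  assumes X: "path_process X" and Y: "path_process Y" and t: "t \<in> {0..T}"
  shows "sup_dist t (drift_int X) (drift_int Y)
    \<le> ennreal (T * Lb\<^sup>2) * (\<integral>\<^sup>+s\<in>{0..t}. sup_dist s X Y \<partial>lborel)"
proof -
  have "sup_dist t (drift_int X) (drift_int Y)
    \<le> (\<integral>\<^sup>+\<omega>. ennreal (T * Lb\<^sup>2) * path_dist t X Y \<omega> \<partial>M)"
    unfolding sup_sq_moment_eq by (intro nn_integral_mono drift_int_diff_bound X Y t)
  also have "\<dots> = ennreal (T * Lb\<^sup>2) * (\<integral>\<^sup>+\<omega>. path_dist t X Y \<omega> \<partial>M)"
    by (rule nn_integral_cmult[OF time_average_bound(2)[OF X Y t]])
  finally show ?thesis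
    using time_average_bound(1)[OF X Y t] by (meson mult_left_mono order_trans zero_le)
qed

lemma diffusion_moment_diff_bound:
  assumes X: "path_process X" and Y: "path_process Y" and t: "t \<in> {0..T}"
  shows "hs_dist t (diffusion X) (diffusion Y)
    \<le> ennreal (cg * Ls) * (\<integral>\<^sup>+s\<in>{0..t}. sup_dist s X Y \<partial>lborel)"
proof -
  have "hs_dist t (diffusion X) (diffusion Y) \<le>
    (\<integral>\<^sup>+\<omega>. ennreal (cg * Ls) * path_dist t X Y \<omega> \<partial>M)"
    unfolding hs_int_def
  proof (rule nn_integral_mono)
    fix \<omega> assume \<omega>: "\<omega> \<in> space M"
    have "(\<lambda>s. indicat_real {0..t} s *\<^sub>R (X s \<omega> - Y s \<omega>)) \<in> borel_measurable borel"
      using X Y \<omega> t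
      by (intro borel_measurable_continuous_on_indicator continuous_on_diff)
        (auto simp: continuous_adapted_def intro: continuous_on_subset)
    then have "(\<lambda>s. ennreal ((norm (indicat_real {0..t} s *\<^sub>R (X s \<omega> - Y s \<omega>)))\<^sup>2)) \<in> borel_measurable borel"
      by measurable
    also have "(\<lambda>s. ennreal ((norm (indicat_real {0..t} s *\<^sub>R (X s \<omega> - Y s \<omega>)))\<^sup>2)) =
        (\<lambda>s. ennreal ((norm (X s \<omega> - Y s \<omega>))\<^sup>2) * indicator {0..t} s)"
      by (auto simp: fun_eq_iff split: split_indicator)
    finally have m: "(\<lambda>s. ennreal ((norm (X s \<omega> - Y s \<omega>))\<^sup>2) * indicator {0..t} s) \<in> borel_measurable lborel"
      by simp
    have "(\<integral>\<^sup>+s\<in>{0..t}. hsq I e (diffusion X s \<omega> - diffusion Y s \<omega>) \<partial>lborel)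
       \<le> (\<integral>\<^sup>+s. ennreal (cg * Ls) * (ennreal ((norm (X s \<omega> - Y s \<omega>))\<^sup>2) * indicator {0..t} s) \<partial>lborel)"
      using t by (intro nn_integral_mono) (auto split: split_indicator intro!: hsq_diffusion_diff)
    also have "\<dots> = ennreal (cg * Ls) * path_dist t X Y \<omega>"
      by (rule nn_integral_cmult[OF m])
    finally show "(\<integral>\<^sup>+s\<in>{0..t}. hsq I e (diffusion X s \<omega> - diffusion Y s \<omega>) \<partial>lborel)
       \<le> ennreal (cg * Ls) * path_dist t X Y \<omega>" .
  qed
  also have "\<dots> = ennreal (cg * Ls) * (\<integral>\<^sup>+\<omega>. path_dist t X Y \<omega> \<partial>M)"
    by (rule nn_integral_cmult[OF time_average_bound(2)[OF X Y t]])
  finally show ?thesis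
    using time_average_bound(1)[OF X Y t] by (meson mult_left_mono order_trans zero_le)
qed

text \<open>A relation, because the stochastic integral is one: many indistinguishable
  \<open>X'\<close> may follow the same \<open>X\<close>. A strong solution is exactly a process
  related to itself.\<close>

definition picard_step :: "('w \<Rightarrow> 'h) \<Rightarrow> (real \<Rightarrow> 'w \<Rightarrow> 'h) \<Rightarrow> (real \<Rightarrow> 'w \<Rightarrow> 'h) \<Rightarrow> bool" where
  "picard_step X0 X X' \<longleftrightarrow> L2_process X \<and> L2_process X' \<and>
     (\<exists>J. ito_integral (diffusion X) J \<and>
        (AE \<omega> in M. set_integrable lborel {0..T} (\<lambda>s. b s (X s \<omega>)) \<and>
           (\<forall>t\<in>{0..T}. X' t \<omega> = X0 \<omega> + drift_int X t \<omega> + J t \<omega>)))"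

lemma strong_solution_iff_picard_step:
  "strong_solution I e M F T W b (\<lambda>t x. g t *\<^sub>R \<sigma> x) X0 X \<longleftrightarrow> picard_step X0 X X"
  unfolding strong_solution_def picard_step_def drift_int_def diffusion_def[abs_def] by auto

definition initial_datum :: "('w \<Rightarrow> 'h) \<Rightarrow> bool" where
  "initial_datum X0 \<longleftrightarrow> X0 \<in> borel_measurable (F 0) \<and> integrable M (\<lambda>\<omega>. (norm (X0 \<omega>))\<^sup>2)"

lemma initial_datum_zero: "initial_datum (\<lambda>\<omega>. 0)"
  by (simp add: initial_datum_def)

lemma constant_continuous_adapted:
  assumes "X0 \<in> borel_measurable (F 0)"
  shows "path_process (\<lambda>t. X0)"
  using measurable_F_mono[OF assms] by (simp add: continuous_adapted_def)

lemma sup_sq_moment_constant: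
  "0 \<le> t \<Longrightarrow> sup_sq_moment M t (\<lambda>t. X0) = (\<integral>\<^sup>+\<omega>. ennreal ((norm (X0 \<omega>))\<^sup>2) \<partial>M)"
  unfolding sup_sq_moment_eq sup_sq_def by simp

lemma L2_continuous_adapted_zero: "L2_process (\<lambda>t \<omega>. 0)"
  unfolding L2_continuous_adapted_def
  using T_pos by (simp add: constant_continuous_adapted sup_sq_moment_constant)

text \<open>Compared with the drift along the zero process, which is deterministic and continuous in
  time, hence bounded.\<close>

lemma drift_int_L2:
  assumes X: "L2_process X"
  shows "L2_process (drift_int X)"
proof -
  let ?O = "\<lambda>t \<omega>. 0 :: 'h"
  have TT: "T \<in> {0..T}" using T_pos by auto
  note Xc = L2_continuous_adaptedD(1)[OF X] and Oc = L2_continuous_adaptedD(1)[OF L2_continuous_adapted_zero]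
  have ca: "path_process (drift_int X)" "path_process (drift_int ?O)"
    by (rule drift_int_continuous_adapted[OF Xc], rule drift_int_continuous_adapted[OF Oc])
  have "sup_sq_moment M T (drift_int X) =
      sup_sq_moment M T (\<lambda>t \<omega>. (drift_int X t \<omega> - drift_int ?O t \<omega>) + drift_int ?O t \<omega>)" by simp
  also have "\<dots> \<le> 2 * sup_dist T (drift_int X) (drift_int ?O) + 2 * sup_sq_moment M T (drift_int ?O)"
    by (intro sup_sq_moment_add ae_continuous_adapted_diff continuous_adapted_ae ca TT)
  also have "\<dots> < \<infinity>"
  proof -
    have "(\<integral>\<^sup>+s\<in>{0..T}. sup_sq_moment M s (\<lambda>s \<omega>. X s \<omega> - 0) \<partial>lborel) \<le> (\<integral>\<^sup>+s\<in>{0..T}. sup_sq_moment M T X \<partial>lborel)"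
      by (intro nn_integral_mono) (auto split: split_indicator intro!: sup_sq_moment_mono_time)
    also have "\<dots> = sup_sq_moment M T X * ennreal T"
      using T_pos by (simp add: nn_integral_cmult_indicator)
    also have "\<dots> < \<infinity>" using L2_continuous_adaptedD(3)[OF X] by (simp add: ennreal_mult_less_top)
    finally have "sup_dist T (drift_int X) (drift_int ?O) < \<infinity>"
      by (intro le_less_trans[OF drift_moment_diff_bound[OF Xc Oc TT]]) (simp add: ennreal_mult_less_top)
    moreover have "sup_sq_moment M T (drift_int ?O) < \<infinity>"
    proof -
      define \<beta> where "\<beta> t = (LINT s:{0..t}|lborel. b s 0)" for t
      have "compact (\<beta> ` {0..T})"
        unfolding \<beta>_def by (intro compact_continuous_image continuous_set_integral b_integrable) auto
      then have "bounded (\<beta> ` {0..T})" by (rule compact_imp_bounded)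
      then obtain B where B: "\<And>t. t \<in> {0..T} \<Longrightarrow> norm (\<beta> t) \<le> B" unfolding bounded_iff by blast
      have "sup_sq T (drift_int ?O) \<omega> \<le> ennreal (B\<^sup>2)" for \<omega>
        by (intro sup_sq_least ennreal_leI power_mono) (use B in \<open>auto simp: drift_int_def \<beta>_def\<close>)
      then have "sup_sq_moment M T (drift_int ?O) \<le> (\<integral>\<^sup>+\<omega>. ennreal (B\<^sup>2) \<partial>M)"
        unfolding sup_sq_moment_eq by (intro nn_integral_mono)
      also have "\<dots> < \<infinity>" by (simp add: emeasure_space_1)
      finally show ?thesis .
    qed
    ultimately show ?thesis by (simp add: ennreal_mult_less_top)
  qed
  finally show ?thesis using ca(1) by (simp add: L2_continuous_adapted_def)
qed

lemma L2_continuous_adapted_add: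
  assumes X: "L2_process X" and Y: "L2_process Y"
  shows "L2_process (\<lambda>t \<omega>. X t \<omega> + Y t \<omega> :: 'h)"
proof -
  have TT: "T \<in> {0..T}" using T_pos by auto
  have "sup_sq_moment M T (\<lambda>t \<omega>. X t \<omega> + Y t \<omega>) \<le> 2 * sup_sq_moment M T X + 2 * sup_sq_moment M T Y"
    by (intro sup_sq_moment_add L2_continuous_adaptedD X Y TT)
  also have "\<dots> < \<infinity>" using X Y by (simp add: L2_continuous_adapted_def ennreal_mult_less_top)
  finally show ?thesis
    using X Y by (auto simp: L2_continuous_adapted_def continuous_adapted_def intro: borel_measurable_add continuous_on_add)
qed

lemma initial_datum_L2:
  assumes "initial_datum X0"
  shows "L2_process (\<lambda>t. X0)"
  using assms T_pos unfolding L2_continuous_adapted_def initial_datum_def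
  by (simp add: constant_continuous_adapted sup_sq_moment_constant integrable_iff_bounded)

lemma picard_step_exists:
  assumes X0: "initial_datum X0" and X: "L2_process X"
  obtains X' where "picard_step X0 X X'"
proof -
  obtain J where J: "ito_integral (diffusion X) J"
    using diffusion_integral_exists[OF X] .
  then have JL: "L2_process J" by (simp add: has_stochastic_integral_def)
  have "L2_process (\<lambda>t \<omega>. X0 \<omega> + drift_int X t \<omega> + J t \<omega>)"
    by (intro L2_continuous_adapted_add drift_int_L2 X JL initial_datum_L2 X0)
  then have "picard_step X0 X (\<lambda>t \<omega>. X0 \<omega> + drift_int X t \<omega> + J t \<omega>)"
    unfolding picard_step_def
    using X J drift_set_integrable[OF L2_continuous_adaptedD(1)[OF X]] by auto
  then show thesis by (rule that)
qed

text \<open>\<open>4\<close> and \<open>64 = 4 * 16\<close> are the drift and diffusion constants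
  after two splittings with factor 2 each; the summand 1 makes the constant positive, as the weight
  requires.\<close>

definition lip_const :: real where
  "lip_const = 4 * (T * Lb\<^sup>2) + 64 * (cg * Ls) + 1"

lemma lip_const_pos: "0 < lip_const"
  unfolding lip_const_def using T_pos cg_nonneg Ls_nonneg by (intro add_nonneg_pos add_nonneg_nonneg mult_nonneg_nonneg) auto

text \<open>Allowing different initial data and unrelated inputs lets the one estimate serve
  uniqueness, convergence and the moment bound. The AE equations of the two steps decompose the
  difference into initial data, drift and integral.\<close>

lemma picard_step_diff:
  assumes X: "picard_step X0 X X'" and Y: "picard_step Y0 Y Y'"
    and X0: "initial_datum X0" and Y0: "initial_datum Y0" and t: "t \<in> {0..T}"
  shows "sup_dist t X' Y' \<le>
     2 * (\<integral>\<^sup>+\<omega>. ennreal ((norm (X0 \<omega> - Y0 \<omega>))\<^sup>2) \<partial>M) +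
     ennreal lip_const * (\<integral>\<^sup>+s\<in>{0..t}. sup_dist s X Y \<partial>lborel)"
proof -
  obtain J where J: "ito_integral (diffusion X) J"
    "AE \<omega> in M. \<forall>t\<in>{0..T}. X' t \<omega> = X0 \<omega> + drift_int X t \<omega> + J t \<omega>"
    using X unfolding picard_step_def by auto
  obtain K where K: "ito_integral (diffusion Y) K"
    "AE \<omega> in M. \<forall>t\<in>{0..T}. Y' t \<omega> = Y0 \<omega> + drift_int Y t \<omega> + K t \<omega>"
    using Y unfolding picard_step_def by auto
  have JK: "ae_continuous_adapted J" "ae_continuous_adapted K"
    using J(1) K(1) by (auto simp: has_stochastic_integral_def L2_continuous_adaptedD)
  have XY: "path_process X" "path_process Y"
    using X Y by (auto simp: picard_step_def L2_continuous_adaptedD)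
  have XY0: "ae_continuous_adapted (\<lambda>t. X0)" "ae_continuous_adapted (\<lambda>t. Y0)"
    using X0 Y0 by (auto simp: initial_datum_L2 L2_continuous_adaptedD)
  note ca = ae_continuous_adapted_diff ae_continuous_adapted_add continuous_adapted_ae drift_int_continuous_adapted JK XY XY0
  let ?S = "\<integral>\<^sup>+s\<in>{0..t}. sup_dist s X Y \<partial>lborel"
  have "sup_dist t X' Y' =
     sup_sq_moment M t (\<lambda>s \<omega>. (X0 \<omega> - Y0 \<omega>) + ((drift_int X s \<omega> - drift_int Y s \<omega>) + (J s \<omega> - K s \<omega>)))"
  proof (rule sup_sq_moment_cong_AE)
    show "AE \<omega> in M. \<forall>s\<in>{0..t}. X' s \<omega> - Y' s \<omega> = (X0 \<omega> - Y0 \<omega>) + ((drift_int X s \<omega> - drift_int Y s \<omega>) + (J s \<omega> - K s \<omega>))"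
      using J(2) K(2) by eventually_elim (use t in auto)
  qed
  also have "\<dots> \<le> 2 * sup_sq_moment M t (\<lambda>s \<omega>. X0 \<omega> - Y0 \<omega>) +
     2 * sup_sq_moment M t (\<lambda>s \<omega>. (drift_int X s \<omega> - drift_int Y s \<omega>) + (J s \<omega> - K s \<omega>))"
    by (intro sup_sq_moment_add ca t)
  also have "sup_sq_moment M t (\<lambda>s \<omega>. X0 \<omega> - Y0 \<omega>) = (\<integral>\<^sup>+\<omega>. ennreal ((norm (X0 \<omega> - Y0 \<omega>))\<^sup>2) \<partial>M)"
    using t by (intro sup_sq_moment_constant) auto
  also have "sup_sq_moment M t (\<lambda>s \<omega>. (drift_int X s \<omega> - drift_int Y s \<omega>) + (J s \<omega> - K s \<omega>)) \<le>
     2 * sup_dist t (drift_int X) (drift_int Y) + 2 * sup_dist t J K"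
    by (intro sup_sq_moment_add ca t)
  also have "\<dots> \<le> 2 * (ennreal (T * Lb\<^sup>2) * ?S) + 2 * (16 * (ennreal (cg * Ls) * ?S))"
  proof (intro add_mono mult_left_mono drift_moment_diff_bound XY t)
    show "sup_dist t J K \<le> 16 * (ennreal (cg * Ls) * ?S)"
      by (rule order_trans[OF stochastic_integral_diff_bound[OF J(1) K(1) t]])
        (intro mult_left_mono diffusion_moment_diff_bound XY t, simp)
  qed auto
  also have "2 * (2 * (ennreal (T * Lb\<^sup>2) * ?S) + 2 * (16 * (ennreal (cg * Ls) * ?S))) = ennreal (4 * (T * Lb\<^sup>2) + 64 * (cg * Ls)) * ?S"
    using T_pos cg_nonneg Ls_nonneg by (simp add: ennreal_plus ennreal_mult distrib_left distrib_right mult.assoc[symmetric])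
  also have "\<dots> \<le> ennreal lip_const * ?S"
    by (intro mult_right_mono ennreal_leI) (auto simp: lip_const_def)
  finally show ?thesis by (simp add: add_left_mono mult_left_mono)
qed

lemma sup_sq_moment_zero_AE:
  assumes "ae_continuous_adapted X" "sup_sq_moment M T X = 0"
  shows "AE \<omega> in M. \<forall>t\<in>{0..T}. X t \<omega> = 0"
proof -
  have TT: "T \<in> {0..T}" using T_pos by auto
  have "AE \<omega> in M. sup_sq T X \<omega> = 0"
    using assms sup_sq_measurable[OF assms(1) TT] by (simp add: sup_sq_moment_eq nn_integral_0_iff_AE)
  then show ?thesis by (simp add: sup_sq_eq_0_iff)
qed

section \<open>Fixed points of the Picard step\<close>

lemma picard_step_unique:
  assumes X: "picard_step X0 X X" and Y: "picard_step X0 Y Y" and X0: "initial_datum X0"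
  shows "AE \<omega> in M. \<forall>t\<in>{0..T}. Y t \<omega> = X t \<omega>"
proof -
  have TT: "T \<in> {0..T}" using T_pos by auto
  have XY: "L2_process X" "L2_process Y"
    using X Y by (auto simp: picard_step_def)
  let ?D = "\<lambda>t. sup_dist t Y X"
  \<comment> \<open>Membership of both solutions in the square-integrable class supplies the finite
    a priori bound for Gronwall; the additive constant is 0 since the initial data agree.\<close>
  have "?D T \<le> 2 * sup_sq_moment M T Y + 2 * sup_sq_moment M T X"
    by (intro sup_sq_moment_diff L2_continuous_adaptedD XY TT)
  also have "\<dots> < \<infinity>" using XY by (simp add: L2_continuous_adapted_def ennreal_mult_less_top)
  finally obtain B where B: "?D T = ennreal B" "0 \<le> B" by (auto simp: less_top_ennreal)
  have "?D T \<le> ennreal (2 * 0 * exp (16 * lip_const * T))"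
  proof (rule gronwall_weighted[OF lip_const_pos, where B=B])
    show "?D t \<le> ennreal B" if "t \<in> {0..T}" for t
      unfolding B(1)[symmetric] using that by (intro sup_sq_moment_mono_time) auto
    show "?D t \<le> ennreal 0 + ennreal lip_const * (\<integral>\<^sup>+r\<in>{0..t}. ?D r \<partial>lborel)" if "t \<in> {0..T}" for t
      using picard_step_diff[OF Y X X0 X0 that] by simp
  qed (use B T_pos in auto)
  then have "?D T = 0" by simp
  then have "AE \<omega> in M. \<forall>t\<in>{0..T}. Y t \<omega> - X t \<omega> = 0"
    by (intro sup_sq_moment_zero_AE ae_continuous_adapted_diff L2_continuous_adaptedD XY)
  then show ?thesis by simp
qed

text \<open>Only the output of the step is exchanged. Drift and integrand are taken along
  \<open>X\<close> both before and after, so the same integral \<open>J\<close> serves.\<close>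

lemma picard_step_cong_AE:
  assumes "picard_step X0 X X'" "AE \<omega> in M. \<forall>t\<in>{0..T}. X' t \<omega> = X t \<omega>"
  shows "picard_step X0 X X"
proof -
  obtain J where "ito_integral (diffusion X) J"
    and J: "AE \<omega> in M. set_integrable lborel {0..T} (\<lambda>s. b s (X s \<omega>)) \<and>
           (\<forall>t\<in>{0..T}. X' t \<omega> = X0 \<omega> + drift_int X t \<omega> + J t \<omega>)"
    using assms(1) unfolding picard_step_def by blast
  moreover have "AE \<omega> in M. set_integrable lborel {0..T} (\<lambda>s. b s (X s \<omega>)) \<and>
           (\<forall>t\<in>{0..T}. X t \<omega> = X0 \<omega> + drift_int X t \<omega> + J t \<omega>)"
    using J assms(2) by eventually_elim auto
  ultimately show ?thesis using assms(1) unfolding picard_step_def by blast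
qed

lemma picard_step_fixed_point:
  assumes X0: "initial_datum X0"
  obtains X where "picard_step X0 X X"
proof -
  have TT: "T \<in> {0..T}" using T_pos by auto
  \<comment> \<open>Dependent choice of a whole sequence of iterates, as a step does not determine
    its output.\<close>
  have "\<exists>X. \<forall>n. L2_process (X n) \<and> picard_step X0 (X n) (X (Suc n))"
  proof (rule dependent_nat_choice)
    show "\<exists>X. L2_process X" using L2_continuous_adapted_zero by blast
    show "\<exists>X'. L2_process X' \<and> picard_step X0 X X'" if "L2_process X" for X n
      using picard_step_exists[OF X0 that] by (metis picard_step_def)
  qed
  then obtain X where X: "\<And>n. L2_process (X n)" "\<And>n. picard_step X0 (X n) (X (Suc n))" by blast
  let ?D = "\<lambda>n t. sup_dist t (X (Suc n)) (X n)"
  have "?D 0 T \<le> 2 * sup_sq_moment M T (X (Suc 0)) + 2 * sup_sq_moment M T (X 0)"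
    by (intro sup_sq_moment_diff L2_continuous_adaptedD X TT)
  also have "\<dots> < \<infinity>" using X(1) by (simp add: L2_continuous_adapted_def ennreal_mult_less_top)
  finally obtain A where A: "?D 0 T = ennreal A" "0 \<le> A" by (auto simp: less_top_ennreal)
  have D: "\<forall>t\<in>{0..T}. ?D n t \<le> ennreal (A * (1/16)^n * exp (16 * lip_const * t))" for n
  proof (induction n)
    case 0
    show ?case
    proof
      fix t assume t: "t \<in> {0..T}"
      have "?D 0 t \<le> ?D 0 T" using t by (intro sup_sq_moment_mono_time) auto
      also have "\<dots> \<le> ennreal (A * exp (16 * lip_const * t))"
        unfolding A(1) using A(2) lip_const_pos t
        by (intro ennreal_leI) (simp add: mult_le_cancel_left1)
      finally show "?D 0 t \<le> ennreal (A * (1/16)^0 * exp (16 * lip_const * t))" by simp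
    qed
  next
    case (Suc n)
    show ?case
    proof
      fix t assume t: "t \<in> {0..T}"
      have "?D (Suc n) t \<le> ennreal lip_const * (\<integral>\<^sup>+s\<in>{0..t}. ?D n s \<partial>lborel)"
        using picard_step_diff[OF X(2)[of "Suc n"] X(2)[of n] X0 X0 t] by simp
      also have "\<dots> \<le> ennreal (A * (1/16)^n / 16 * exp (16 * lip_const * t))"
        using Suc t A(2) by (intro weighted_integral_bound lip_const_pos) auto
      finally show "?D (Suc n) t \<le> ennreal (A * (1/16)^Suc n * exp (16 * lip_const * t))" by simp
    qed
  qed
  obtain Y where Y: "L2_process Y"
    "(\<lambda>n. sup_dist T Y (X n)) \<longlonglongrightarrow> 0"
  proof (rule L2_continuous_limit[of X "A * exp (16 * lip_const * T)"])
    show "?D n T \<le> ennreal (A * exp (16 * lip_const * T) * (1/16)^n)" for n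
      using D[of n] TT by (auto simp: mult_ac)
    show "ae_continuous_adapted (X n)" "sup_sq_moment M T (X n) < \<infinity>" for n
      by (rule L2_continuous_adaptedD(2)[OF X(1)], rule L2_continuous_adaptedD(3)[OF X(1)])
  qed (use A(2) in auto)
  \<comment> \<open>One more step from the limit. \<open>Y'\<close> and \<open>X (Suc n)\<close> are
    outputs for the inputs \<open>Y\<close> and \<open>X n\<close>, whose distance tends to 0; so
    \<open>Y'\<close> is indistinguishable from \<open>Y\<close> and may be replaced by it.\<close>
  obtain Y' where Y': "picard_step X0 Y Y'" using picard_step_exists[OF X0 Y(1)] .
  have Y'L: "L2_process Y'" using Y' by (simp add: picard_step_def)
  let ?E = "\<lambda>n. sup_dist T Y (X n)"
  have "sup_dist T Y' Y \<le> 2 * (ennreal (lip_const * T) * ?E n) + 2 * ?E (Suc n)" for n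
  proof -
    have "sup_dist T Y' (X (Suc n)) \<le>
      ennreal lip_const * (\<integral>\<^sup>+s\<in>{0..T}. sup_dist s Y (X n) \<partial>lborel)"
      using picard_step_diff[OF Y' X(2)[of n] X0 X0 TT] by simp
    also have "\<dots> \<le> ennreal lip_const * (\<integral>\<^sup>+s\<in>{0..T}. ?E n \<partial>lborel)"
      by (intro mult_left_mono nn_integral_mono) (auto split: split_indicator intro!: sup_sq_moment_mono_time)
    also have "\<dots> = ennreal (lip_const * T) * ?E n"
    proof -
      have "(\<integral>\<^sup>+s\<in>{0..T}. ?E n \<partial>lborel) = ?E n * ennreal T"
        using T_pos by (subst nn_integral_cmult_indicator) auto
      then show ?thesis using T_pos lip_const_pos by (simp add: ennreal_mult mult_ac)
    qed
    finally have 1: "sup_dist T Y' (X (Suc n)) \<le> ennreal (lip_const * T) * ?E n" .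
    have "sup_dist T Y' Y =
      sup_sq_moment M T (\<lambda>t \<omega>. (Y' t \<omega> - X (Suc n) t \<omega>) - (Y t \<omega> - X (Suc n) t \<omega>))" by simp
    also have "\<dots> \<le> 2 * sup_dist T Y' (X (Suc n)) + 2 * ?E (Suc n)"
      by (intro sup_sq_moment_diff ae_continuous_adapted_diff L2_continuous_adaptedD X Y Y'L TT)
    also have "\<dots> \<le> 2 * (ennreal (lip_const * T) * ?E n) + 2 * ?E (Suc n)"
      by (intro add_right_mono mult_left_mono 1) simp
    finally show ?thesis .
  qed
  moreover have "(\<lambda>n. 2 * (ennreal (lip_const * T) * ?E n) + 2 * ?E (Suc n)) \<longlonglongrightarrow> 2 * (ennreal (lip_const * T) * 0) + 2 * 0"
    by (intro tendsto_add ennreal_tendsto_cmult Y(2) LIMSEQ_Suc) auto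
  ultimately have "sup_dist T Y' Y \<le> 2 * (ennreal (lip_const * T) * 0) + 2 * 0"
    by (intro LIMSEQ_le_const) auto
  then have "AE \<omega> in M. \<forall>t\<in>{0..T}. Y' t \<omega> - Y t \<omega> = 0"
    by (intro sup_sq_moment_zero_AE ae_continuous_adapted_diff L2_continuous_adaptedD Y Y'L) simp
  then have "picard_step X0 Y Y" by (intro picard_step_cong_AE[OF Y']) simp
  then show thesis by (rule that)
qed

text \<open>\<open>X\<close> is a step from itself and \<open>V\<close> a step from the zero
  process, so the bound on \<open>X - V\<close> contains the time integral of the moments of
  \<open>X\<close> itself, and Gronwall closes the estimate.\<close>

lemma moment_bound:
  "\<exists>C. \<forall>X0 X. initial_datum X0 \<and> picard_step X0 X X \<longrightarrow>
     sup_sq_moment M T X \<le> ennreal (C * (1 + (LINT \<omega>|M. (norm (X0 \<omega>))\<^sup>2)))"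
proof -
  have TT: "T \<in> {0..T}" using T_pos by auto
  \<comment> \<open>\<open>V\<close> has initial value 0 and input 0, so it depends only on the
    coefficients and the noise. This lets the constant be chosen before \<open>X0\<close>.\<close>
  obtain V where V: "picard_step (\<lambda>\<omega>. 0) (\<lambda>t \<omega>. 0) V"
    using picard_step_exists[OF initial_datum_zero L2_continuous_adapted_zero] .
  then have VL: "L2_process V" by (simp add: picard_step_def)
  then obtain v where v: "sup_sq_moment M T V = ennreal v" "0 \<le> v"
    by (auto simp: L2_continuous_adapted_def less_top_ennreal)
  define E where "E = exp (16 * (2 * lip_const) * T)"
  have "sup_sq_moment M T X \<le> ennreal ((4 * v + 8) * E * (1 + (LINT \<omega>|M. (norm (X0 \<omega>))\<^sup>2)))"
    if X0: "initial_datum X0" and X: "picard_step X0 X X" for X0 X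
  proof -
    have XL: "L2_process X" using X by (simp add: picard_step_def)
    then obtain B where B: "sup_sq_moment M T X = ennreal B" "0 \<le> B"
      by (auto simp: L2_continuous_adapted_def less_top_ennreal)
    define x where "x = (LINT \<omega>|M. (norm (X0 \<omega>))\<^sup>2)"
    have x: "0 \<le> x" unfolding x_def by simp
    have x_eq: "(\<integral>\<^sup>+\<omega>. ennreal ((norm (X0 \<omega>))\<^sup>2) \<partial>M) = ennreal x"
      unfolding x_def using X0 by (intro nn_integral_eq_integral) (auto simp: initial_datum_def)
    have "sup_sq_moment M T X \<le> ennreal (2 * (2 * v + 4 * x) * exp (16 * (2 * lip_const) * T))"
    proof (rule gronwall_weighted[where B=B])
      show "sup_sq_moment M t X \<le> ennreal B" if "t \<in> {0..T}" for t
        unfolding B(1)[symmetric] using that by (intro sup_sq_moment_mono_time) auto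
      show "sup_sq_moment M t X \<le> ennreal (2 * v + 4 * x) + ennreal (2 * lip_const) * (\<integral>\<^sup>+r\<in>{0..t}. sup_sq_moment M r X \<partial>lborel)"
        if t: "t \<in> {0..T}" for t
      proof -
        \<comment> \<open>Splitting off \<open>V\<close> costs the factor 2 that turns
          \<open>lip_const\<close> into \<open>2 * lip_const\<close> and produces the summands
          \<open>2 * v\<close> and \<open>4 * x\<close>.\<close>
        have "sup_sq_moment M t X = sup_sq_moment M t (\<lambda>s \<omega>. V s \<omega> + (X s \<omega> - V s \<omega>))" by simp
        also have "\<dots> \<le> 2 * sup_sq_moment M t V + 2 * sup_dist t X V"
          by (intro sup_sq_moment_add ae_continuous_adapted_diff L2_continuous_adaptedD XL VL t)
        also have "\<dots> \<le> 2 * ennreal v + 2 * (2 * ennreal x + ennreal lip_const * (\<integral>\<^sup>+r\<in>{0..t}. sup_sq_moment M r X \<partial>lborel))"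
        proof (intro add_mono mult_left_mono)
          show "sup_sq_moment M t V \<le> ennreal v"
            unfolding v(1)[symmetric] using t by (intro sup_sq_moment_mono_time) auto
          show "sup_dist t X V \<le> 2 * ennreal x + ennreal lip_const * (\<integral>\<^sup>+r\<in>{0..t}. sup_sq_moment M r X \<partial>lborel)"
            using picard_step_diff[OF X V X0 initial_datum_zero t] by (simp add: x_eq)
        qed auto
        also have "\<dots> = ennreal (2 * v + 4 * x) + ennreal (2 * lip_const) * (\<integral>\<^sup>+r\<in>{0..t}. sup_sq_moment M r X \<partial>lborel)"
          using v(2) x lip_const_pos by (simp add: ennreal_mult distrib_left mult.assoc[symmetric] add.assoc)
        finally show ?thesis .
      qed
    qed (use v(2) x B(2) T_pos lip_const_pos in auto)
    also have "\<dots> \<le> ennreal ((4 * v + 8) * E * (1 + x))"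
    proof (rule ennreal_leI)
      have "(4 * v + 8 * x) * E \<le> ((4 * v + 8) * (1 + x)) * E"
        using v(2) x by (intro mult_right_mono) (auto simp: E_def algebra_simps)
      then show "2 * (2 * v + 4 * x) * exp (16 * (2 * lip_const) * T) \<le> (4 * v + 8) * E * (1 + x)"
        by (simp add: E_def mult_ac)
    qed
    finally show ?thesis unfolding x_def .
  qed
  then show ?thesis by blast
qed

theorem strong_solution_well_posed:
  "\<exists>C::real. \<forall>X0. X0 \<in> borel_measurable (F 0) \<and> integrable M (\<lambda>\<omega>. (norm (X0 \<omega>))\<^sup>2) \<longrightarrow>
     (\<exists>X. strong_solution I e M F T W b (\<lambda>t x. g t *\<^sub>R \<sigma> x) X0 X \<and>
        (\<forall>Y. strong_solution I e M F T W b (\<lambda>t x. g t *\<^sub>R \<sigma> x) X0 Y \<longrightarrow>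
           (AE \<omega> in M. \<forall>t\<in>{0..T}. Y t \<omega> = X t \<omega>)) \<and>
        sup_sq_moment M T X \<le> ennreal (C * (1 + (LINT \<omega>|M. (norm (X0 \<omega>))\<^sup>2))))"
proof -
  obtain C where C: "\<And>X0 X. initial_datum X0 \<Longrightarrow> picard_step X0 X X \<Longrightarrow>
     sup_sq_moment M T X \<le> ennreal (C * (1 + (LINT \<omega>|M. (norm (X0 \<omega>))\<^sup>2)))"
    using moment_bound by blast
  show ?thesis
    unfolding strong_solution_iff_picard_step
  proof (rule exI[of _ C], intro allI impI)
    fix X0 :: "'w \<Rightarrow> 'h" assume "X0 \<in> borel_measurable (F 0) \<and> integrable M (\<lambda>\<omega>. (norm (X0 \<omega>))\<^sup>2)"
    then have X0: "initial_datum X0" by (simp add: initial_datum_def)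
    obtain X where X: "picard_step X0 X X" using picard_step_fixed_point[OF X0] .
    show "\<exists>X. picard_step X0 X X \<and> (\<forall>Y. picard_step X0 Y Y \<longrightarrow> (AE \<omega> in M. \<forall>t\<in>{0..T}. Y t \<omega> = X t \<omega>)) \<and>
        sup_sq_moment M T X \<le> ennreal (C * (1 + (LINT \<omega>|M. (norm (X0 \<omega>))\<^sup>2)))"
      using X picard_step_unique[OF X _ X0] C[OF X0 X] by blast
  qed
qed

end

section \<open>Well-posedness\<close>

theorem theorem4p2:
  fixes e :: "nat \<Rightarrow> 'h::{real_inner, banach, second_countable_topology}"
    and I :: "nat set"
    and q :: "nat \<Rightarrow> real"
    and Q :: "'h \<Rightarrow>\<^sub>L 'h"
    and D :: "'h \<Rightarrow> ('h \<Rightarrow>\<^sub>L 'h)"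
    and d_minus d_plus :: real
    and M :: "'w measure"
    and F :: "real \<Rightarrow> 'w measure"
    and W :: "real \<Rightarrow> 'h \<Rightarrow> 'w \<Rightarrow> real"
    and T :: real
    and b :: "real \<Rightarrow> 'h \<Rightarrow> 'h"
    and \<beta> :: "real \<Rightarrow> real"
    and beta_minus beta_plus :: real
  assumes basis: "orthonormal_basis I e"
    and Q_eigen: "\<And>k. k \<in> I \<Longrightarrow> Q (e k) = q k *\<^sub>R e k"
    and q_pos: "\<And>k. k \<in> I \<Longrightarrow> q k > 0"
    and q_summable: "q summable_on I"
    and D_positive: "\<And>x. positive_op (D x)"
    and d_bounds: "0 < d_minus" "d_minus \<le> d_plus"
    and D_bounds: "\<And>x y. d_minus * (y \<bullet> y) \<le> D x y \<bullet> y \<and> D x y \<bullet> y \<le> d_plus * (y \<bullet> y)"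
    and D_sqrt_lipschitz: "\<exists>L. L-lipschitz_on UNIV (\<lambda>x. sqrt_op (D x))"
    and prob: "prob_space M"
    and filt: "complete_filtration M F"
    and wiener: "cylindrical_wiener M F T W"
    and T_pos: "T > 0"
    and b_lipschitz: "\<exists>L. \<forall>t\<in>{0..T}. L-lipschitz_on UNIV (b t)"
    and b_integrable: "\<And>x. set_integrable lborel {0..T} (\<lambda>t. b t x)"
    and \<beta>_cont: "continuous_on {0..T} \<beta>"
    and \<beta>_bounds: "0 < beta_minus" "\<And>t. t \<in> {0..T} \<Longrightarrow> beta_minus \<le> \<beta> t \<and> \<beta> t \<le> beta_plus"
    and \<sigma>_lipschitz: "lipschitz_into_HS I e (\<lambda>x. sqrt_op (D x) o\<^sub>L sqrt_op Q)"
  shows "\<exists>C::real. \<forall>X0. X0 \<in> borel_measurable (F 0) \<and> integrable M (\<lambda>\<omega>. (norm (X0 \<omega>))\<^sup>2) \<longrightarrow>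
           (\<exists>X. strong_solution I e M F T W b
                   (\<lambda>t x. sqrt (\<beta> t) *\<^sub>R (sqrt_op (D x) o\<^sub>L sqrt_op Q)) X0 X \<and>
                (\<forall>Y. strong_solution I e M F T W b
                       (\<lambda>t x. sqrt (\<beta> t) *\<^sub>R (sqrt_op (D x) o\<^sub>L sqrt_op Q)) X0 Y \<longrightarrow>
                     (AE \<omega> in M. \<forall>t\<in>{0..T}. Y t \<omega> = X t \<omega>)) \<and>
                sup_sq_moment M T X
                  \<le> ennreal (C * (1 + (LINT \<omega>|M. (norm (X0 \<omega>))\<^sup>2))))"
proof -
  obtain Lb where Lb: "\<And>t. t \<in> {0..T} \<Longrightarrow> Lb-lipschitz_on UNIV (b t)"
    using b_lipschitz by blast
  obtain L where hs: "\<And>x. hilbert_schmidt I e (sqrt_op (D x) o\<^sub>L sqrt_op Q)"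
    and L: "\<And>x y. hs_norm I e ((sqrt_op (D x) o\<^sub>L sqrt_op Q) - (sqrt_op (D y) o\<^sub>L sqrt_op Q)) \<le> L * dist x y"
    using \<sigma>_lipschitz unfolding lipschitz_into_HS_def by blast
  have lip: "hsq I e ((sqrt_op (D x) o\<^sub>L sqrt_op Q) - (sqrt_op (D y) o\<^sub>L sqrt_op Q)) \<le> ennreal (L\<^sup>2 * (norm (x - y))\<^sup>2)" for x y
  proof -
    let ?A = "(sqrt_op (D x) o\<^sub>L sqrt_op Q) - (sqrt_op (D y) o\<^sub>L sqrt_op Q)"
    have "0 \<le> hs_norm I e ?A" by (simp add: hs_norm_def infsum_nonneg)
    \<comment> \<open>Squaring rests on the nonnegativity of the left side only. The sign of
      \<open>L\<close> stays open, and its square is a valid nonnegative constant.\<close>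
    then have "(hs_norm I e ?A)\<^sup>2 \<le> (L * dist x y)\<^sup>2" by (intro power_mono L)
    then show ?thesis
      unfolding hs_norm_sq_eq_hsq[OF hilbert_schmidt_diff[OF hs hs], symmetric]
      by (intro ennreal_leI) (simp add: power_mult_distrib dist_norm)
  qed
  interpret prob_space M by (rule prob)
  interpret sde_space M F T W I e b "\<lambda>t. sqrt (\<beta> t)" "\<lambda>x. sqrt_op (D x) o\<^sub>L sqrt_op Q" Lb "L\<^sup>2" beta_plus
  proof unfold_locales
    show "continuous_on {0..T} (\<lambda>t. sqrt (\<beta> t))" by (intro continuous_intros \<beta>_cont)
    \<comment> \<open>The positive lower bound on \<open>\<beta>\<close> makes the square of the
      root equal to \<open>\<beta> t\<close>.\<close>
    show "(sqrt (\<beta> t))\<^sup>2 \<le> beta_plus" if "t \<in> {0..T}" for t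
      using \<beta>_bounds(1) \<beta>_bounds(2)[OF that] by simp
  qed (use filt T_pos wiener basis Lb b_integrable hs lip in auto)
  show ?thesis by (rule strong_solution_well_posed)
qed

end
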